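(* Let $\mathbb{E}$ be an odometer-based system constructed as described in the context (construction of $\mathbb{E}$), equipped with its shift-invariant probability measure $\mu$. Then $\mathbb{E}$ is loosely Bernoulli.
   Context: **The $\overline f$ distance.** A match between two strings of symbols $a_1\cdots a_n$ and $b_1\cdots b_m$ is a collection $I$ of pairs $(i_s,j_s)$, $s=1,\dots,r$, with $1\le i_1<\cdots<i_r\le n$, $1\le j_1<\cdots<j_r\le m$ and $a_{i_s}=b_{j_s}$ for all $s$. Put $\overline f(a_1\cdots a_n,b_1\cdots b_m)=1-\frac{2\sup\{|I|: I\text{ a match}\}}{n+m}$. **Loosely Bernoulli.** Let $T$ be a measurable automorphism of a measurable space $(\Omega,\mathcal M)$ and $\mathcal P=\{P_\sigma:\sigma\in\Sigma\}$ a finite measurable partition. For $x,y\in\Omega$ with $T^i(x)\in P_{a_i}$, $T^i(y)\in P_{b_i}$ ($i=1,\dots,K$) put $\overline f_K(x,y)=\overline f(a_1\cdots a_K,b_1\cdots b_K)$. For probability measures $\nu,\omega$ on $(\Omega,\mathcal M)$ write $\overline f_K(\nu,\omega)<\varepsilon$ if there is an invertible measure-preserving map $\phi:(\Omega,\mathcal M,\nu)\to(\Omega,\mathcal M,\omega)$ and a set $G$ with $\nu(G)>1-\varepsilon$ and $\overline f_K(x,\phi(x))<\varepsilon$ for all $x\in G$. A measure-preserving process $(T,\mathcal P,\nu)$ is loosely Bernoulli if for every $\varepsilon>0$ there is a positive integer $K$ such that for every positive integer $M$ there is a collection $\mathcal G$ of atoms of $\bigvee_{i=-M}^0T^{-i}\mathcal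 P$ whose union has measure greater than $1-\varepsilon$ such that $\overline f_K(\nu_A,\nu_B)<\varepsilon$ for each pair $A,B\in\mathcal G$ of positive measure, where $\nu_A=\nu(\cdot|A)$. A measure-preserving transformation is loosely Bernoulli if the process is loosely Bernoulli for every finite partition $\mathcal P$ (equivalently, for one generating partition). **Odometer-based systems.** Let $\Sigma$ be a finite alphabet and $k_n\ge 2$ integers. An odometer-based construction sequence is a sequence of finite sets of words $\mathtt W_0=\Sigma$, $\mathtt W_{n+1}\subseteq(\mathtt W_n)^{k_n}$ (concatenations of $k_n$ words of $\mathtt W_n$), such that every $w\in\mathtt W_n$ occurs in every $w'\in\mathtt W_{n+1}$ and each $\mathtt W_n$ is uniquely readable (whenever $u,v,w\in \mathtt W_n$ and $uv=pws$, then $p$ or $s$ is empty). Words in $\mathtt W_n$ are called $n$-blocks and have length $\mathtt h_n=\prod_{i<n}k_i$. The associated system is the set of $x\in\Sigma^{\mathbb Z}$ all of whose finite substrings occur inside words of $\bigcup_n \mathtt W_n$, with the left shift. If the sequence is uniform (each $n$-block occurs the same number of times in each $(n+1)$-block), the system is equipped with the shift-invariant probability measure $\mu$ that gives a cylinder $\{x:x_0\cdots x_{k-1}=u\}$ the limiting frequency $\lim_n\#\{\text{occurrences of }u\text{ in }w_n\}/\mathtt h_n$, $w_n\in\mathtt W_n$. **Construction of $\mathbb E$.** Let $\mathtt W_0=\Sigma$ and $N(n)=|\mathtt W_n|$. Choose, for each $n\ge0$, a positive rational $\varepsilon_n<2^{-(n+12)}$ with $\varepsilon_nN(n)>2$,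 and then an integer $k_n$ such that $\varepsilon_nk_n$ is an integer and $k_n$ is a multiple of $N(n)$; put $k_n'=(1-\varepsilon_n)k_n$. Let $\tau_n$ be the probability that, when $k_n'$ symbols are chosen independently and uniformly from $\{1,\dots,N(n)-1\}$, some symbol is chosen more than $k_n/N(n)$ times. The $k_n$ are chosen large enough that $\sum_{n=1}^\infty N(n)^2/(\varepsilon_n^2k_n)<1/8$ and $\sum_{n=1}^\infty\tau_n^{(2^{-n})}<\infty$. Enumerate $\mathtt W_n=\{\mathtt y_1,\dots,\mathtt y_{N(n)}\}$. Then $\mathtt W_{n+1}$ consists of all words $\mathtt w_1\mathtt w_2\cdots\mathtt w_{k_n}$ with $\mathtt w_j\in\mathtt W_n$ such that: (1) for each $i\in\{1,\dots,N(n)-1\}$, $\#\{j\le k_n':\mathtt w_j=\mathtt y_i\}\le k_n/N(n)$, and $\mathtt w_j\ne\mathtt y_{N(n)}$ for $j\le k_n'$; (2) $\mathtt w_j=\mathtt y_{N(n)}$ for the last $k_n/N(n)$ indices $j$; (3) the remaining middle part $\mathtt w_{k_n'+1}\cdots\mathtt w_{k_n-k_n/N(n)}$ consists of a finite (possibly empty) string of $\mathtt y_1$'s, followed by a finite string of $\mathtt y_2$'s, etc., ending with a finite string of $\mathtt y_{N(n)-1}$'s, such that $\#\{j\le k_n:\mathtt w_j=\mathtt y_i\}=k_n/N(n)$ for every $i\in\{1,\dots,N(n)\}$. The sequence $(\mathtt W_n)$ is uniform and uniquely readable, and $\mathbb E$ is the associated odometer-based system. *)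

theory Defs
  imports "HOL-Probability.Probability" "HOL-Library.Sublist"
begin

section \<open>The f-bar distance\<close>

text \<open>Positions in words are counted from 0. Two distinct pairs of a match must be strictly
  ordered in the same direction in both coordinates, so that a match can be listed as
  \<open>(i\<^sub>1, j\<^sub>1), \<dots>, (i\<^sub>r, j\<^sub>r)\<close> with both coordinates strictly increasing.\<close>

definition is_match :: "'b list \<Rightarrow> 'b list \<Rightarrow> (nat \<times> nat) set \<Rightarrow> bool" where
  "is_match a b I \<longleftrightarrow>
     (\<forall>(i, j)\<in>I. i < length a \<and> j < length b \<and> a ! i = b ! j) \<and>
     (\<forall>(i, j)\<in>I. \<forall>(i', j')\<in>I.
        (i, j) = (i', j') \<or> i < i' \<and> j < j' \<or> i' < i \<and> j' < j)"

definition fbar :: "'b list \<Rightarrow> 'b list \<Rightarrow> real" where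
  "fbar a b = 1 - 2 * real (Max {card I |I. is_match a b I}) / real (length a + length b)"

section \<open>Loosely Bernoulli transformations\<close>

definition mp_automorphism :: "'b measure \<Rightarrow> ('b \<Rightarrow> 'b) \<Rightarrow> bool" where
  "mp_automorphism M T \<longleftrightarrow>
     prob_space M \<and> T \<in> M \<rightarrow>\<^sub>M M \<and> bij_betw T (space M) (space M) \<and>
     the_inv_into (space M) T \<in> M \<rightarrow>\<^sub>M M \<and> distr M M T = M"

definition finite_measurable_partition :: "'b measure \<Rightarrow> 'b set set \<Rightarrow> bool" where
  "finite_measurable_partition M P \<longleftrightarrow> finite P \<and> P \<subseteq> sets M \<and> partition_on (space M) P"

text \<open>The cells of a partition serve as their own labels: the name of \<open>x\<close> is the list of the
  cells containing \<open>T x, \<dots>, T\<^sup>K x\<close>.\<close>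

definition cell :: "'b set set \<Rightarrow> 'b \<Rightarrow> 'b set" where
  "cell P x = (THE A. A \<in> P \<and> x \<in> A)"

definition itinerary :: "('b \<Rightarrow> 'b) \<Rightarrow> 'b set set \<Rightarrow> nat \<Rightarrow> 'b \<Rightarrow> 'b set list" where
  "itinerary T P K x = map (\<lambda>i. cell P ((T ^^ i) x)) [1..<Suc K]"

text \<open>Maps between measure spaces are invertible in the usual sense of ergodic theory, that is,
  up to null sets. (The measures used below are conditional measures on different
  atoms, all living on the same measurable space.)\<close>

definition invertible_mp_map :: "'b measure \<Rightarrow> 'b measure \<Rightarrow> ('b \<Rightarrow> 'b) \<Rightarrow> bool" where
  "invertible_mp_map \<nu> \<omega> \<phi> \<longleftrightarrow>
     \<phi> \<in> \<nu> \<rightarrow>\<^sub>M \<omega> \<and> distr \<nu> \<omega> \<phi> = \<omega> \<and>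
     (\<exists>\<psi> \<in> \<omega> \<rightarrow>\<^sub>M \<nu>. (AE x in \<nu>. \<psi> (\<phi> x) = x) \<and> (AE y in \<omega>. \<phi> (\<psi> y) = y))"

definition fbar_close ::
  "('b \<Rightarrow> 'b) \<Rightarrow> 'b set set \<Rightarrow> nat \<Rightarrow> 'b measure \<Rightarrow> 'b measure \<Rightarrow> real \<Rightarrow> bool" where
  "fbar_close T P K \<nu> \<omega> \<epsilon> \<longleftrightarrow>
     (\<exists>\<phi> G. invertible_mp_map \<nu> \<omega> \<phi> \<and> G \<in> sets \<nu> \<and> measure \<nu> G > 1 - \<epsilon> \<and>
        (\<forall>x\<in>G. fbar (itinerary T P K x) (itinerary T P K (\<phi> x)) < \<epsilon>))"

text \<open>The atoms of \<open>\<Or>\<^bsub>i=-M\<^esub>\<^bsup>0\<^esup> T\<^sup>-\<^sup>i P\<close>. For \<open>i = -m\<close> the partition \<open>T\<^sup>-\<^sup>i P\<close> consists of the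
  forward images \<open>T\<^sup>m A\<close>, \<open>A \<in> P\<close> (for an automorphism \<open>T\<close>).\<close>

definition past_atoms :: "('b \<Rightarrow> 'b) \<Rightarrow> 'b set set \<Rightarrow> nat \<Rightarrow> 'b set set" where
  "past_atoms T P m =
     {B. B \<noteq> {} \<and> (\<exists>A. (\<forall>i\<le>m. A i \<in> P) \<and> B = (\<Inter>i\<le>m. (T ^^ i) ` A i))}"

text \<open>\<^const>\<open>uniform_measure\<close> \<open>M A\<close> is the conditional measure \<open>M(\<cdot> | A)\<close>, on all of the
  measurable space of \<open>M\<close>.\<close>

definition loosely_Bernoulli_process :: "'b measure \<Rightarrow> ('b \<Rightarrow> 'b) \<Rightarrow> 'b set set \<Rightarrow> bool" where
  "loosely_Bernoulli_process M T P \<longleftrightarrow>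
     (\<forall>\<epsilon>>0. \<exists>K>0. \<forall>m>0. \<exists>\<G>\<subseteq>past_atoms T P m.
        measure M (\<Union>\<G>) > 1 - \<epsilon> \<and>
        (\<forall>A\<in>\<G>. \<forall>B\<in>\<G>. measure M A > 0 \<longrightarrow> measure M B > 0 \<longrightarrow>
           fbar_close T P K (uniform_measure M A) (uniform_measure M B) \<epsilon>))"

definition loosely_Bernoulli :: "'b measure \<Rightarrow> ('b \<Rightarrow> 'b) \<Rightarrow> bool" where
  "loosely_Bernoulli M T \<longleftrightarrow>
     mp_automorphism M T \<and>
     (\<forall>P. finite_measurable_partition M P \<longrightarrow> loosely_Bernoulli_process M T P)"

section \<open>The system of a sequence of sets of words\<close>

definition word_system :: "(nat \<Rightarrow> 'a list set) \<Rightarrow> (int \<Rightarrow> 'a) set" where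
  "word_system W = {x. \<forall>i j. \<exists>n. \<exists>w\<in>W n. sublist (map x [i..j]) w}"

definition left_shift :: "(int \<Rightarrow> 'a) \<Rightarrow> int \<Rightarrow> 'a" where
  "left_shift x = (\<lambda>i. x (i + 1))"

definition occurrences :: "'a list \<Rightarrow> 'a list \<Rightarrow> nat" where
  "occurrences u w = card {i. i + length u \<le> length w \<and> take (length u) (drop i w) = u}"

text \<open>The shift-invariant probability measure on the system, with the product sigma-algebra, that
  gives every cylinder the limiting frequency of the word defining it. (All words in \<open>W n\<close> have
  the same length.)\<close>

definition is_frequency_measure ::
  "(nat \<Rightarrow> 'a list set) \<Rightarrow> (int \<Rightarrow> 'a) measure \<Rightarrow> bool" where
  "is_frequency_measure W \<mu> \<longleftrightarrow>
     prob_space \<mu> \<and>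
     space \<mu> = word_system W \<and>
     sets \<mu> = sets (restrict_space (\<Pi>\<^sub>M i\<in>(UNIV :: int set). count_space UNIV) (word_system W)) \<and>
     distr \<mu> \<mu> left_shift = \<mu> \<and>
     (\<forall>u w. (\<forall>n. w n \<in> W n) \<longrightarrow>
        (\<lambda>n. real (occurrences u (w n)) / real (length (w n)))
          \<longlonglongrightarrow> measure \<mu> {x \<in> space \<mu>. map x [0..int (length u) - 1] = u})"

section \<open>The construction\<close>

definition short_length :: "real \<Rightarrow> nat \<Rightarrow> nat" where
  "short_length \<epsilon> k = nat \<lfloor>(1 - \<epsilon>) * real k\<rfloor>"

text \<open>The probability that among \<open>k'\<close> independent uniform choices from \<open>{1..N - 1}\<close> some symbol is
  chosen more than \<open>k / N\<close> times.\<close>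

definition overflow_prob :: "nat \<Rightarrow> nat \<Rightarrow> nat \<Rightarrow> real" where
  "overflow_prob N k k' =
     measure_pmf.prob (Pi_pmf {..<k'} 0 (\<lambda>_. pmf_of_set {1..<N}))
       {c. \<exists>s\<in>{1..<N}. real (card {j. j < k' \<and> c j = s}) > real k / real N}"

text \<open>\<open>next_words V N y k k'\<close> is the next set of words, formed from the set \<open>V\<close> of \<open>N\<close> words
  enumerated as \<open>y 1, \<dots>, y N\<close>; it is used with \<open>N\<close> dividing \<open>k\<close>.\<close>

definition next_words ::
  "'a list set \<Rightarrow> nat \<Rightarrow> (nat \<Rightarrow> 'a list) \<Rightarrow> nat \<Rightarrow> nat \<Rightarrow> 'a list set" where
  "next_words V N y k k' =
     {concat ws |ws. length ws = k \<and> set ws \<subseteq> V \<and>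
        (\<forall>i\<in>{1..<N}. count_list (take k' ws) (y i) \<le> k div N) \<and>
        y N \<notin> set (take k' ws) \<and>
        drop (k - k div N) ws = replicate (k div N) (y N) \<and>
        (\<exists>m. drop k' (take (k - k div N) ws) = concat (map (\<lambda>i. replicate (m i) (y i)) [1..<N])) \<and>
        (\<forall>i\<in>{1..N}. count_list ws (y i) = k div N)}"

text \<open>The finite alphabet is the type \<open>'a\<close>. Term \<open>n\<close> of the two series below belongs to
  index \<open>n + 1\<close>.\<close>

locale E_construction =
  fixes W :: "nat \<Rightarrow> 'a::finite list set"
    and \<epsilon> :: "nat \<Rightarrow> real"
    and k :: "nat \<Rightarrow> nat"
    and y :: "nat \<Rightarrow> nat \<Rightarrow> 'a list"
  assumes W_0: "W 0 = {[a] |a. True}"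
    and eps_rational: "\<And>n. \<epsilon> n \<in> \<rat>"
    and eps_pos: "\<And>n. 0 < \<epsilon> n"
    and eps_less: "\<And>n. \<epsilon> n < 1 / 2 ^ (n + 12)"
    and eps_card: "\<And>n. \<epsilon> n * real (card (W n)) > 2"
    and k_ge_2: "\<And>n. k n \<ge> 2"
    and eps_k_int: "\<And>n. \<epsilon> n * real (k n) \<in> \<int>"
    and card_dvd_k: "\<And>n. card (W n) dvd k n"
    and summable_k: "summable (\<lambda>n. real (card (W (Suc n))) ^ 2 / (\<epsilon> (Suc n) ^ 2 * real (k (Suc n))))"
    and sum_k: "(\<Sum>n. real (card (W (Suc n))) ^ 2 / (\<epsilon> (Suc n) ^ 2 * real (k (Suc n)))) < 1 / 8"
    and summable_overflow:
      "summable (\<lambda>n. overflow_prob (card (W (Suc n))) (k (Suc n)) (short_length (\<epsilon> (Suc n)) (k (Suc n)))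
                       powr (1 / 2 ^ Suc n))"
    and enum: "\<And>n. bij_betw (y n) {1..card (W n)} (W n)"
    and W_Suc: "\<And>n. W (Suc n) =
                  next_words (W n) (card (W n)) (y n) (k n) (short_length (\<epsilon> n) (k n))"

end

(* Fix a finite partition P and let R be the joint process of P-names and symbols.  Since
   H(R_1 ... R_r) / r decreases to the entropy rate, the mutual information between the past of R
   and its next K symbols is at most delta K for large K, uniformly in the length of the past.
   A window of length K = L h_n consists, up to a small proportion, of n-blocks in the
   unconstrained initial parts of their (n+1)-, (n+2)-, ... blocks ("free" blocks).  Given their
   positions, the free blocks are almost independent and uniform, because only an asymptotically
   negligible proportion of the sequences of n-blocks is excluded by the frequency conditions.
   Hence, given the past, their entropy deficit is still small on average, and by Marton's
   coupling argument they can be matched with independent uniform blocks with few mismatches.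
   The positions of the free blocks may depend on the past, but f-bar ignores positions, so the
   conditional law of the future is f-bar close to the law of a concatenation of L independent
   uniform blocks, which does not depend on the past.  A P-name is, up to a small density of
   errors, a sliding block code of the symbols, so this carries over to P-names.  Finally, the
   measure has no atoms, so that couplings of conditional laws of names are realised by
   invertible maps. *)
theory Submission
  imports Defs "HOL-Real_Asymp.Real_Asymp"
begin

section \<open>Entropy of finitely supported distributions\<close>

text \<open>The coupling bound is linear, \<open>c * deficit + 1 / c\<close> per block, so what has
  to be small is the entropy deficit per n-block in absolute terms, not per symbol. The constraints
  of the construction cost about \<open>total_cost n\<close> per block, the tail of a series in
  \<tau> and \<open>1 / N\<close>. The past costs \<delta> per symbol, hence
  \<open>\<delta> * h n\<close> per block; therefore n is fixed before \<delta>, and \<delta> is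
  taken as \<open>\<theta>\<^sup>2 / h n\<close>. With \<open>c = 1 / \<theta>\<close> both
  contributions become multiples of \<theta>. The positions of the free blocks are not read off a
  point of the system. They are an additional random variable: a window cut out of a random word of
  level n + d carries positions, and a subsequential limit as d grows gives a joint law of positions
  and window whose second marginal is the law under \<mu>. Positions are attached to the process
  through the conditional law given the window, so they tell nothing about the past beyond what the
  window tells. Their own entropy may be large; it does no harm, since positions enter only as a
  condition.\<close>

definition ent :: "'x pmf \<Rightarrow> real" where
  "ent p = (\<Sum>x\<in>set_pmf p. - (pmf p x * ln (pmf p x)))"

lemma expectation_finite_pmf:
  fixes f :: "'x \<Rightarrow> real"
  assumes "finite (set_pmf p)"
  shows "measure_pmf.expectation p f = (\<Sum>x\<in>set_pmf p. pmf p x * f x)"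
  using integral_measure_pmf_real[of "set_pmf p" p f] assms by (simp add: mult.commute)

lemma ent_expectation:
  assumes "finite (set_pmf p)"
  shows "ent p = measure_pmf.expectation p (\<lambda>x. - ln (pmf p x))"
  by (simp add: expectation_finite_pmf[OF assms] ent_def sum_negf)

lemma ent_map:
  assumes "finite (set_pmf p)"
  shows "ent (map_pmf f p) = measure_pmf.expectation p (\<lambda>x. - ln (pmf (map_pmf f p) (f x)))"
  using assms by (subst ent_expectation) (simp_all add: integral_map_pmf)

lemma sum_pmf_marginal:
  assumes "finite A" "fst ` set_pmf q \<subseteq> A"
  shows "(\<Sum>a\<in>A. pmf q (a, c)) = pmf (map_pmf snd q) c"
proof -
  have "pmf (map_pmf snd q) c = measure q (snd -` {c})"
    by (simp add: pmf_map)
  also have "\<dots> = measure q (A \<times> {c})"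
    using assms(2) by (intro measure_pmf.finite_measure_eq_AE) (auto simp: AE_measure_pmf_iff)
  also have "\<dots> = (\<Sum>x\<in>A \<times> {c}. pmf q x)"
    using assms(1) by (simp add: measure_measure_pmf_finite)
  also have "\<dots> = (\<Sum>a\<in>A. pmf q (a, c))"
    by (rule sum.reindex_bij_witness[of _ "\<lambda>a. (a, c)" fst]) auto
  finally show ?thesis by simp
qed

lemma pmf_map_pos: "x \<in> set_pmf p \<Longrightarrow> pmf (map_pmf f p) (f x) > 0"
  by (intro pmf_positive) auto

text \<open>This is nonnegativity of the conditional mutual information of f and g given e. The
  function r is the density of the conditionally independent joining with respect to the actual
  joint law; its expectation is at most 1, and \<open>ln r \<le> r - 1\<close>.\<close>

theorem ent_submodular:
  assumes fin: "finite (set_pmf p)"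
  shows "ent (map_pmf (\<lambda>x. (f x, g x, e x)) p) + ent (map_pmf e p)
    \<le> ent (map_pmf (\<lambda>x. (f x, e x)) p) + ent (map_pmf (\<lambda>x. (g x, e x)) p)"
proof -
  define Q where "Q = map_pmf (\<lambda>x. (f x, g x, e x)) p"
  define F where "F = map_pmf (\<lambda>x. (f x, e x)) p"
  define G where "G = map_pmf (\<lambda>x. (g x, e x)) p"
  define E where "E = map_pmf e p"
  define r where "r = (\<lambda>(a, b, c). pmf F (a, c) * pmf G (b, c) / (pmf Q (a, b, c) * pmf E c))"
  define A where "A = f ` set_pmf p"
  define B where "B = g ` set_pmf p"
  define C where "C = e ` set_pmf p"
  have finABC: "finite A" "finite B" "finite C"
    using fin by (auto simp: A_def B_def C_def)
  have sF: "(\<Sum>a\<in>A. pmf F (a, c)) = pmf E c" for c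
    using sum_pmf_marginal[of A F c] finABC by (simp add: F_def E_def A_def pmf.map_comp o_def image_image)
  have sG: "(\<Sum>a\<in>B. pmf G (a, c)) = pmf E c" for c
    using sum_pmf_marginal[of B G c] finABC by (simp add: G_def E_def B_def pmf.map_comp o_def image_image)
  have setQ: "set_pmf Q \<subseteq> A \<times> B \<times> C"
    by (auto simp: Q_def A_def B_def C_def)
  have finQ: "finite (set_pmf Q)"
    using fin by (simp add: Q_def)
  have "measure_pmf.expectation p (\<lambda>x. r (f x, g x, e x)) = measure_pmf.expectation Q r"
    by (simp add: Q_def integral_map_pmf)
  also have "\<dots> = (\<Sum>t\<in>set_pmf Q. pmf Q t * r t)"
    by (rule expectation_finite_pmf[OF finQ])
  also have "\<dots> = (\<Sum>(a, b, c)\<in>set_pmf Q. pmf F (a, c) * pmf G (b, c) / pmf E c)"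
    by (intro sum.cong) (auto simp: r_def set_pmf_iff)
  \<comment> \<open>The conditionally independent joining may charge triples outside the support of
    Q, hence an inequality here.\<close>
  also have "\<dots> \<le> (\<Sum>(a, b, c)\<in>A \<times> B \<times> C. pmf F (a, c) * pmf G (b, c) / pmf E c)"
    using finABC setQ by (intro sum_mono2) auto
  also have "\<dots> = (\<Sum>a\<in>A. \<Sum>b\<in>B. \<Sum>c\<in>C. pmf F (a, c) * pmf G (b, c) / pmf E c)"
    by (simp add: sum.cartesian_product)
  also have "\<dots> = (\<Sum>a\<in>A. \<Sum>c\<in>C. \<Sum>b\<in>B. pmf F (a, c) * pmf G (b, c) / pmf E c)"
    by (intro sum.cong refl sum.swap)
  also have "\<dots> = (\<Sum>c\<in>C. \<Sum>a\<in>A. \<Sum>b\<in>B. pmf F (a, c) * pmf G (b, c) / pmf E c)"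
    by (rule sum.swap)
  also have "\<dots> = (\<Sum>c\<in>C. pmf E c * pmf E c / pmf E c)"
  proof (intro sum.cong refl)
    fix c
    have "(\<Sum>a\<in>A. \<Sum>b\<in>B. pmf F (a, c) * pmf G (b, c) / pmf E c)
        = (\<Sum>a\<in>A. pmf F (a, c)) * (\<Sum>b\<in>B. pmf G (b, c)) / pmf E c"
      by (simp only: sum_product sum_divide_distrib)
    then show "(\<Sum>a\<in>A. \<Sum>b\<in>B. pmf F (a, c) * pmf G (b, c) / pmf E c) = pmf E c * pmf E c / pmf E c"
      by (simp only: sF sG)
  qed
  also have "\<dots> = (\<Sum>c\<in>C. pmf E c)"
    by (intro sum.cong) auto
  also have "\<dots> = 1"
    using finABC by (intro sum_pmf_eq_1) (auto simp: E_def C_def)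
  finally have r1: "measure_pmf.expectation p (\<lambda>x. r (f x, g x, e x)) \<le> 1" .
  have int: "integrable (measure_pmf p) h" for h :: "_ \<Rightarrow> real"
    by (rule integrable_measure_pmf_finite[OF fin])
  have "ent Q + ent E - ent F - ent G = measure_pmf.expectation p
      (\<lambda>x. - ln (pmf Q (f x, g x, e x)) - ln (pmf E (e x)) + ln (pmf F (f x, e x)) + ln (pmf G (g x, e x)))"
    unfolding Q_def E_def F_def G_def by (simp add: ent_map[OF fin] int)
  also have "\<dots> \<le> measure_pmf.expectation p (\<lambda>x. r (f x, g x, e x) - 1)"
  proof (intro integral_mono_AE int AE_pmfI)
    fix x assume x: "x \<in> set_pmf p"
    have pos: "pmf Q (f x, g x, e x) > 0" "pmf E (e x) > 0" "pmf F (f x, e x) > 0" "pmf G (g x, e x) > 0"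
      using pmf_map_pos[OF x] by (auto simp: Q_def E_def F_def G_def)
    have "- ln (pmf Q (f x, g x, e x)) - ln (pmf E (e x)) + ln (pmf F (f x, e x)) + ln (pmf G (g x, e x))
        = ln (r (f x, g x, e x))"
      using pos by (simp add: r_def ln_div ln_mult)
    also have "\<dots> \<le> r (f x, g x, e x) - 1"
      using pos by (intro ln_le_minus_one) (simp add: r_def)
    finally show "- ln (pmf Q (f x, g x, e x)) - ln (pmf E (e x)) + ln (pmf F (f x, e x)) + ln (pmf G (g x, e x))
      \<le> r (f x, g x, e x) - 1" .
  qed
  also have "\<dots> \<le> 0"
    using r1 by (simp add: int)
  finally show ?thesis
    by (simp add: Q_def E_def F_def G_def)
qed

lemma ent_map_inj:
  assumes "finite (set_pmf p)" "inj_on f (set_pmf p)"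
  shows "ent (map_pmf f p) = ent p"
  unfolding ent_map[OF assms(1)] ent_expectation[OF assms(1)]
  by (intro integral_cong_AE) (auto simp: AE_measure_pmf_iff pmf_map_inj[OF assms(2)])

lemma ent_map_le:
  assumes fin: "finite (set_pmf p)"
  shows "ent (map_pmf f p) \<le> ent p"
  unfolding ent_map[OF fin] ent_expectation[OF fin]
proof (intro integral_mono_AE integrable_measure_pmf_finite fin AE_pmfI)
  fix x assume x: "x \<in> set_pmf p"
  have "measure p {x} \<le> measure p (f -` {f x})"
    by (intro measure_pmf.finite_measure_mono) auto
  then have "pmf p x \<le> pmf (map_pmf f p) (f x)"
    by (simp add: measure_pmf_single pmf_map)
  then show "- ln (pmf (map_pmf f p) (f x)) \<le> - ln (pmf p x)"
    using pmf_positive[OF x] by simp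
qed

text \<open>Entropy depends only on the partition of the support into level sets. This is the device
  for dropping redundant coordinates and regrouping tuples.\<close>

lemma ent_map_cong_inj:
  assumes fin: "finite (set_pmf p)"
    and "\<And>x y. x \<in> set_pmf p \<Longrightarrow> y \<in> set_pmf p \<Longrightarrow> f x = f y \<longleftrightarrow> g x = g y"
  shows "ent (map_pmf f p) = ent (map_pmf g p)"
proof -
  have "pmf (map_pmf f p) (f x) = pmf (map_pmf g p) (g x)" if "x \<in> set_pmf p" for x
    unfolding pmf_map using assms(2)[OF _ that]
    by (intro measure_pmf.finite_measure_eq_AE) (auto simp: AE_measure_pmf_iff)
  then show ?thesis
    unfolding ent_map[OF fin] by (intro integral_cong_AE) (auto simp: AE_measure_pmf_iff)
qed

lemma ent_nonneg: "ent p \<ge> 0"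
  unfolding ent_def
  by (intro sum_nonneg) (auto simp: pmf_le_1 pmf_positive mult_nonneg_nonpos)

lemma ent_return: "ent (return_pmf x) = 0"
  by (simp add: ent_def)

lemma ent_subadditive:
  assumes fin: "finite (set_pmf p)"
  shows "ent (map_pmf (\<lambda>x. (f x, g x)) p) \<le> ent (map_pmf f p) + ent (map_pmf g p)"
proof -
  have "ent (map_pmf (\<lambda>x. (f x, g x, ())) p) = ent (map_pmf (\<lambda>x. (f x, g x)) p)"
    "ent (map_pmf (\<lambda>x. (f x, ())) p) = ent (map_pmf f p)"
    "ent (map_pmf (\<lambda>x. (g x, ())) p) = ent (map_pmf g p)"
    by (auto intro!: ent_map_cong_inj[OF fin])
  moreover have "ent (map_pmf (\<lambda>x. ()) p) = 0"
    by (simp add: ent_return map_pmf_const)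
  ultimately show ?thesis
    using ent_submodular[OF fin, of f g "\<lambda>_. ()"] by simp
qed

section \<open>Mutual information\<close>

definition mutual :: "('x \<Rightarrow> 'y) \<Rightarrow> ('x \<Rightarrow> 'z) \<Rightarrow> 'x pmf \<Rightarrow> real" where
  "mutual f g p = ent (map_pmf f p) + ent (map_pmf g p) - ent (map_pmf (\<lambda>x. (f x, g x)) p)"

text \<open>Data processing: submodularity with \<open>h (g x)\<close> as the conditioning variable,
  where \<open>(f, g, h g)\<close> carries the same information as \<open>(f, g)\<close>.\<close>

lemma mutual_le_right:
  assumes fin: "finite (set_pmf p)"
  shows "mutual f (\<lambda>x. h (g x)) p \<le> mutual f g p"
proof -
  have "ent (map_pmf (\<lambda>x. (f x, g x, h (g x))) p) = ent (map_pmf (\<lambda>x. (f x, g x)) p)"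
    "ent (map_pmf (\<lambda>x. (g x, h (g x))) p) = ent (map_pmf g p)"
    by (auto intro!: ent_map_cong_inj[OF fin])
  then show ?thesis
    using ent_submodular[OF fin, of f g "\<lambda>x. h (g x)"] by (simp add: mutual_def)
qed

lemma mutual_commute:
  assumes fin: "finite (set_pmf p)"
  shows "mutual f g p = mutual g f p"
proof -
  have "ent (map_pmf (\<lambda>x. (f x, g x)) p) = ent (map_pmf (\<lambda>x. (g x, f x)) p)"
    by (auto intro!: ent_map_cong_inj[OF fin])
  then show ?thesis by (simp add: mutual_def)
qed

lemma mutual_mono:
  assumes fin: "finite (set_pmf p)"
  shows "mutual (\<lambda>x. h (f x)) (\<lambda>x. k (g x)) p \<le> mutual f g p"
  using mutual_le_right[OF fin, of "\<lambda>x. h (f x)" k g] mutual_le_right[OF fin, of g h f]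
  by (simp add: mutual_commute[OF fin, of g] )

section \<open>Disintegration of joint laws and the chain rule\<close>

lemma pmf_bind_Pair:
  "pmf (bind_pmf q (\<lambda>a. map_pmf (Pair a) (\<kappa> a))) (a, b) = pmf q a * pmf (\<kappa> a) b"
proof -
  have "pmf (map_pmf (Pair a') (\<kappa> a')) (a, b) = indicator {a} a' * pmf (\<kappa> a) b" for a'
  proof (cases "a' = a")
    case True
    then show ?thesis by (simp add: pmf_map_inj' inj_on_def)
  next
    case False
    then have "(a, b) \<notin> set_pmf (map_pmf (Pair a') (\<kappa> a'))" by auto
    then have "pmf (map_pmf (Pair a') (\<kappa> a')) (a, b) = 0"
      by (simp only: set_pmf_iff not_not)
    then show ?thesis using False by simp
  qed
  then show ?thesis
    unfolding pmf_bind by (simp add: measure_pmf_single)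
qed

text \<open>Off the support of the first marginal the kernel is arbitrary, because
  \<open>cond_pmf\<close> carries information only for sets of positive mass. Every later use
  restricts to that support.\<close>

lemma pmf_disintegrate:
  obtains \<kappa> where "p = bind_pmf (map_pmf fst p) (\<lambda>a. map_pmf (Pair a) (\<kappa> a))"
proof -
  define \<kappa> where "\<kappa> a = map_pmf snd (cond_pmf p (fst -` {a}))" for a
  have "pmf p (a, b) = pmf (map_pmf fst p) a * pmf (\<kappa> a) b" for a b
  proof (cases "a \<in> fst ` set_pmf p")
    case True
    then have ne: "set_pmf p \<inter> fst -` {a} \<noteq> {}" by auto
    have pos: "measure p (fst -` {a}) > 0"
      using True pmf_positive[of a "map_pmf fst p"] by (simp add: pmf_map)
    have "pmf (\<kappa> a) b = measure (cond_pmf p (fst -` {a})) (snd -` {b})"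
      by (simp add: \<kappa>_def pmf_map)
    also have "\<dots> = measure (cond_pmf p (fst -` {a})) {(a, b)}"
      by (intro measure_pmf.finite_measure_eq_AE) (auto simp: AE_measure_pmf_iff set_cond_pmf[OF ne])
    also have "\<dots> = pmf p (a, b) / measure p (fst -` {a})"
      by (simp add: measure_pmf_single pmf_cond[OF ne])
    finally show ?thesis using pos by (simp add: pmf_map)
  next
    case False
    then have "pmf p (a, b) = 0" by (force simp: set_pmf_iff)
    moreover have "pmf (map_pmf fst p) a = 0"
      using False by (metis set_map_pmf set_pmf_iff)
    ultimately show ?thesis by simp
  qed
  then have "p = bind_pmf (map_pmf fst p) (\<lambda>a. map_pmf (Pair a) (\<kappa> a))"
    by (intro pmf_eqI) (simp add: pmf_bind_Pair split_paired_all)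
  then show thesis by (rule that)
qed

lemma expectation_bind_finite:
  fixes h :: "'y \<Rightarrow> real"
  assumes "finite (set_pmf p)" "\<And>x. x \<in> set_pmf p \<Longrightarrow> finite (set_pmf (f x))"
  shows "measure_pmf.expectation (bind_pmf p f) h = (\<Sum>x\<in>set_pmf p. pmf p x * measure_pmf.expectation (f x) h)"
  using pmf_expectation_bind[of "set_pmf p" f p h] assms by simp

text \<open>Chain rule: the second summand is the conditional entropy, written as an average over
  the kernel.\<close>

lemma ent_bind_Pair:
  assumes finq: "finite (set_pmf q)" and fin\<kappa>: "\<And>a. a \<in> set_pmf q \<Longrightarrow> finite (set_pmf (\<kappa> a))"
  shows "ent (bind_pmf q (\<lambda>a. map_pmf (Pair a) (\<kappa> a))) = ent q + (\<Sum>a\<in>set_pmf q. pmf q a * ent (\<kappa> a))"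
proof -
  let ?p = "bind_pmf q (\<lambda>a. map_pmf (Pair a) (\<kappa> a))"
  have finp: "finite (set_pmf ?p)" using assms by auto
  have "ent ?p = (\<Sum>a\<in>set_pmf q. pmf q a * measure_pmf.expectation (\<kappa> a) (\<lambda>b. - ln (pmf q a * pmf (\<kappa> a) b)))"
    unfolding ent_expectation[OF finp]
    by (subst expectation_bind_finite) (use assms in \<open>auto simp: integral_map_pmf pmf_bind_Pair\<close>)
  also have "\<dots> = (\<Sum>a\<in>set_pmf q. pmf q a * (- ln (pmf q a) + ent (\<kappa> a)))"
  proof (intro sum.cong refl)
    fix a assume a: "a \<in> set_pmf q"
    have "measure_pmf.expectation (\<kappa> a) (\<lambda>b. - ln (pmf q a * pmf (\<kappa> a) b))
        = measure_pmf.expectation (\<kappa> a) (\<lambda>b. - ln (pmf q a) + - ln (pmf (\<kappa> a) b))"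
      using pmf_positive[OF a] by (intro integral_cong_AE) (simp_all add: AE_measure_pmf_iff ln_mult pmf_positive less_imp_neq[OF pmf_positive, symmetric])
    also have "\<dots> = - ln (pmf q a) + ent (\<kappa> a)"
      unfolding ent_expectation[OF fin\<kappa>[OF a]]
      by (subst Bochner_Integration.integral_add) (auto intro!: integrable_measure_pmf_finite fin\<kappa>[OF a])
    finally show "pmf q a * measure_pmf.expectation (\<kappa> a) (\<lambda>b. - ln (pmf q a * pmf (\<kappa> a) b))
        = pmf q a * (- ln (pmf q a) + ent (\<kappa> a))" by simp
  qed
  also have "\<dots> = ent q + (\<Sum>a\<in>set_pmf q. pmf q a * ent (\<kappa> a))"
    by (simp add: ent_def sum.distrib[symmetric] algebra_simps)
  finally show ?thesis .
qed

text \<open>The increments of H decrease to a limit l. Adding K steps after M costs at least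
  \<open>K * l\<close> whatever M is, while \<open>H K\<close> is at most
  \<open>H J + K * (l + \<delta> / 2)\<close> once the increments from J on are below
  \<open>l + \<delta> / 2\<close>. The excess is thus bounded independently of M.\<close>

lemma excess_bound:
  fixes H :: "nat \<Rightarrow> real"
  assumes H0: "H 0 \<ge> 0" and mono: "\<And>n. H n \<le> H (Suc n)"
    and conc: "\<And>n. H (Suc (Suc n)) + H n \<le> 2 * H (Suc n)" and "\<delta> > 0"
  shows "\<exists>K0. \<forall>K\<ge>K0. \<forall>M. H M + H K - H (M + K) \<le> \<delta> * real K"
proof -
  define d where "d n = H (Suc n) - H n" for n
  have dec: "decseq d" using conc by (intro decseq_SucI) (auto simp: d_def algebra_simps)
  have dpos: "0 \<le> d n" for n using mono by (simp add: d_def)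
  obtain l where l: "d \<longlonglongrightarrow> l" "\<And>n. l \<le> d n"
    using decseq_convergent[OF dec, of 0] dpos by metis
  obtain J where J: "\<And>j. j \<ge> J \<Longrightarrow> d j < l + \<delta> / 2"
    using order_tendstoD(2)[OF l(1), of "l + \<delta> / 2"] \<open>\<delta> > 0\<close> by (auto simp: eventually_sequentially)
  have sumd: "H (M + K) - H M = (\<Sum>j<K. d (M + j))" for M K
    by (induction K) (auto simp: d_def)
  have low: "H (M + K) - H M \<ge> real K * l" for M K
    unfolding sumd using sum_mono[of "{..<K}" "\<lambda>_. l" "\<lambda>j. d (M + j)"] l(2) by simp
  \<comment> \<open>From K0 on, the initial value \<open>H J\<close> is absorbed by the other half
    of \<delta>.\<close>
  obtain K0 :: nat where K0: "(H J) / (\<delta> / 2) \<le> real K0" using real_arch_simple by blast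
  show ?thesis
  proof (intro exI[of _ "K0 + J"] allI impI)
    fix K M assume K: "K0 + J \<le> K"
    have "H (J + (K - J)) - H J \<le> (\<Sum>j<K - J. l + \<delta> / 2)"
      unfolding sumd using J by (intro sum_mono) (simp add: less_imp_le)
    then have "H K \<le> H J + real (K - J) * (l + \<delta> / 2)" using K by simp
    also have "\<dots> \<le> H J + real K * (l + \<delta> / 2)"
      using l(1) dpos \<open>\<delta> > 0\<close> LIMSEQ_le_const[OF l(1), of 0] by (intro add_left_mono mult_right_mono) auto
    also have "H J \<le> \<delta> / 2 * real K"
    proof -
      have "H J \<le> \<delta> / 2 * real K0" using K0 \<open>\<delta> > 0\<close> by (simp add: field_simps)
      also have "\<dots> \<le> \<delta> / 2 * real K" using K \<open>\<delta> > 0\<close> by (intro mult_left_mono) auto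
      finally show ?thesis .
    qed
    finally have "H K \<le> real K * l + \<delta> * real K" by (simp add: algebra_simps)
    then show "H M + H K - H (M + K) \<le> \<delta> * real K" using low[of K M] by simp
  qed
qed

text \<open>Here \<open>Q r\<close> is the law of r consecutive symbols of a stationary process. Its
  block entropies are concave in r, by submodularity of the first and the last symbol given those
  between. Uniformity in M is essential: K has to be chosen before the length of the past is
  known.\<close>

lemma stationary_mutual_bound:
  fixes Q :: "nat \<Rightarrow> 'r list pmf"
  assumes len: "\<And>r xs. xs \<in> set_pmf (Q r) \<Longrightarrow> length xs = r"
    and fin: "\<And>r. finite (set_pmf (Q r))"
    and tk: "\<And>r s. map_pmf (take r) (Q (r + s)) = Q r"
    and dr: "\<And>r s. map_pmf (drop s) (Q (s + r)) = Q r"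
    and "\<delta> > 0"
  shows "\<exists>K0. \<forall>K\<ge>K0. \<forall>M. mutual (take M) (drop M) (Q (M + K)) \<le> \<delta> * real K"
proof -
  let ?H = "\<lambda>r. ent (Q r)"
  have mono: "?H r \<le> ?H (Suc r)" for r
    using ent_map_le[OF fin, of "take r" "Suc r"] tk[of r 1] by simp
  have conc: "?H (Suc (Suc r)) + ?H r \<le> 2 * ?H (Suc r)" for r
  proof -
    let ?p = "Q (Suc (Suc r))"
    \<comment> \<open>On words of length r + 2 this is the middle part, so that first letter, last
      letter and \<open>?e\<close> determine the word.\<close>
    let ?e = "\<lambda>xs. take r (drop 1 xs) :: 'r list"
    have e1: "map_pmf ?e ?p = Q r"
    proof -
      have "map_pmf ?e ?p = map_pmf (take r) (map_pmf (drop 1) ?p)" by (simp add: pmf.map_comp o_def)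
      then show ?thesis using dr[of 1 "Suc r"] tk[of r 1] by simp
    qed
    have sp: "\<exists>a b m. length m = r \<and> xs = a # m @ [b]" if "xs \<in> set_pmf ?p" for xs
    proof -
      from len[OF that] obtain a ys where "xs = a # ys" "length ys = Suc r" by (cases xs) auto
      then show ?thesis by (cases ys rule: rev_exhaust) auto
    qed
    have "ent (map_pmf (\<lambda>xs. (hd xs, last xs, ?e xs)) ?p) = ent (map_pmf (\<lambda>xs. xs) ?p)"
    proof (intro ent_map_cong_inj fin)
      fix xs ys assume "xs \<in> set_pmf ?p" "ys \<in> set_pmf ?p"
      from this[THEN sp] obtain a b m a' b' m' where "length m = r" "xs = a # m @ [b]" "length m' = r" "ys = a' # m' @ [b']" by metis
      then show "((hd xs, last xs, ?e xs) = (hd ys, last ys, ?e ys)) = (xs = ys)" by auto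
    qed
    moreover have "ent (map_pmf (\<lambda>xs. (hd xs, ?e xs)) ?p) = ent (map_pmf (take (Suc r)) ?p)"
    proof (intro ent_map_cong_inj fin)
      fix xs ys assume "xs \<in> set_pmf ?p" "ys \<in> set_pmf ?p"
      from this[THEN sp] obtain a b m a' b' m' where "length m = r" "xs = a # m @ [b]" "length m' = r" "ys = a' # m' @ [b']" by metis
      then show "((hd xs, ?e xs) = (hd ys, ?e ys)) = (take (Suc r) xs = take (Suc r) ys)" by simp
    qed
    moreover have "ent (map_pmf (\<lambda>xs. (last xs, ?e xs)) ?p) = ent (map_pmf (drop 1) ?p)"
    proof (intro ent_map_cong_inj fin)
      fix xs ys assume "xs \<in> set_pmf ?p" "ys \<in> set_pmf ?p"
      from this[THEN sp] obtain a b m a' b' m' where "length m = r" "xs = a # m @ [b]" "length m' = r" "ys = a' # m' @ [b']" by metis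
      then show "((last xs, ?e xs) = (last ys, ?e ys)) = (drop 1 xs = drop 1 ys)" by auto
    qed
    ultimately show ?thesis
      using ent_submodular[OF fin, of hd "last" ?e "Suc (Suc r)"] e1 tk[of "Suc r" 1] dr[of 1 "Suc r"]
      by simp
  qed
  have "mutual (take M) (drop M) (Q (M + K)) = ?H M + ?H K - ?H (M + K)" for M K
  proof -
    have "ent (map_pmf (\<lambda>xs. (take M xs, drop M xs)) (Q (M + K))) = ent (map_pmf (\<lambda>xs. xs) (Q (M + K)))"
      by (intro ent_map_cong_inj fin) (metis append_take_drop_id Pair_inject)
    then show ?thesis by (simp add: mutual_def tk dr)
  qed
  then show ?thesis
    using excess_bound[of ?H \<delta>, OF ent_nonneg mono conc \<open>\<delta> > 0\<close>] by simp
qed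

section \<open>Coupling with independent uniform symbols\<close>

lemma ex_pmf_finite:
  fixes f :: "'x \<Rightarrow> real"
  assumes "finite A" "\<And>x. f x \<ge> 0" "\<And>x. x \<notin> A \<Longrightarrow> f x = 0" "sum f A = 1"
  shows "\<exists>p. \<forall>x. pmf p x = f x"
proof -
  have "(\<integral>\<^sup>+x. ennreal (f x) \<partial>count_space UNIV) = (\<Sum>x\<in>A. ennreal (f x))"
    using assms by (intro nn_integral_count_space') auto
  also have "\<dots> = 1" using assms by (simp add: sum_ennreal)
  finally have "pmf (embed_pmf f) x = f x" for x
    using assms by (intro pmf_embed_pmf) auto
  then show ?thesis by blast
qed

text \<open>The common part m is placed on the diagonal; the excess u of p over q and the excess v
  of q over p have equal mass d and are joined independently.\<close>

lemma maximal_coupling: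
  fixes p q :: "'x pmf"
  assumes fin: "finite A" and sp: "set_pmf p \<subseteq> A" and sq: "set_pmf q \<subseteq> A"
  shows "\<exists>\<gamma>. map_pmf fst \<gamma> = p \<and> map_pmf snd \<gamma> = q \<and>
    measure_pmf.prob \<gamma> {(x, y). x \<noteq> y} \<le> (\<Sum>x\<in>A. max 0 (pmf p x - pmf q x))"
proof -
  define u where "u x = max 0 (pmf p x - pmf q x)" for x
  define v where "v x = max 0 (pmf q x - pmf p x)" for x
  define m where "m x = min (pmf p x) (pmf q x)" for x
  define d where "d = sum u A"
  have p1: "sum (pmf p) A = 1" and q1: "sum (pmf q) A = 1"
    using fin sp sq by (auto intro: sum_pmf_eq_1)
  have um: "m x + u x = pmf p x" and vm: "m x + v x = pmf q x" for x
    by (auto simp: m_def u_def v_def)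
  have "sum m A + sum u A = 1" "sum m A + sum v A = 1"
    using p1 q1 by (simp_all add: sum.distrib[symmetric] um vm)
  then have dv: "sum v A = d" and dm: "sum m A = 1 - d" by (auto simp: d_def)
  have nn: "u x \<ge> 0" "v x \<ge> 0" "m x \<ge> 0" for x by (auto simp: u_def v_def m_def)
  have z: "u x = 0" "v x = 0" "m x = 0" if "x \<notin> A" for x
  proof -
    have "pmf p x = 0" "pmf q x = 0" using that sp sq by (metis set_pmf_iff subsetD)+
    then show "u x = 0" "v x = 0" "m x = 0" by (simp_all add: u_def v_def m_def)
  qed
  have d0: "d \<ge> 0" using nn by (auto simp: d_def intro: sum_nonneg)
  have u0: "u x = 0" if "d = 0" for x
    using that fin nn z unfolding d_def by (cases "x \<in> A") (auto simp: sum_nonneg_eq_0_iff)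
  have v0: "v x = 0" if "d = 0" for x
    using that fin nn z dv by (cases "x \<in> A") (auto simp: sum_nonneg_eq_0_iff)
  \<comment> \<open>For d = 0 the quotient is 0 by convention; u and v vanish then, so the row and
    column sums remain correct.\<close>
  define f where "f = (\<lambda>(x, y). (if x = y then m x else 0) + u x * v y / d)"
  have rowsum: "(\<Sum>y\<in>A. f (x, y)) = pmf p x" if "x \<in> A" for x
  proof -
    have "(\<Sum>y\<in>A. f (x, y)) = m x + u x * d / d"
      using fin that by (simp add: f_def sum.distrib sum_distrib_left[symmetric] sum_divide_distrib[symmetric] dv)
    then show ?thesis using um[of x] u0 by (cases "d = 0") auto
  qed
  have colsum: "(\<Sum>x\<in>A. f (x, y)) = pmf q y" if "y \<in> A" for y
  proof -
    have "(\<Sum>x\<in>A. f (x, y)) = m y + d * v y / d"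
      using fin that by (simp add: f_def sum.distrib sum_distrib_right[symmetric] sum_divide_distrib[symmetric] d_def)
    then show ?thesis using vm[of y] v0 by (cases "d = 0") auto
  qed
  have fz: "f x = 0" if "x \<notin> A \<times> A" for x using that z by (cases x) (auto simp: f_def)
  have "\<exists>\<gamma>. \<forall>x. pmf \<gamma> x = f x"
  proof (rule ex_pmf_finite[of "A \<times> A"])
    show "sum f (A \<times> A) = 1"
      using rowsum p1 by (simp add: sum.cartesian_product')
    show "f x = 0" if "x \<notin> A \<times> A" for x using that by (rule fz)
  qed (use fin nn d0 in \<open>auto simp: f_def\<close>)
  then obtain \<gamma> where \<gamma>: "\<And>x. pmf \<gamma> x = f x" by blast
  have s\<gamma>: "set_pmf \<gamma> \<subseteq> A \<times> A"
    by (metis \<gamma> fz set_pmf_iff subsetI)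
  have "map_pmf snd \<gamma> = q"
  proof (rule pmf_eqI)
    fix y
    have "pmf (map_pmf snd \<gamma>) y = (\<Sum>x\<in>A. f (x, y))"
      using sum_pmf_marginal[of A \<gamma> y, OF fin] s\<gamma> by (fastforce simp: \<gamma>)
    then show "pmf (map_pmf snd \<gamma>) y = pmf q y"
    proof (cases "y \<in> A")
      case False
      then have "pmf q y = 0" "\<And>x. f (x, y) = 0" using sq fz by (auto simp: set_pmf_iff)
      then show ?thesis using \<open>pmf (map_pmf snd \<gamma>) y = (\<Sum>x\<in>A. f (x, y))\<close> by simp
    qed (simp add: colsum)
  qed
  moreover have "map_pmf fst \<gamma> = p"
  proof (rule pmf_eqI)
    fix x
    \<comment> \<open>\<open>sum_pmf_marginal\<close> sums out the first coordinate; the swap makes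
      it applicable to the second.\<close>
    let ?sw = "\<lambda>z. (snd z, fst z)"
    have inj: "inj ?sw" by (auto simp: inj_on_def)
    have sw: "pmf (map_pmf ?sw \<gamma>) (y, x) = f (x, y)" for y
      using pmf_map_inj'[OF inj, of \<gamma> "(x, y)"] by (simp add: \<gamma>)
    have "pmf (map_pmf snd (map_pmf ?sw \<gamma>)) x = (\<Sum>y\<in>A. f (x, y))"
      using sum_pmf_marginal[of A "map_pmf ?sw \<gamma>" x, OF fin] s\<gamma> by (fastforce simp: sw)
    then show "pmf (map_pmf fst \<gamma>) x = pmf p x"
    proof (cases "x \<in> A")
      case False
      then have "pmf p x = 0" "\<And>y. f (x, y) = 0" using sp fz by (auto simp: set_pmf_iff)
      then show ?thesis
        using \<open>pmf (map_pmf snd (map_pmf ?sw \<gamma>)) x = (\<Sum>y\<in>A. f (x, y))\<close>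
        by (simp add: pmf.map_comp o_def)
    qed (simp add: rowsum pmf.map_comp o_def)
  qed
  moreover have "measure_pmf.prob \<gamma> {(x, y). x \<noteq> y} \<le> d"
  proof -
    have "measure_pmf.prob \<gamma> {(x, y). x = y} \<ge> measure_pmf.prob \<gamma> ((\<lambda>x. (x, x)) ` A)"
      by (intro measure_pmf.finite_measure_mono) auto
    also have "measure_pmf.prob \<gamma> ((\<lambda>x. (x, x)) ` A) = (\<Sum>x\<in>A. f (x, x))"
      using fin by (simp add: measure_measure_pmf_finite sum.reindex inj_on_def \<gamma>)
    also have "\<dots> \<ge> sum m A"
      using nn d0 by (intro sum_mono) (auto simp: f_def)
    finally have "measure_pmf.prob \<gamma> {(x, y). x = y} \<ge> 1 - d" by (simp add: dm)
    moreover have "measure_pmf.prob \<gamma> {(x, y). x \<noteq> y} = 1 - measure_pmf.prob \<gamma> {(x, y). x = y}"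
      using measure_pmf.prob_compl[of "{(x, y). x = y}" \<gamma>]
      by (simp add: set_diff_eq split_def)
    ultimately show ?thesis by simp
  qed
  ultimately show ?thesis by (auto simp: d_def u_def)
qed

text \<open>A tangent-line form of Pinsker's inequality: \<open>t ln t - t + 1\<close> lies above its tangent at
  \<open>exp (1 / c)\<close>.\<close>

lemma tangent_pinsker:
  fixes c t :: real
  assumes "c \<ge> 1" "t \<ge> 0"
  shows "max 0 (t - 1) \<le> c * (t * ln t - t + 1) + 1 / c"
proof (cases "t = 0")
  case True
  then show ?thesis using assms by simp
next
  case False
  with assms have t: "t > 0" by simp
  have "ln (1 / t) \<le> 1 / t - 1" using t by (intro ln_le_minus_one) simp
  then have "t * ln t - t + 1 \<ge> 0" using t by (simp add: ln_div field_simps)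
  then have A: "0 \<le> c * (t * ln t - t + 1) + 1 / c" using assms by simp
  define t0 where "t0 = exp (1 / c)"
  \<comment> \<open>This is convexity at t0: the tangent of \<open>t ln t - t + 1\<close> there is
    \<open>t / c - t0 + 1\<close>, of slope \<open>1 / c\<close>, so that multiplication by c gives
    slope 1.\<close>
  have "ln (t0 / t) \<le> t0 / t - 1" using t by (intro ln_le_minus_one) (simp add: t0_def)
  then have "1 / c - ln t \<le> t0 / t - 1" using t by (simp add: ln_div t0_def)
  then have "t * (1 / c - ln t) \<le> t * (t0 / t - 1)" using t by (intro mult_left_mono) auto
  then have "t / c - t0 + 1 \<le> t * ln t - t + 1" using t by (simp add: algebra_simps)
  then have "c * (t / c - t0 + 1) \<le> c * (t * ln t - t + 1)" using assms by (intro mult_left_mono) auto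
  moreover have "c * (t / c - t0 + 1) = t - c * (t0 - 1)" using assms by (simp add: field_simps)
  moreover have "c * (t0 - 1) \<le> 1 + 1 / c"
  proof -
    have "t0 \<le> 1 + 1 / c + (1 / c)\<^sup>2" unfolding t0_def using assms by (intro exp_bound) auto
    then have "c * (t0 - 1) \<le> c * (1 / c + (1 / c)\<^sup>2)" using assms by (intro mult_left_mono) auto
    also have "\<dots> = 1 + 1 / c" using assms by (simp add: field_simps power2_eq_square)
    finally show ?thesis .
  qed
  ultimately have "t - 1 \<le> c * (t * ln t - t + 1) + 1 / c" by simp
  with A show ?thesis by simp
qed

text \<open>With t equal to N times \<open>pmf p x\<close>, the average over V of
  \<open>t ln t - t + 1\<close> is exactly the relative entropy \<open>ln (card V) - ent p\<close>.
  The bound is kept linear, with a free parameter c in place of a square root, so that it can be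
  averaged over conditions by the chain rule alone.\<close>

lemma uniform_coupling:
  fixes p :: "'x pmf"
  assumes fin: "finite V" and sp: "set_pmf p \<subseteq> V" and c: "c \<ge> 1"
  shows "\<exists>\<gamma>. map_pmf fst \<gamma> = p \<and> map_pmf snd \<gamma> = pmf_of_set V \<and>
    measure_pmf.prob \<gamma> {(x, y). x \<noteq> y} \<le> c * (ln (card V) - ent p) + 1 / c"
proof -
  have ne: "V \<noteq> {}" using sp set_pmf_not_empty[of p] by blast
  define N where "N = real (card V)"
  have N: "N > 0" using fin ne by (simp add: N_def card_gt_0_iff)
  have pu: "pmf (pmf_of_set V) x = 1 / N" if "x \<in> V" for x
    using that fin ne by (simp add: N_def)
  have p1: "sum (pmf p) V = 1" using fin sp by (auto intro: sum_pmf_eq_1)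
  have entV: "(\<Sum>x\<in>V. pmf p x * ln (pmf p x)) = - ent p"
  proof -
    have "(\<Sum>x\<in>V. pmf p x * ln (pmf p x)) = (\<Sum>x\<in>set_pmf p. pmf p x * ln (pmf p x))"
      using fin sp by (intro sum.mono_neutral_right) (auto simp: set_pmf_iff)
    then show ?thesis by (simp add: ent_def sum_negf)
  qed
  have "(\<Sum>x\<in>V. max 0 (pmf p x - pmf (pmf_of_set V) x))
      = (\<Sum>x\<in>V. max 0 (pmf p x * N - 1)) / N"
    unfolding sum_divide_distrib
  proof (intro sum.cong refl)
    fix x assume "x \<in> V"
    then show "max 0 (pmf p x - pmf (pmf_of_set V) x) = max 0 (pmf p x * N - 1) / N"
      using N by (auto simp: pu max_def field_simps)
  qed
  also have "\<dots> \<le> (\<Sum>x\<in>V. c * (pmf p x * N * ln (pmf p x * N) - pmf p x * N + 1) + 1 / c) / N"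
    using N c by (intro divide_right_mono sum_mono tangent_pinsker) auto
  also have "(\<Sum>x\<in>V. c * (pmf p x * N * ln (pmf p x * N) - pmf p x * N + 1) + 1 / c)
      = (\<Sum>x\<in>V. c * (N * (pmf p x * ln (pmf p x)) + (N * ln N) * pmf p x - N * pmf p x + 1) + 1 / c)"
  proof (intro sum.cong refl)
    fix x
    show "c * (pmf p x * N * ln (pmf p x * N) - pmf p x * N + 1) + 1 / c
      = c * (N * (pmf p x * ln (pmf p x)) + (N * ln N) * pmf p x - N * pmf p x + 1) + 1 / c"
      using N pmf_nonneg[of p x] by (cases "pmf p x = 0") (auto simp: ln_mult algebra_simps)
  qed
  also have "\<dots> = c * (N * (- ent p) + N * ln N) + N / c"
    by (simp add: sum.distrib sum_distrib_left[symmetric] sum_subtractf entV p1 N_def[symmetric])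
  also have "\<dots> / N = c * (ln N - ent p) + 1 / c"
    using N c by (simp add: field_simps)
  finally have "(\<Sum>x\<in>V. max 0 (pmf p x - pmf (pmf_of_set V) x)) \<le> c * (ln N - ent p) + 1 / c" .
  moreover have "set_pmf (pmf_of_set V) \<subseteq> V" using fin ne by simp
  ultimately show ?thesis
    using maximal_coupling[OF fin sp, of "pmf_of_set V"] unfolding N_def by (meson order_trans)
qed

text \<open>Hamming distance on the common initial part: \<open>zip\<close> truncates, so a second
  list that is longer than the first is allowed and its surplus is not counted.\<close>

definition mism :: "'b list \<Rightarrow> 'b list \<Rightarrow> nat" where
  "mism xs ys = length (filter (\<lambda>(x, y). x \<noteq> y) (zip xs ys))"

lemma mism_simps [simp]:
  "mism [] ys = 0" "mism (x # xs) (z # ys) = (if x = z then 0 else 1) + mism xs ys"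
  by (auto simp: mism_def)

lemma mism_append: "length xs = length ys \<Longrightarrow> mism xs (ys @ zs) = mism xs ys"
  by (induction rule: list_induct2) auto

lemma mism_card: "length xs \<le> length ys \<Longrightarrow> mism xs ys = card {i. i < length xs \<and> xs ! i \<noteq> ys ! i}"
  by (auto simp: mism_def length_filter_conv_card intro!: arg_cong[where f = card])

lemma set_replicate_pmf_lists:
  "set_pmf (replicate_pmf n p) = {xs. length xs = n \<and> set xs \<subseteq> set_pmf p}"
  by (auto simp: Probability_Mass_Function.set_replicate_pmf lists_eq_set)

lemma finite_set_replicate_pmf: "finite (set_pmf p) \<Longrightarrow> finite (set_pmf (replicate_pmf n p))"
  unfolding set_replicate_pmf_lists using finite_lists_length_eq[of "set_pmf p" n] by (simp add: conj_commute)

text \<open>Marton's argument: the heads are coupled first, then, given the head h of the first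
  list, the conditional law of its tail is coupled with uniform symbols by induction. The deficits
  of the successive conditional laws add up to the total deficit by the chain rule.\<close>

theorem list_uniform_coupling:
  fixes \<rho> :: "'b list pmf"
  assumes fin: "finite V" and ne: "V \<noteq> {}" and c: "c \<ge> 1"
    and "\<And>xs. xs \<in> set_pmf \<rho> \<Longrightarrow> length xs = n \<and> set xs \<subseteq> V"
  shows "\<exists>\<gamma>. map_pmf fst \<gamma> = \<rho> \<and> map_pmf snd \<gamma> = replicate_pmf n (pmf_of_set V) \<and>
    measure_pmf.expectation \<gamma> (\<lambda>(xs, ys). real (mism xs ys)) \<le> c * (real n * ln (card V) - ent \<rho>) + real n / c"
  using assms(4)
proof (induction n arbitrary: \<rho>)
  case 0
  then have "set_pmf \<rho> \<subseteq> {[]}" by auto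
  then have \<rho>: "\<rho> = return_pmf []" by (simp add: set_pmf_subset_singleton)
  show ?case by (rule exI[of _ "return_pmf ([], [])"]) (simp add: \<rho> ent_return)
next
  case (Suc n)
  let ?U = "pmf_of_set V"
  have setU: "set_pmf ?U = V" using fin ne by simp
  let ?s = "\<lambda>l. (hd l, tl l)"
  have sl: "hd xs # tl xs = xs \<and> hd xs \<in> V \<and> length (tl xs) = n \<and> set (tl xs) \<subseteq> V" if "xs \<in> set_pmf \<rho>" for xs
    using Suc.prems[OF that] by (cases xs) auto
  have fin\<rho>: "finite (set_pmf \<rho>)"
    by (rule finite_subset[OF _ finite_lists_length_eq[OF fin, of "Suc n"]]) (use Suc.prems in auto)
  obtain \<kappa> where \<kappa>: "map_pmf ?s \<rho> = bind_pmf (map_pmf fst (map_pmf ?s \<rho>)) (\<lambda>a. map_pmf (Pair a) (\<kappa> a))"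
    by (rule pmf_disintegrate)
  define p where "p = map_pmf hd \<rho>"
  have \<kappa>': "map_pmf ?s \<rho> = bind_pmf p (\<lambda>a. map_pmf (Pair a) (\<kappa> a))"
    by (subst \<kappa>) (simp add: p_def pmf.map_comp o_def)
  have \<rho>: "\<rho> = bind_pmf p (\<lambda>a. map_pmf ((#) a) (\<kappa> a))"
  proof -
    have "\<rho> = map_pmf (\<lambda>(h, t). h # t) (map_pmf ?s \<rho>)"
      unfolding pmf.map_comp o_def by (rule map_pmf_idI[symmetric]) (simp add: sl)
    also have "\<dots> = bind_pmf p (\<lambda>a. map_pmf ((#) a) (\<kappa> a))"
      unfolding \<kappa>' by (simp add: map_bind_pmf pmf.map_comp o_def)
    finally show ?thesis .
  qed
  have setp: "set_pmf p \<subseteq> V" using sl by (auto simp: p_def)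
  have finp: "finite (set_pmf p)" using setp fin finite_subset by blast
  have set\<kappa>: "length t = n \<and> set t \<subseteq> V" if "h \<in> set_pmf p" "t \<in> set_pmf (\<kappa> h)" for h t
  proof -
    have "h # t \<in> set_pmf \<rho>" by (subst \<rho>) (use that in auto)
    then show ?thesis using sl[of "h # t"] by simp
  qed
  have fin\<kappa>: "finite (set_pmf (\<kappa> h))" if "h \<in> set_pmf p" for h
    by (rule finite_subset[OF _ finite_lists_length_eq[OF fin, of n]]) (use set\<kappa>[OF that] in auto)
  have ent\<rho>: "ent \<rho> = ent p + (\<Sum>h\<in>set_pmf p. pmf p h * ent (\<kappa> h))"
  proof -
    have "ent \<rho> = ent (map_pmf ?s \<rho>)"
      by (intro ent_map_inj[symmetric] fin\<rho>) (intro inj_on_inverseI[where g = "\<lambda>(h, t). h # t"], simp add: sl)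
    then show ?thesis unfolding \<kappa>' using ent_bind_Pair[OF finp fin\<kappa>] by simp
  qed
  obtain \<gamma>0 where \<gamma>0: "map_pmf fst \<gamma>0 = p" "map_pmf snd \<gamma>0 = ?U"
    "measure_pmf.prob \<gamma>0 {(x, y). x \<noteq> y} \<le> c * (ln (card V) - ent p) + 1 / c"
    using uniform_coupling[OF fin setp c] by blast
  let ?e = "\<lambda>\<gamma>. measure_pmf.expectation \<gamma> (\<lambda>(xs, ys). real (mism xs ys))"
  have "\<forall>h\<in>set_pmf p. \<exists>\<gamma>. map_pmf fst \<gamma> = \<kappa> h \<and> map_pmf snd \<gamma> = replicate_pmf n ?U \<and>
    ?e \<gamma> \<le> c * (real n * ln (card V) - ent (\<kappa> h)) + real n / c"
    using Suc.IH set\<kappa> by blast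
  then obtain g where g: "\<And>h. h \<in> set_pmf p \<Longrightarrow> map_pmf fst (g h) = \<kappa> h"
    "\<And>h. h \<in> set_pmf p \<Longrightarrow> map_pmf snd (g h) = replicate_pmf n ?U"
    "\<And>h. h \<in> set_pmf p \<Longrightarrow> ?e (g h) \<le> c * (real n * ln (card V) - ent (\<kappa> h)) + real n / c"
    by metis
  have sg0: "h \<in> set_pmf p" "z \<in> V" if "(h, z) \<in> set_pmf \<gamma>0" for h z
    using that \<gamma>0(1,2) setU by (metis fst_conv imageI set_map_pmf, metis snd_conv imageI set_map_pmf)
  have sgh: "t \<in> set_pmf (\<kappa> h)" "z \<in> set_pmf (replicate_pmf n ?U)" if "h \<in> set_pmf p" "(t, z) \<in> set_pmf (g h)" for h t z
    using that g(1,2) by (metis fst_conv imageI set_map_pmf, metis snd_conv imageI set_map_pmf)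
  have fing0: "finite (set_pmf \<gamma>0)"
    by (rule finite_subset[of _ "set_pmf p \<times> V"]) (use sg0 finp fin in auto)
  have fing: "finite (set_pmf (g h))" if "h \<in> set_pmf p" for h
  proof -
    have "set_pmf (g h) \<subseteq> set_pmf (\<kappa> h) \<times> set_pmf (replicate_pmf n ?U)"
      using sgh[OF that] by (metis SigmaI prod.collapse subsetI)
    then show ?thesis
      using fin\<kappa>[OF that] finite_set_replicate_pmf[of ?U n] fin setU by (metis finite_SigmaI finite_subset)
  qed
  define \<gamma> where "\<gamma> = bind_pmf \<gamma>0 (\<lambda>(h, z). map_pmf (\<lambda>(t, zs). (h # t, z # zs)) (g h))"
  have "map_pmf fst \<gamma> = bind_pmf \<gamma>0 (\<lambda>hz. map_pmf ((#) (fst hz)) (map_pmf fst (g (fst hz))))"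
    by (simp add: \<gamma>_def map_bind_pmf pmf.map_comp o_def case_prod_beta)
  also have "\<dots> = bind_pmf \<gamma>0 (\<lambda>hz. map_pmf ((#) (fst hz)) (\<kappa> (fst hz)))"
    by (intro bind_pmf_cong refl) (use sg0 g(1) in auto)
  also have "\<dots> = \<rho>"
    by (subst \<rho>) (simp add: \<gamma>0(1)[symmetric] bind_map_pmf)
  finally have 1: "map_pmf fst \<gamma> = \<rho>" .
  have "map_pmf snd \<gamma> = bind_pmf \<gamma>0 (\<lambda>hz. map_pmf ((#) (snd hz)) (map_pmf snd (g (fst hz))))"
    by (simp add: \<gamma>_def map_bind_pmf pmf.map_comp o_def case_prod_beta)
  \<comment> \<open>The second marginal of \<open>g h\<close> is the same for every h, so the tail
    of the second list is independent of its head although the coupling depends on h.\<close>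
  also have "\<dots> = bind_pmf \<gamma>0 (\<lambda>hz. map_pmf ((#) (snd hz)) (replicate_pmf n ?U))"
    by (intro bind_pmf_cong refl) (use sg0 g(2) in auto)
  also have "\<dots> = bind_pmf (map_pmf snd \<gamma>0) (\<lambda>z. map_pmf ((#) z) (replicate_pmf n ?U))"
    by (simp add: bind_map_pmf)
  also have "\<dots> = replicate_pmf (Suc n) ?U"
    unfolding \<gamma>0(2) by (simp add: map_pmf_def)
  finally have 2: "map_pmf snd \<gamma> = replicate_pmf (Suc n) ?U" .
  have "?e \<gamma> = (\<Sum>hz\<in>set_pmf \<gamma>0. pmf \<gamma>0 hz *
      measure_pmf.expectation (map_pmf (\<lambda>(t, zs). (fst hz # t, snd hz # zs)) (g (fst hz))) (\<lambda>(xs, ys). real (mism xs ys)))"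
    unfolding \<gamma>_def by (subst expectation_bind_finite) (use fing0 fing sg0 in \<open>auto simp: case_prod_beta\<close>)
  also have "\<dots> \<le> (\<Sum>hz\<in>set_pmf \<gamma>0. pmf \<gamma>0 hz * (indicator {(x, y). x \<noteq> y} hz +
       (c * (real n * ln (card V) - ent (\<kappa> (fst hz))) + real n / c)))"
  proof (intro sum_mono mult_left_mono pmf_nonneg)
    fix hz assume hz: "hz \<in> set_pmf \<gamma>0"
    obtain h z where [simp]: "hz = (h, z)" by force
    have h: "h \<in> set_pmf p" using hz sg0 by simp
    have "measure_pmf.expectation (map_pmf (\<lambda>(t, zs). (h # t, z # zs)) (g h)) (\<lambda>(xs, ys). real (mism xs ys))
      = measure_pmf.expectation (g h) (\<lambda>(t, zs). indicator {(x, y). x \<noteq> y} (h, z) + real (mism t zs))"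
      by (simp add: integral_map_pmf split_def)
    also have "\<dots> = indicator {(x, y). x \<noteq> y} (h, z) + ?e (g h)"
      unfolding case_prod_beta
      by (subst Bochner_Integration.integral_add) (auto intro!: integrable_measure_pmf_finite fing h)
    finally show "measure_pmf.expectation (map_pmf (\<lambda>(t, zs). (fst hz # t, snd hz # zs)) (g (fst hz))) (\<lambda>(xs, ys). real (mism xs ys))
      \<le> indicator {(x, y). x \<noteq> y} hz + (c * (real n * ln (card V) - ent (\<kappa> (fst hz))) + real n / c)"
      using g(3)[OF h] by simp
  qed
  also have "\<dots> = measure_pmf.expectation \<gamma>0 (\<lambda>hz. indicator {(x, y). x \<noteq> y} hz +
       (c * (real n * ln (card V) - ent (\<kappa> (fst hz))) + real n / c))"
    by (simp add: expectation_finite_pmf[OF fing0])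
  also have "\<dots> = measure_pmf.prob \<gamma>0 {(x, y). x \<noteq> y} +
      measure_pmf.expectation \<gamma>0 (\<lambda>hz. c * (real n * ln (card V) - ent (\<kappa> (fst hz))) + real n / c)"
    by (subst Bochner_Integration.integral_add) (auto intro!: integrable_measure_pmf_finite fing0)
  also have "measure_pmf.expectation \<gamma>0 (\<lambda>hz. c * (real n * ln (card V) - ent (\<kappa> (fst hz))) + real n / c)
      = measure_pmf.expectation p (\<lambda>h. c * (real n * ln (card V) - ent (\<kappa> h)) + real n / c)"
    by (simp add: \<gamma>0(1)[symmetric] integral_map_pmf)
  also have "\<dots> = c * (real n * ln (card V) - (\<Sum>h\<in>set_pmf p. pmf p h * ent (\<kappa> h))) + real n / c"
    using sum_pmf_eq_1[OF finp order_refl]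
    by (simp add: expectation_finite_pmf[OF finp, symmetric] integrable_measure_pmf_finite[OF finp])
  finally have "?e \<gamma> \<le> c * (real (Suc n) * ln (card V) - ent \<rho>) + real (Suc n) / c"
    using \<gamma>0(3) by (simp add: ent\<rho> algebra_simps add_divide_distrib)
  with 1 2 show ?case by blast
qed

text \<open>For each value s, the conditional law of the list is coupled with \<open>F s\<close>
  uniform symbols, and these are padded to length L. The padded list has the same law for every s,
  hence is independent of s; this is how the dependence on the past disappears later. Padding is
  invisible to \<open>mism\<close>.\<close>

theorem side_information_coupling:
  fixes p :: "('s \<times> 'b list) pmf"
  assumes finp: "finite (set_pmf p)" and fin: "finite V" and ne: "V \<noteq> {}" and c: "c \<ge> 1"
    and p: "\<And>s v. (s, v) \<in> set_pmf p \<Longrightarrow> length v = F s \<and> F s \<le> L \<and> set v \<subseteq> V"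
  shows "\<exists>R. map_pmf fst R = p \<and> finite (set_pmf R) \<and>
    map_pmf (\<lambda>((s, v), z). (s, z)) R = pair_pmf (map_pmf fst p) (replicate_pmf L (pmf_of_set V)) \<and>
    measure_pmf.expectation R (\<lambda>((s, v), z). real (mism v z)) \<le>
      c * (measure_pmf.expectation p (\<lambda>(s, v). real (F s)) * ln (card V) - (ent p - ent (map_pmf fst p)))
      + real L / c"
proof -
  let ?U = "pmf_of_set V"
  let ?S = "map_pmf fst p"
  let ?e = "\<lambda>\<gamma>. measure_pmf.expectation \<gamma> (\<lambda>(xs, ys). real (mism xs ys))"
  have setU: "set_pmf ?U = V" using fin ne by simp
  have finS: "finite (set_pmf ?S)" using finp by simp
  obtain \<kappa> where \<kappa>: "p = bind_pmf ?S (\<lambda>a. map_pmf (Pair a) (\<kappa> a))"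
    by (rule pmf_disintegrate)
  have set\<kappa>: "(s, v) \<in> set_pmf p" if "s \<in> set_pmf ?S" "v \<in> set_pmf (\<kappa> s)" for s v
    by (subst \<kappa>) (use that in auto)
  have fin\<kappa>: "finite (set_pmf (\<kappa> s))" if "s \<in> set_pmf ?S" for s
    by (rule finite_subset[of _ "snd ` set_pmf p"]) (use set\<kappa>[OF that] finp in force)+
  have FL: "F s \<le> L" if "s \<in> set_pmf ?S" for s
    using that p by (metis fst_conv imageE prod.collapse set_map_pmf)
  have "\<exists>\<gamma>. map_pmf fst \<gamma> = \<kappa> s \<and> map_pmf snd \<gamma> = replicate_pmf (F s) ?U \<and>
    ?e \<gamma> \<le> c * (real (F s) * ln (card V) - ent (\<kappa> s)) + real (F s) / c" if "s \<in> set_pmf ?S" for s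
    using list_uniform_coupling[OF fin ne c, of "\<kappa> s" "F s"] set\<kappa>[OF that] p by blast
  then obtain g where g: "\<And>s. s \<in> set_pmf ?S \<Longrightarrow> map_pmf fst (g s) = \<kappa> s"
    "\<And>s. s \<in> set_pmf ?S \<Longrightarrow> map_pmf snd (g s) = replicate_pmf (F s) ?U"
    "\<And>s. s \<in> set_pmf ?S \<Longrightarrow> ?e (g s) \<le> c * (real (F s) * ln (card V) - ent (\<kappa> s)) + real (F s) / c"
    by metis
  have sg: "v \<in> set_pmf (\<kappa> s)" "z \<in> set_pmf (replicate_pmf (F s) ?U)"
    if "s \<in> set_pmf ?S" "(v, z) \<in> set_pmf (g s)" for s v z
    using that g(1,2) by (metis fst_conv imageI set_map_pmf, metis snd_conv imageI set_map_pmf)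
  have finr: "finite (set_pmf (replicate_pmf n ?U))" for n
    using finite_set_replicate_pmf[of ?U n] fin setU by simp
  have fing: "finite (set_pmf (g s))" if "s \<in> set_pmf ?S" for s
  proof -
    have "set_pmf (g s) \<subseteq> set_pmf (\<kappa> s) \<times> set_pmf (replicate_pmf (F s) ?U)"
      using sg[OF that] by (metis SigmaI prod.collapse subsetI)
    then show ?thesis using fin\<kappa>[OF that] finr finite_subset by blast
  qed
  \<comment> \<open>Padding by \<open>L - F s\<close> fresh uniform symbols.\<close>
  define q where "q s = bind_pmf (g s) (\<lambda>vz. map_pmf (\<lambda>z'. (fst vz, snd vz @ z')) (replicate_pmf (L - F s) ?U))" for s
  have finq: "finite (set_pmf (q s))" if "s \<in> set_pmf ?S" for s
    unfolding q_def using fing[OF that] finr by auto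
  have q1: "map_pmf fst (q s) = \<kappa> s" if "s \<in> set_pmf ?S" for s
    using g(1)[OF that] by (simp add: q_def map_bind_pmf pmf.map_comp o_def map_pmf_def[symmetric] bind_return_pmf')
  have q2: "map_pmf snd (q s) = replicate_pmf L ?U" if "s \<in> set_pmf ?S" for s
  proof -
    have "map_pmf snd (q s) = bind_pmf (map_pmf snd (g s)) (\<lambda>z. map_pmf (\<lambda>z'. z @ z') (replicate_pmf (L - F s) ?U))"
      by (simp add: q_def map_bind_pmf pmf.map_comp o_def bind_map_pmf)
    also have "\<dots> = replicate_pmf (F s + (L - F s)) ?U"
      unfolding g(2)[OF that] replicate_pmf_distrib by (simp add: map_pmf_def)
    finally show ?thesis using FL[OF that] by simp
  qed
  have q3: "?e (q s) = ?e (g s)" if s: "s \<in> set_pmf ?S" for s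
  proof -
    have "?e (q s) = (\<Sum>vz\<in>set_pmf (g s). pmf (g s) vz * real (mism (fst vz) (snd vz)))"
      unfolding q_def
    proof (subst expectation_bind_finite, goal_cases)
      case 3
      show ?case
      proof (intro sum.cong refl)
        fix vz assume vz: "vz \<in> set_pmf (g s)"
        have "length (fst vz) = length (snd vz)"
          using sg[OF s, of "fst vz" "snd vz"] vz p[OF set\<kappa>[OF s]] by (auto simp: set_replicate_pmf_lists)
        then show "pmf (g s) vz * ?e (map_pmf (\<lambda>z'. (fst vz, snd vz @ z')) (replicate_pmf (L - F s) ?U))
          = pmf (g s) vz * real (mism (fst vz) (snd vz))"
          by (simp add: integral_map_pmf mism_append)
      qed
    qed (use fing[OF s] finr in auto)
    then show ?thesis by (simp add: expectation_finite_pmf[OF fing[OF s]] case_prod_beta)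
  qed
  define R where "R = bind_pmf ?S (\<lambda>s. map_pmf (\<lambda>vz. ((s, fst vz), snd vz)) (q s))"
  have "map_pmf fst R = bind_pmf ?S (\<lambda>s. map_pmf (Pair s) (map_pmf fst (q s)))"
    by (simp add: R_def map_bind_pmf pmf.map_comp o_def)
  also have "\<dots> = bind_pmf ?S (\<lambda>s. map_pmf (Pair s) (\<kappa> s))"
    by (intro bind_pmf_cong refl) (simp add: q1)
  finally have R1: "map_pmf fst R = p" using \<kappa> by simp
  have "map_pmf (\<lambda>((s, v), z). (s, z)) R = bind_pmf ?S (\<lambda>s. map_pmf (Pair s) (map_pmf snd (q s)))"
    by (simp add: R_def map_bind_pmf pmf.map_comp o_def)
  also have "\<dots> = bind_pmf ?S (\<lambda>s. map_pmf (Pair s) (replicate_pmf L ?U))"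
    by (intro bind_pmf_cong refl) (simp add: q2)
  also have "\<dots> = pair_pmf ?S (replicate_pmf L ?U)"
    by (simp add: pair_pmf_def map_pmf_def)
  finally have R2: "map_pmf (\<lambda>((s, v), z). (s, z)) R = pair_pmf ?S (replicate_pmf L ?U)" .
  have finR: "finite (set_pmf R)" using finp finq by (auto simp: R_def)
  have "measure_pmf.expectation R (\<lambda>((s, v), z). real (mism v z)) = (\<Sum>s\<in>set_pmf ?S. pmf ?S s * ?e (q s))"
    unfolding R_def
    by (subst expectation_bind_finite[OF finS]) (use finq in \<open>auto simp: integral_map_pmf case_prod_beta o_def split_def\<close>)
  also have "\<dots> \<le> (\<Sum>s\<in>set_pmf ?S. pmf ?S s * (c * (real (F s) * ln (card V) - ent (\<kappa> s)) + real L / c))"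
  proof (intro sum_mono mult_left_mono pmf_nonneg)
    fix s assume s: "s \<in> set_pmf ?S"
    have "real (F s) / c \<le> real L / c" using FL[OF s] c by (intro divide_right_mono) auto
    then show "?e (q s) \<le> c * (real (F s) * ln (card V) - ent (\<kappa> s)) + real L / c"
      using g(3)[OF s] q3[OF s] by simp
  qed
  also have "\<dots> = c * ((\<Sum>s\<in>set_pmf ?S. pmf ?S s * real (F s)) * ln (card V) - (\<Sum>s\<in>set_pmf ?S. pmf ?S s * ent (\<kappa> s)))
      + (\<Sum>s\<in>set_pmf ?S. pmf ?S s) * (real L / c)"
    by (simp add: sum_distrib_left sum_distrib_right sum.distrib sum_subtractf algebra_simps)
  also have "(\<Sum>s\<in>set_pmf ?S. pmf ?S s) = 1" using finS by (intro sum_pmf_eq_1) auto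
  also have "(\<Sum>s\<in>set_pmf ?S. pmf ?S s * ent (\<kappa> s)) = ent p - ent ?S"
    using ent_bind_Pair[of ?S \<kappa>, OF finS fin\<kappa>] by (simp add: \<kappa>[symmetric])
  also have "(\<Sum>s\<in>set_pmf ?S. pmf ?S s * real (F s)) = measure_pmf.expectation p (\<lambda>(s, v). real (F s))"
    by (simp only: expectation_finite_pmf[OF finS, symmetric] integral_map_pmf split_def)
  finally show ?thesis using R1 R2 finR by auto
qed

section \<open>Properties of the f-bar distance\<close>

lemma is_matchI:
  assumes "\<And>i j. (i, j) \<in> I \<Longrightarrow> i < length a \<and> j < length b \<and> a ! i = b ! j"
    and "\<And>i j i' j'. (i, j) \<in> I \<Longrightarrow> (i', j') \<in> I \<Longrightarrow> (i, j) = (i', j') \<or> i < i' \<and> j < j' \<or> i' < i \<and> j' < j"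
  shows "is_match a b I"
proof -
  have "\<forall>x\<in>I. fst x < length a \<and> snd x < length b \<and> a ! fst x = b ! snd x"
    using assms(1) by (metis prod.collapse)
  moreover have "\<forall>x\<in>I. \<forall>y\<in>I. x = y \<or> fst x < fst y \<and> snd x < snd y \<or> fst y < fst x \<and> snd y < snd x"
  proof (intro ballI)
    fix x y assume "x \<in> I" "y \<in> I"
    then show "x = y \<or> fst x < fst y \<and> snd x < snd y \<or> fst y < fst x \<and> snd y < snd x"
      using assms(2)[of "fst x" "snd x" "fst y" "snd y"] by (simp add: prod_eq_iff)
  qed
  ultimately show ?thesis unfolding is_match_def split_def by simp
qed

lemma is_matchD:
  assumes "is_match a b I"
  shows "(i, j) \<in> I \<Longrightarrow> i < length a \<and> j < length b \<and> a ! i = b ! j"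
    and "(i, j) \<in> I \<Longrightarrow> (i', j') \<in> I \<Longrightarrow> (i, j) = (i', j') \<or> i < i' \<and> j < j' \<or> i' < i \<and> j' < j"
proof -
  note m = assms[unfolded is_match_def]
  show "i < length a \<and> j < length b \<and> a ! i = b ! j" if "(i, j) \<in> I"
    using bspec[OF conjunct1[OF m] that] unfolding prod.case .
  show "(i, j) = (i', j') \<or> i < i' \<and> j < j' \<or> i' < i \<and> j' < j" if "(i, j) \<in> I" "(i', j') \<in> I"
    using bspec[OF bspec[OF conjunct2[OF m] that(1), unfolded prod.case] that(2)] unfolding prod.case .
qed

lemma match_subset: "is_match a b I \<Longrightarrow> I \<subseteq> {..<length a} \<times> {..<length b}"
proof
  fix x assume "is_match a b I" "x \<in> I"
  then show "x \<in> {..<length a} \<times> {..<length b}"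
    using is_matchD(1)[of a b I "fst x" "snd x"] by (cases x) simp
qed

lemma match_finite: "is_match a b I \<Longrightarrow> finite I"
  by (rule finite_subset[OF match_subset]) auto

lemma match_inj:
  assumes "is_match a b I"
  shows "inj_on fst I" "inj_on snd I"
proof -
  have "x = y" if "x \<in> I" "y \<in> I" "fst x = fst y \<or> snd x = snd y" for x y
    using is_matchD(2)[OF assms, of "fst x" "snd x" "fst y" "snd y"] that by (auto simp: prod_eq_iff)
  then show "inj_on fst I" "inj_on snd I" by (auto intro!: inj_onI)
qed

lemma match_card_le:
  assumes "is_match a b I"
  shows "card I \<le> length a" "card I \<le> length b"
proof -
  have "fst ` I \<subseteq> {..<length a}" "snd ` I \<subseteq> {..<length b}"
    using match_subset[OF assms] by auto
  then have "card (fst ` I) \<le> card {..<length a}" "card (snd ` I) \<le> card {..<length b}"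
    by (auto intro!: card_mono simp del: card_lessThan)
  then show "card I \<le> length a" "card I \<le> length b"
    using match_inj[OF assms] by (simp_all add: card_image)
qed

lemma finite_match_cards: "finite {card I |I. is_match a b I}"
  by (rule finite_subset[of _ "{..length a}"]) (use match_card_le in auto)

lemma match_empty: "is_match a b {}"
  by (simp add: is_match_def)

text \<open>For words of common length K the factor 2 cancels. With K = 0 both sides are 1, by the
  convention for division by zero.\<close>

lemma fbar_le_match:
  assumes "is_match a b I" "length a = K" "length b = K"
  shows "fbar a b \<le> 1 - real (card I) / real K"
proof -
  have "card I \<le> Max {card I |I. is_match a b I}"
    using assms(1) by (intro Max_ge finite_match_cards) blast
  then have "real (card I) / real K \<le> real (Max {card I |I. is_match a b I}) / real K"
    by (intro divide_right_mono) auto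
  then show ?thesis using assms by (cases "K = 0") (simp_all add: fbar_def field_simps)
qed

lemma fbar_match:
  assumes "length a = K" "length b = K"
  obtains I where "is_match a b I" "fbar a b = 1 - real (card I) / real K"
proof -
  have "Max {card I |I. is_match a b I} \<in> {card I |I. is_match a b I}"
    using match_empty[of a b] by (intro Max_in finite_match_cards) blast
  then obtain I where "is_match a b I" "Max {card I |I. is_match a b I} = card I" by auto
  then show thesis using assms by (intro that[of I]) (auto simp: fbar_def field_simps)
qed

lemma fbar_nonneg:
  assumes "length a = K" "length b = K"
  shows "fbar a b \<ge> 0"
proof -
  obtain I where I: "is_match a b I" "fbar a b = 1 - real (card I) / real K"
    using fbar_match[OF assms] by blast
  have "real (card I) / real K \<le> 1"
    using match_card_le(1)[OF I(1)] assms by (cases "K = 0") auto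
  then show ?thesis using I(2) by simp
qed

lemma fbar_commute:
  fixes a b :: "'b list"
  assumes "length a = K" "length b = K"
  shows "fbar a b = fbar b a"
proof -
  have le: "fbar b a \<le> fbar a b" if l: "length a = K" "length b = K" for a b :: "'b list"
  proof -
    obtain I where I: "is_match a b I" "fbar a b = 1 - real (card I) / real K"
      using fbar_match[OF l] by blast
    have "is_match b a (prod.swap ` I)"
    proof (rule is_matchI)
      fix i j assume "(i, j) \<in> prod.swap ` I"
      then have "(j, i) \<in> I" by auto
      then show "i < length b \<and> j < length a \<and> b ! i = a ! j" using is_matchD(1)[OF I(1)] by metis
    next
      fix i j i' j' assume "(i, j) \<in> prod.swap ` I" "(i', j') \<in> prod.swap ` I"
      then have "(j, i) \<in> I" "(j', i') \<in> I" by auto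
      then show "(i, j) = (i', j') \<or> i < i' \<and> j < j' \<or> i' < i \<and> j' < j"
        using is_matchD(2)[OF I(1)] by blast
    qed
    moreover have "card (prod.swap ` I) = card I" by (intro card_image) auto
    ultimately show ?thesis using fbar_le_match[of b a "prod.swap ` I" K] I(2) l by simp
  qed
  show ?thesis using le[OF assms] le[OF assms(2,1)] by simp
qed

text \<open>Matches are composed as relations. At least \<open>card I + card J - K\<close> middle
  positions belong to both matches, and each of them yields a pair of the composite.\<close>

lemma fbar_triangle:
  assumes K: "length a = K" "length b = K" "length c = K"
  shows "fbar a c \<le> fbar a b + fbar b c"
proof (cases "K = 0")
  case True
  then show ?thesis using K fbar_nonneg[of a K b] by simp
next
  case False
  obtain I where I: "is_match a b I" "fbar a b = 1 - real (card I) / real K"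
    using fbar_match[OF K(1,2)] by blast
  obtain J where J: "is_match b c J" "fbar b c = 1 - real (card J) / real K"
    using fbar_match[OF K(2,3)] by blast
  have IJ: "is_match a c (I O J)"
  proof (rule is_matchI)
    fix i k assume "(i, k) \<in> I O J"
    then obtain j where "(i, j) \<in> I" "(j, k) \<in> J" by auto
    then show "i < length a \<and> k < length c \<and> a ! i = c ! k"
      using is_matchD(1)[OF I(1), of i j] is_matchD(1)[OF J(1), of j k] by simp
  next
    fix i k i' k' assume "(i, k) \<in> I O J" "(i', k') \<in> I O J"
    then obtain j j' where "(i, j) \<in> I" "(j, k) \<in> J" "(i', j') \<in> I" "(j', k') \<in> J" by auto
    then show "(i, k) = (i', k') \<or> i < i' \<and> k < k' \<or> i' < i \<and> k' < k"
      using is_matchD(2)[OF I(1), of i j i' j'] is_matchD(2)[OF J(1), of j k j' k'] by auto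
  qed
  let ?Z = "snd ` I \<inter> fst ` J"
  \<comment> \<open>The middle position is recovered from the first component of a composite pair,
    since a position has at most one partner in I.\<close>
  have "?Z \<subseteq> (\<lambda>p. THE j. (fst p, j) \<in> I) ` (I O J)"
  proof
    fix j assume "j \<in> ?Z"
    then obtain i k where ik: "(i, j) \<in> I" "(j, k) \<in> J" by force
    have "(THE j'. (i, j') \<in> I) = j"
    proof (rule the_equality)
      fix j' assume "(i, j') \<in> I"
      then show "j' = j" using is_matchD(2)[OF I(1) ik(1), of i j'] by simp
    qed (rule ik(1))
    then show "j \<in> (\<lambda>p. THE j. (fst p, j) \<in> I) ` (I O J)" using ik by (intro image_eqI[of _ _ "(i, k)"]) auto
  qed
  then have "card ?Z \<le> card (I O J)"
    by (rule surj_card_le[OF match_finite[OF IJ]])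
  moreover have "card (snd ` I) + card (fst ` J) \<le> K + card ?Z"
  proof -
    have "card (snd ` I \<union> fst ` J) \<le> card {..<K}"
      using match_subset[OF I(1)] match_subset[OF J(1)] K by (intro card_mono) auto
    then show ?thesis
      using card_Un_Int[of "snd ` I" "fst ` J"] match_finite[OF I(1)] match_finite[OF J(1)] by simp
  qed
  ultimately have "card I + card J \<le> K + card (I O J)"
    using match_inj[OF I(1)] match_inj[OF J(1)] by (simp add: card_image)
  then have "real (card I) + real (card J) \<le> real K + real (card (I O J))" by linarith
  then have "(real (card I) + real (card J)) / real K \<le> (real K + real (card (I O J))) / real K"
    by (intro divide_right_mono) auto
  then have "real (card I) / real K + real (card J) / real K \<le> 1 + real (card (I O J)) / real K"
    using False by (simp add: add_divide_distrib)
  then show ?thesis using fbar_le_match[OF IJ K(1,3)] I(2) J(2) by simp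
qed

text \<open>The j-th block starts at \<open>b j\<close> in p and at \<open>j * h\<close> in q; both
  families are in the same order, so pairing equal offsets in corresponding blocks is order
  preserving. J collects the blocks to be paired and G the reliable positions of p. A margin of s
  letters at each end of a block leaves room for a sliding window of radius s.\<close>

lemma fbar_block_match:
  fixes b :: "nat \<Rightarrow> nat"
  assumes lenK: "length p = K" "length q = K"
    and gap: "\<And>j j'. j < j' \<Longrightarrow> j' < F \<Longrightarrow> b j + h \<le> b j'"
    and bK: "\<And>j. j < F \<Longrightarrow> b j + h \<le> K" and FK: "F * h \<le> K"
    and G: "G \<subseteq> {..<K}"
    and J: "J \<subseteq> {..<F}"
    and eq: "\<And>j t. j \<in> J \<Longrightarrow> s \<le> t \<Longrightarrow> t < h - s \<Longrightarrow> b j + t \<in> G \<Longrightarrow> p ! (b j + t) = q ! (j * h + t)"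
  shows "fbar p q \<le> 1 - (real (card J) * (real h - 2 * real s) - (real K - real (card G))) / real K"
proof -
  define T where "T = {s..<h - s}"
  define PT where "PT = {(j, t). j \<in> J \<and> t \<in> T \<and> b j + t \<in> G}"
  define BT where "BT = {(j, t). j \<in> J \<and> t \<in> T \<and> b j + t \<notin> G}"
  define f where "f = (\<lambda>(j, t). (b j + t, j * h + t))"
  have finJ: "finite J" using J finite_subset by blast
  have finT: "finite T" by (simp add: T_def)
  have PB: "PT \<union> BT = J \<times> T" "PT \<inter> BT = {}" by (auto simp: PT_def BT_def)
  have finPB: "finite PT" "finite BT" using finJ finT PB(1) by (metis finite_Un finite_cartesian_product)+
  have ord: "b j + t < b j' + t'" "j * h + t < j' * h + t'"
    if "j < j'" "j' \<in> J" "t \<in> T" "t' \<in> T" for j j' t t'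
  proof -
    show "b j + t < b j' + t'" using gap[of j j'] that J by (auto simp: T_def)
    have "Suc j * h \<le> j' * h" using that by (intro mult_right_mono) auto
    then show "j * h + t < j' * h + t'" using that by (auto simp: T_def)
  qed
  have inj1: "inj_on (\<lambda>(j, t). b j + t) (J \<times> T)"
  proof (rule inj_onI, clarify)
    fix j t j' t' assume *: "j \<in> J" "t \<in> T" "j' \<in> J" "t' \<in> T" "b j + t = b j' + t'"
    then show "j = j' \<and> t = t'" using ord(1)[of j j' t t'] ord(1)[of j' j t' t] by (cases j j' rule: linorder_cases) auto
  qed
  have "card BT = card ((\<lambda>(j, t). b j + t) ` BT)"
    by (rule card_image[symmetric], rule inj_on_subset[OF inj1]) (auto simp: BT_def)
  also have "\<dots> \<le> card ({..<K} - G)"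
  proof (intro card_mono)
    show "(\<lambda>(j, t). b j + t) ` BT \<subseteq> {..<K} - G"
    proof clarify
      fix j t assume "(j, t) \<in> BT"
      then show "b j + t \<in> {..<K} - G" using bK[of j] J by (auto simp: BT_def T_def)
    qed
  qed simp
  also have "\<dots> = K - card G" using G by (subst card_Diff_subset) (auto intro: finite_subset)
  finally have BT: "real (card BT) \<le> real K - real (card G)"
    using card_mono[OF _ G] by simp
  have "card PT + card BT = card J * card T"
    using card_Un_disjoint[OF finPB PB(2)] PB(1) by (simp add: card_cartesian_product)
  then have "real (card PT) + real (card BT) = real (card J) * real (card T)"
    by (metis of_nat_add of_nat_mult)
  \<comment> \<open>For h < 2 s the left side is at most 0 and T is empty, so no case distinction is
    needed.\<close>
  moreover have "real (card J) * (real h - 2 * real s) \<le> real (card J) * real (card T)"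
    by (intro mult_left_mono) (auto simp: T_def)
  ultimately have PT: "real (card PT) \<ge> real (card J) * (real h - 2 * real s) - (real K - real (card G))"
    using BT by linarith
  have m: "is_match p q (f ` PT)"
  proof (rule is_matchI)
    fix x y assume "(x, y) \<in> f ` PT"
    then obtain j t where x: "x = b j + t" "y = j * h + t" "j \<in> J" "t \<in> T" "b j + t \<in> G"
      by (auto simp: f_def PT_def)
    have "j < F" using x(3) J by auto
    then have "Suc j * h \<le> F * h" by (intro mult_right_mono) auto
    then have "j * h + t < K" using x(4) FK by (auto simp: T_def)
    moreover have "b j + t < K" using bK[OF \<open>j < F\<close>] x(4) by (auto simp: T_def)
    ultimately show "x < length p \<and> y < length q \<and> p ! x = q ! y"
      using eq[OF x(3) _ _ x(5)] x(1,2,4) lenK by (auto simp: T_def)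
  next
    fix x y x' y' assume "(x, y) \<in> f ` PT" "(x', y') \<in> f ` PT"
    then obtain j t j' t' where xy: "x = b j + t" "y = j * h + t" "x' = b j' + t'" "y' = j' * h + t'"
      "j \<in> J" "t \<in> T" "j' \<in> J" "t' \<in> T" by (auto simp: f_def PT_def)
    show "(x, y) = (x', y') \<or> x < x' \<and> y < y' \<or> x' < x \<and> y' < y"
    proof (cases j j' rule: linorder_cases)
      case equal
      then show ?thesis using xy(1-4) by auto
    qed (use xy ord[of j j' t t'] ord[of j' j t' t] in auto)
  qed
  have "inj_on f PT"
  proof (rule inj_on_subset[of _ "J \<times> T"])
    show "inj_on f (J \<times> T)" using inj1 by (auto simp: inj_on_def f_def)
  qed (auto simp: PT_def)
  then have "real (card (f ` PT)) / real K \<ge> (real (card J) * (real h - 2 * real s) - (real K - real (card G))) / real K"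
    using PT by (intro divide_right_mono) (simp_all add: card_image)
  then show ?thesis using fbar_le_match[OF m lenK] by simp
qed

section \<open>Realising couplings by invertible maps\<close>

text \<open>The interval is open because the quantile function of a distribution on the whole line
  is finite only there.\<close>

definition unit_measure :: "real measure" where
  "unit_measure = restrict_space lborel {0<..<1}"

lemma space_unit_measure: "space unit_measure = {0<..<1}"
  by (simp add: unit_measure_def space_restrict_space)

lemma prob_space_unit_measure: "prob_space unit_measure"
  by (auto simp: unit_measure_def space_restrict_space emeasure_restrict_space intro!: prob_spaceI)

lemma measurable_unit_measure: "f \<in> borel \<rightarrow>\<^sub>M N \<Longrightarrow> f \<in> unit_measure \<rightarrow>\<^sub>M N"
  unfolding unit_measure_def by (intro measurable_restrict_space1) simp

lemma measure_unit_measure_atMost: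
  assumes "0 \<le> t" "t \<le> 1"
  shows "measure unit_measure {s \<in> space unit_measure. s \<le> t} = t"
proof -
  have "{s \<in> space unit_measure. s \<le> t} = (if t = 1 then {0<..<1} else {0<..t})"
    using assms by (auto simp: space_unit_measure)
  moreover have "measure unit_measure S = measure lborel S" if "S \<subseteq> {0<..<1}" for S
    unfolding unit_measure_def using that by (intro measure_restrict_space) simp_all
  moreover have "{0<..t} \<subseteq> {0<..<1}" if "t \<noteq> 1" using that assms by auto
  ultimately show ?thesis using assms by (cases "t = 1") auto
qed

text \<open>The map \<open>F\<close> embeds the space measurably into the real line, with measurable left inverse
  \<open>D\<close>; the image measure has no atoms.\<close>

locale coded_space = prob_space M for M :: "'x measure" +
  fixes F :: "'x \<Rightarrow> real" and D :: "real \<Rightarrow> 'x"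
  assumes F_meas [measurable]: "F \<in> borel_measurable M"
    and D_meas [measurable]: "D \<in> borel \<rightarrow>\<^sub>M M"
    and D_F: "\<And>x. x \<in> space M \<Longrightarrow> D (F x) = x"
    and atomless: "\<And>r. prob (F -` {r} \<inter> space M) = 0"
begin

lemma prob_space_cond: "prob A > 0 \<Longrightarrow> prob_space (uniform_measure M A)"
  by (intro prob_space_uniform_measure) (auto simp: emeasure_eq_measure)

lemma prob_cond: "prob A > 0 \<Longrightarrow> B \<in> events \<Longrightarrow> measure (uniform_measure M A) B = prob (A \<inter> B) / prob A"
  by (intro measure_uniform_measure) (auto simp: emeasure_eq_measure)

lemma AE_cond: "prob A > 0 \<Longrightarrow> (AE x in uniform_measure M A. P x) \<longleftrightarrow> (AE x in M. x \<in> A \<longrightarrow> P x)"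
  by (intro AE_uniform_measure) (auto simp: emeasure_eq_measure)

text \<open>The parametrisation \<open>g\<close> is the quantile function and \<open>f\<close> the distribution function of the
  image of the conditional measure on the line.\<close>

lemma parametrise:
  assumes A: "prob A > 0"
  obtains g f where "g \<in> borel \<rightarrow>\<^sub>M M" "f \<in> borel_measurable M"
    "distr unit_measure M g = uniform_measure M A" "AE s in unit_measure. f (g s) = s"
proof -
  let ?\<nu> = "uniform_measure M A"
  let ?R = "distr ?\<nu> borel F"
  interpret N: prob_space ?\<nu> by (rule prob_space_cond[OF A])
  have F\<nu>: "F \<in> ?\<nu> \<rightarrow>\<^sub>M borel" using F_meas by simp
  interpret R: prob_space ?R by (rule N.prob_space_distr[OF F\<nu>])
  interpret R: cdf_distribution ?R
    by (unfold cdf_distribution_def real_distribution_def real_distribution_axioms_def) (simp add: R.prob_space_axioms)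
  define I' where "I' s = (if s \<in> {0<..<1} then R.I s else 0)" for s
  have I'_meas [measurable]: "I' \<in> borel_measurable borel"
  proof -
    have "{x::real. 0 < x \<and> x < 1} = {0<..<1}" by auto
    then show ?thesis
      unfolding I'_def using R.measurable_CI
      by (subst measurable_If_restrict_space_iff) (simp_all add: measurable_const)
  qed
  have RI: "distr unit_measure borel I' = ?R"
  proof -
    have "distr unit_measure borel I' = distr (restrict_space lborel {0<..<1}) borel R.I"
      unfolding unit_measure_def by (intro distr_cong) (auto simp: I'_def space_restrict_space)
    then show ?thesis using R.distr_I_eq_M by simp
  qed
  define g where "g = (\<lambda>s. D (I' s))"
  define f where "f = (\<lambda>x. R.C (F x))"
  have g: "g \<in> borel \<rightarrow>\<^sub>M M" unfolding g_def by measurable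
  have f: "f \<in> borel_measurable M" unfolding f_def using R.measurable_C by measurable
  \<comment> \<open>The image measure lives on the range of F, where the left inverse D is also a
    right inverse.\<close>
  have FD: "AE r in ?R. F (D r) = r"
    by (subst AE_distr_iff[OF F\<nu>]) (auto simp: D_F)
  then have "AE s in unit_measure. F (D (I' s)) = I' s"
    unfolding RI[symmetric] by (subst (asm) AE_distr_iff) (auto intro: measurable_unit_measure)
  \<comment> \<open>A distribution function composed with its quantile function is the identity
    where the distribution function is continuous; this is where absence of atoms enters.\<close>
  moreover have "R.C (I' s) = s" if s: "s \<in> space unit_measure" for s
  proof -
    have s01: "0 < s" "s < 1" using s by (auto simp: space_unit_measure)
    have I's: "I' s = R.I s" unfolding I'_def using s01 by (intro if_P) simp
    have ps: "s \<le> R.C x \<longleftrightarrow> I' s \<le> x" for x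
      unfolding I's by (rule R.pseudoinverse[OF s01])
    have "R.prob {I' s} = 0"
    proof -
      have "R.prob {I' s} = prob (A \<inter> (F -` {I' s} \<inter> space M)) / prob A"
        using prob_cond[OF A] by (subst measure_distr[OF F\<nu>]) auto
      also have "prob (A \<inter> (F -` {I' s} \<inter> space M)) \<le> prob (F -` {I' s} \<inter> space M)"
        by (intro finite_measure_mono) auto
      finally show ?thesis using atomless[of "I' s"] A by (simp add: measure_le_0_iff field_simps)
    qed
    then have "isCont R.C (I' s)" by (simp add: R.isCont_cdf)
    \<comment> \<open>To the left of \<open>I' s\<close> the distribution function stays below s, by
      the pseudoinverse relation; continuity carries the bound to \<open>I' s\<close>
      itself.\<close>
    then have lim: "(R.C \<longlongrightarrow> R.C (I' s)) (at_left (I' s))"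
      by (simp add: isCont_def filterlim_at_split)
    have "R.C (I' s) \<le> s"
      by (rule tendsto_upperbound[OF lim])
        (use ps in \<open>auto simp: eventually_at_filter not_le intro!: always_eventually less_imp_le simp flip: not_le\<close>)
    then show ?thesis using ps[of "I' s"] by simp
  qed
  ultimately have fg: "AE s in unit_measure. f (g s) = s"
    unfolding f_def g_def by (auto elim!: AE_mp)
  have "distr unit_measure M g = distr ?R M D"
    unfolding g_def RI[symmetric] by (subst distr_distr) (auto simp: o_def intro: measurable_unit_measure)
  also have "\<dots> = distr ?\<nu> M (\<lambda>x. D (F x))"
    by (subst distr_distr) (auto simp: o_def F\<nu>)
  also have "\<dots> = distr ?\<nu> ?\<nu> (\<lambda>x. x)"
    by (intro distr_cong) (auto simp: D_F)
  finally have "distr unit_measure M g = ?\<nu>" by simp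
  then show thesis using that g f fg by blast
qed

text \<open>Both conditional measures are isomorphic to the unit interval; \<phi> goes from A to the
  interval and from there to B.\<close>

lemma isomorphism:
  assumes A: "prob A > 0" and B: "prob B > 0"
  obtains \<phi> \<psi> where "\<phi> \<in> M \<rightarrow>\<^sub>M M" "\<psi> \<in> M \<rightarrow>\<^sub>M M"
    "distr (uniform_measure M A) M \<phi> = uniform_measure M B"
    "distr (uniform_measure M B) M \<psi> = uniform_measure M A"
    "AE x in M. x \<in> A \<longrightarrow> \<psi> (\<phi> x) = x" "AE y in M. y \<in> B \<longrightarrow> \<phi> (\<psi> y) = y"
proof -
  obtain gA fA where a: "gA \<in> borel \<rightarrow>\<^sub>M M" "fA \<in> borel_measurable M"
    "distr unit_measure M gA = uniform_measure M A" "AE s in unit_measure. fA (gA s) = s"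
    by (rule parametrise[OF A])
  obtain gB fB where b: "gB \<in> borel \<rightarrow>\<^sub>M M" "fB \<in> borel_measurable M"
    "distr unit_measure M gB = uniform_measure M B" "AE s in unit_measure. fB (gB s) = s"
    by (rule parametrise[OF B])
  note [measurable] = a(1,2) b(1,2) measurable_unit_measure[OF a(1)] measurable_unit_measure[OF b(1)]
  define \<phi> where "\<phi> = (\<lambda>x. gB (fA x))"
  define \<psi> where "\<psi> = (\<lambda>x. gA (fB x))"
  have m [measurable]: "\<phi> \<in> M \<rightarrow>\<^sub>M M" "\<psi> \<in> M \<rightarrow>\<^sub>M M" by (simp_all add: \<phi>_def \<psi>_def)
  have "distr (uniform_measure M A) M \<phi> = distr unit_measure M (\<lambda>s. \<phi> (gA s))"
    unfolding a(3)[symmetric] by (subst distr_distr) (auto simp: o_def)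
  also have "\<dots> = distr unit_measure M gB"
    by (intro distr_cong_AE) (use a(4) in \<open>auto simp: \<phi>_def elim!: AE_mp\<close>)
  finally have 1: "distr (uniform_measure M A) M \<phi> = uniform_measure M B" by (simp add: b(3))
  have "distr (uniform_measure M B) M \<psi> = distr unit_measure M (\<lambda>s. \<psi> (gB s))"
    unfolding b(3)[symmetric] by (subst distr_distr) (auto simp: o_def)
  also have "\<dots> = distr unit_measure M gA"
    by (intro distr_cong_AE) (use b(4) in \<open>auto simp: \<psi>_def elim!: AE_mp\<close>)
  finally have 2: "distr (uniform_measure M B) M \<psi> = uniform_measure M A" by (simp add: a(3))
  \<comment> \<open>The equality \<open>gA (fA x) = x\<close> is established after applying F, since
    an equation between real-valued measurable functions defines a measurable set. D then removes
    F.\<close>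
  have key: "AE x in M. x \<in> A \<longrightarrow> fB (\<phi> x) = fA x \<and> gA (fA x) = x"
  proof -
    have "AE s in unit_measure. F (gA (fA (gA s))) = F (gA s) \<and> fB (\<phi> (gA s)) = fA (gA s)"
      using a(4) b(4) by eventually_elim (simp add: \<phi>_def)
    then have "AE x in distr unit_measure M gA. F (gA (fA x)) = F x \<and> fB (\<phi> x) = fA x"
      by (subst AE_distr_iff) auto
    then have "AE x in M. x \<in> A \<longrightarrow> F (gA (fA x)) = F x \<and> fB (\<phi> x) = fA x"
      unfolding a(3) AE_cond[OF A] .
    then show ?thesis
    proof (rule AE_mp, intro AE_I2 impI conjI)
      fix x assume x: "x \<in> space M" "x \<in> A \<longrightarrow> F (gA (fA x)) = F x \<and> fB (\<phi> x) = fA x" "x \<in> A"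
      then have "D (F (gA (fA x))) = D (F x)" by simp
      moreover have "gA (fA x) \<in> space M" using measurable_space[OF a(1)] by simp
      ultimately show "gA (fA x) = x" using x(1) by (simp add: D_F)
      show "fB (\<phi> x) = fA x" using x by simp
    qed
  qed
  have key': "AE x in M. x \<in> B \<longrightarrow> fA (\<psi> x) = fB x \<and> gB (fB x) = x"
  proof -
    have "AE s in unit_measure. F (gB (fB (gB s))) = F (gB s) \<and> fA (\<psi> (gB s)) = fB (gB s)"
      using a(4) b(4) by eventually_elim (simp add: \<psi>_def)
    then have "AE x in distr unit_measure M gB. F (gB (fB x)) = F x \<and> fA (\<psi> x) = fB x"
      by (subst AE_distr_iff) auto
    then have "AE x in M. x \<in> B \<longrightarrow> F (gB (fB x)) = F x \<and> fA (\<psi> x) = fB x"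
      unfolding b(3) AE_cond[OF B] .
    then show ?thesis
    proof (rule AE_mp, intro AE_I2 impI conjI)
      fix x assume x: "x \<in> space M" "x \<in> B \<longrightarrow> F (gB (fB x)) = F x \<and> fA (\<psi> x) = fB x" "x \<in> B"
      then have "D (F (gB (fB x))) = D (F x)" by simp
      moreover have "gB (fB x) \<in> space M" using measurable_space[OF b(1)] by simp
      ultimately show "gB (fB x) = x" using x(1) by (simp add: D_F)
      show "fA (\<psi> x) = fB x" using x by simp
    qed
  qed
  have "AE x in M. x \<in> A \<longrightarrow> \<psi> (\<phi> x) = x"
    using key by eventually_elim (auto simp: \<psi>_def)
  moreover have "AE x in M. x \<in> B \<longrightarrow> \<phi> (\<psi> x) = x"
    using key' by eventually_elim (auto simp: \<phi>_def)
  ultimately show thesis using that m 1 2 by blast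
qed

text \<open>A sublevel set of the inverse parametrisation f of the conditional measure on A has
  conditional probability equal to its level, so every value between 0 and \<open>prob A\<close> is
  attained.\<close>

lemma split_event:
  assumes A: "A \<in> events" and c: "0 \<le> c" "c \<le> prob A"
  shows "\<exists>A'\<in>events. A' \<subseteq> A \<and> prob A' = c"
proof (cases "prob A = 0")
  case True
  then show ?thesis using c by (intro bexI[of _ "{}"]) auto
next
  case False
  then have pA: "prob A > 0" by (simp add: zero_less_measure_iff)
  obtain g f where gf: "g \<in> borel \<rightarrow>\<^sub>M M" "f \<in> borel_measurable M"
    "distr unit_measure M g = uniform_measure M A" "AE s in unit_measure. f (g s) = s"
    by (rule parametrise[OF pA])
  note [measurable] = gf(1,2) measurable_unit_measure[OF gf(1)]
  interpret U: prob_space unit_measure by (rule prob_space_unit_measure)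
  let ?t = "c / prob A"
  let ?E = "{x \<in> space M. f x \<le> ?t}"
  have E: "?E \<in> events" by measurable
  have t: "0 \<le> ?t" "?t \<le> 1" using c pA by auto
  have id: "(\<lambda>s. s) \<in> borel_measurable unit_measure" by (intro measurable_unit_measure) simp
  have "prob (A \<inter> ?E) / prob A = measure (distr unit_measure M g) ?E"
    by (simp add: gf(3) prob_cond[OF pA E])
  also have "\<dots> = measure unit_measure (g -` ?E \<inter> space unit_measure)"
    by (intro measure_distr) (auto simp: E)
  also have "\<dots> = measure unit_measure {s \<in> space unit_measure. s \<le> ?t}"
  proof (intro U.finite_measure_eq_AE)
    show "AE s in unit_measure. (s \<in> g -` ?E \<inter> space unit_measure) = (s \<in> {s \<in> space unit_measure. s \<le> ?t})"
      using gf(4)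
    proof (rule AE_mp, intro AE_I2 impI)
      fix s assume "s \<in> space unit_measure" "f (g s) = s"
      moreover have "g s \<in> space M" using measurable_space[OF gf(1)] by simp
      ultimately show "(s \<in> g -` ?E \<inter> space unit_measure) = (s \<in> {s \<in> space unit_measure. s \<le> ?t})" by simp
    qed
  qed (use id E in \<open>auto intro: measurable_sets\<close>)
  also have "\<dots> = ?t" by (rule measure_unit_measure_atMost[OF t])
  finally have "prob (A \<inter> ?E) = c" using pA by simp
  then show ?thesis using A E by (intro bexI[of _ "A \<inter> ?E"]) auto
qed

lemma split_event_finite:
  assumes "finite I" "A \<in> events" "\<And>i. i \<in> I \<Longrightarrow> 0 \<le> c i" "sum c I \<le> prob A"
  shows "\<exists>S. (\<forall>i\<in>I. S i \<in> events \<and> S i \<subseteq> A \<and> prob (S i) = c i) \<and> disjoint_family_on S I"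
  using assms
proof (induction I arbitrary: A rule: finite_induct)
  case empty
  then show ?case by (simp add: disjoint_family_on_def)
next
  case (insert j I)
  have "0 \<le> sum c I" using insert.prems by (intro sum_nonneg) auto
  then obtain A' where A': "A' \<in> events" "A' \<subseteq> A" "prob A' = c j"
    using split_event[of A "c j"] insert.prems insert.hyps by auto
  have "prob (A - A') = prob A - c j" using A' insert.prems by (simp add: finite_measure_Diff)
  then obtain S where S: "\<forall>i\<in>I. S i \<in> events \<and> S i \<subseteq> A - A' \<and> prob (S i) = c i" "disjoint_family_on S I"
    using insert.IH[of "A - A'"] insert.prems insert.hyps A' by auto
  let ?S = "S(j := A')"
  have "disjoint_family_on ?S (insert j I)"
    using S insert.hyps unfolding disjoint_family_on_def by (auto simp: Int_commute split: if_splits)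
  moreover have "\<forall>i\<in>insert j I. ?S i \<in> events \<and> ?S i \<subseteq> A \<and> prob (?S i) = c i"
    using S A' insert.hyps by auto
  ultimately show ?case by blast
qed

lemma piecewise_map:
  assumes "finite I" "disjoint_family_on S I" "\<And>i. i \<in> I \<Longrightarrow> S i \<in> events \<and> \<phi> i \<in> M \<rightarrow>\<^sub>M M"
  shows "\<exists>f\<in>M \<rightarrow>\<^sub>M M. \<forall>i\<in>I. \<forall>x\<in>S i. f x = \<phi> i x"
  using assms
proof (induction I rule: finite_induct)
  case empty
  then show ?case by (intro bexI[of _ "\<lambda>x. x"]) auto
next
  case (insert j I)
  then obtain f where f: "f \<in> M \<rightarrow>\<^sub>M M" "\<forall>i\<in>I. \<forall>x\<in>S i. f x = \<phi> i x"
    by (auto simp: disjoint_family_on_def)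
  let ?f = "\<lambda>x. if x \<in> S j then \<phi> j x else f x"
  have "?f \<in> M \<rightarrow>\<^sub>M M"
    using insert.prems f by (intro measurable_If_set) (auto intro: sets.Int_space_eq2[THEN ssubst])
  moreover have "\<forall>i\<in>insert j I. \<forall>x\<in>S i. ?f x = \<phi> i x"
    using f insert.prems insert.hyps by (fastforce simp: disjoint_family_on_def)
  ultimately show ?case by (intro bexI[of _ ?f])
qed

lemma parts_mod_null:
  assumes "finite I" and A: "A \<in> events" and S: "\<forall>i\<in>I. S i \<in> events \<and> S i \<subseteq> A"
    and dis: "disjoint_family_on S I" and sum: "(\<Sum>i\<in>I. prob (S i)) = prob A"
  shows "AE x in M. x \<in> A \<longrightarrow> x \<in> (\<Union>i\<in>I. S i)"
    and "E \<in> events \<Longrightarrow> prob (A \<inter> E) = (\<Sum>i\<in>I. prob (S i \<inter> E))"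
proof -
  let ?U = "\<Union>i\<in>I. S i"
  have U: "?U \<in> events" "?U \<subseteq> A" using S \<open>finite I\<close> by auto
  have "prob ?U = prob A"
    using sum finite_measure_finite_Union[OF \<open>finite I\<close>, of S] S dis by auto
  then have "prob (A - ?U) = 0" using U A by (simp add: finite_measure_Diff)
  then have "A - ?U \<in> null_sets M" using A U by (intro null_setsI) (auto simp: emeasure_eq_measure)
  then have "AE x in M. x \<notin> A - ?U" by (rule AE_not_in)
  then show ae: "AE x in M. x \<in> A \<longrightarrow> x \<in> (\<Union>i\<in>I. S i)" by eventually_elim auto
  assume E: "E \<in> events"
  have "prob (A \<inter> E) = prob (\<Union>i\<in>I. S i \<inter> E)"
    using ae by (intro finite_measure_eq_AE) (use A E U S \<open>finite I\<close> in \<open>auto elim!: AE_mp\<close>)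
  also have "\<dots> = (\<Sum>i\<in>I. prob (S i \<inter> E))"
  proof (intro finite_measure_finite_Union)
    show "disjoint_family_on (\<lambda>i. S i \<inter> E) I" using dis unfolding disjoint_family_on_def by blast
  qed (use S E \<open>finite I\<close> in auto)
  finally show "prob (A \<inter> E) = (\<Sum>i\<in>I. prob (S i \<inter> E))" .
qed

text \<open>Preservation of measure is required as an identity of relative measures, a form that can
  be summed over the pieces of a map defined piecewise.\<close>

lemma invertible_mp_mapI:
  assumes A: "prob A > 0" and B: "prob B > 0" and "\<phi> \<in> M \<rightarrow>\<^sub>M M" "\<psi> \<in> M \<rightarrow>\<^sub>M M"
    and d: "\<And>E. E \<in> events \<Longrightarrow> prob (A \<inter> (\<phi> -` E \<inter> space M)) / prob A = prob (B \<inter> E) / prob B"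
    and "AE x in M. x \<in> A \<longrightarrow> \<psi> (\<phi> x) = x" "AE y in M. y \<in> B \<longrightarrow> \<phi> (\<psi> y) = y"
  shows "invertible_mp_map (uniform_measure M A) (uniform_measure M B) \<phi>"
proof -
  interpret NA: prob_space "uniform_measure M A" by (rule prob_space_cond[OF A])
  interpret NB: prob_space "uniform_measure M B" by (rule prob_space_cond[OF B])
  have m: "\<phi> \<in> uniform_measure M A \<rightarrow>\<^sub>M uniform_measure M B" "\<psi> \<in> uniform_measure M B \<rightarrow>\<^sub>M uniform_measure M A"
    using assms(3,4) by (simp_all cong: measurable_cong_sets)
  have "distr (uniform_measure M A) (uniform_measure M B) \<phi> = uniform_measure M B"
  proof (rule measure_eqI)
    fix E assume "E \<in> sets (distr (uniform_measure M A) (uniform_measure M B) \<phi>)"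
    then have E: "E \<in> events" by simp
    have "\<phi> -` E \<inter> space M \<in> events" using assms(3) E by (rule measurable_sets)
    then show "emeasure (distr (uniform_measure M A) (uniform_measure M B) \<phi>) E = emeasure (uniform_measure M B) E"
      using d[OF E] by (simp add: emeasure_distr[OF m(1)] E NA.emeasure_eq_measure NB.emeasure_eq_measure
          prob_cond[OF A] prob_cond[OF B] del: emeasure_uniform_measure)
  qed simp
  then show ?thesis
    unfolding invertible_mp_map_def using m assms(6,7) by (auto simp: AE_cond[OF A] AE_cond[OF B])
qed

text \<open>Corresponding pieces have the same relative weight \<open>c i\<close> in A and in B, so
  isomorphisms between their conditional measures fit together. As the weights add up to 1, the
  pieces exhaust A and B up to null sets.\<close>

lemma glue_isomorphisms:
  assumes fin: "finite I" and A: "A \<in> events" "prob A > 0" and B: "B \<in> events" "prob B > 0"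
    and S: "\<And>i. i \<in> I \<Longrightarrow> S i \<in> events \<and> S i \<subseteq> A \<and> prob (S i) = c i * prob A"
    and T: "\<And>i. i \<in> I \<Longrightarrow> T i \<in> events \<and> T i \<subseteq> B \<and> prob (T i) = c i * prob B"
    and dis: "disjoint_family_on S I" "disjoint_family_on T I" and c: "\<And>i. i \<in> I \<Longrightarrow> c i > 0" "sum c I = 1"
  shows "\<exists>\<phi>\<in>M \<rightarrow>\<^sub>M M. invertible_mp_map (uniform_measure M A) (uniform_measure M B) \<phi> \<and>
    (AE x in M. \<forall>i\<in>I. x \<in> S i \<longrightarrow> \<phi> x \<in> T i)"
proof -
  have pos: "prob (S i) > 0" "prob (T i) > 0" if "i \<in> I" for i
    using S T A B c(1) that by auto
  define P where "P i \<phi> \<psi> \<longleftrightarrow> \<phi> \<in> M \<rightarrow>\<^sub>M M \<and> \<psi> \<in> M \<rightarrow>\<^sub>M M \<and>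
    distr (uniform_measure M (S i)) M \<phi> = uniform_measure M (T i) \<and>
    distr (uniform_measure M (T i)) M \<psi> = uniform_measure M (S i) \<and>
    (AE x in M. x \<in> S i \<longrightarrow> \<psi> (\<phi> x) = x) \<and> (AE y in M. y \<in> T i \<longrightarrow> \<phi> (\<psi> y) = y)" for i \<phi> \<psi>
  have "\<exists>\<phi> \<psi>. P i \<phi> \<psi>" if "i \<in> I" for i
    unfolding P_def by (rule isomorphism[OF pos[OF that]]) blast
  then obtain \<phi>i \<psi>i where "\<And>i. i \<in> I \<Longrightarrow> P i (\<phi>i i) (\<psi>i i)" by metis
  then have iso:
    "\<And>i. i \<in> I \<Longrightarrow> \<phi>i i \<in> M \<rightarrow>\<^sub>M M" "\<And>i. i \<in> I \<Longrightarrow> \<psi>i i \<in> M \<rightarrow>\<^sub>M M"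
    "\<And>i. i \<in> I \<Longrightarrow> distr (uniform_measure M (S i)) M (\<phi>i i) = uniform_measure M (T i)"
    "\<And>i. i \<in> I \<Longrightarrow> distr (uniform_measure M (T i)) M (\<psi>i i) = uniform_measure M (S i)"
    "\<And>i. i \<in> I \<Longrightarrow> AE x in M. x \<in> S i \<longrightarrow> \<psi>i i (\<phi>i i x) = x"
    "\<And>i. i \<in> I \<Longrightarrow> AE y in M. y \<in> T i \<longrightarrow> \<phi>i i (\<psi>i i y) = y"
    unfolding P_def by simp_all
  have sumS: "(\<Sum>i\<in>I. prob (S i)) = prob A" "(\<Sum>i\<in>I. prob (T i)) = prob B"
    using S T c(2) by (simp_all add: sum_distrib_right[symmetric])
  have SA: "\<forall>i\<in>I. S i \<in> events \<and> S i \<subseteq> A" and TB: "\<forall>i\<in>I. T i \<in> events \<and> T i \<subseteq> B"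
    using S T by blast+
  note pS = parts_mod_null[OF fin A(1) SA dis(1) sumS(1)]
  note pT = parts_mod_null[OF fin B(1) TB dis(2) sumS(2)]
  have "\<exists>f\<in>M \<rightarrow>\<^sub>M M. \<forall>i\<in>I. \<forall>x\<in>S i. f x = \<phi>i i x"
    using S iso(1) by (intro piecewise_map fin dis) auto
  then obtain \<phi> where \<phi>: "\<phi> \<in> M \<rightarrow>\<^sub>M M" "\<And>i x. i \<in> I \<Longrightarrow> x \<in> S i \<Longrightarrow> \<phi> x = \<phi>i i x"
    by blast
  have "\<exists>f\<in>M \<rightarrow>\<^sub>M M. \<forall>i\<in>I. \<forall>x\<in>T i. f x = \<psi>i i x"
    using T iso(2) by (intro piecewise_map fin dis) auto
  then obtain \<psi> where \<psi>: "\<psi> \<in> M \<rightarrow>\<^sub>M M" "\<And>i x. i \<in> I \<Longrightarrow> x \<in> T i \<Longrightarrow> \<psi> x = \<psi>i i x"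
    by blast
  have inT: "AE x in M. x \<in> S i \<longrightarrow> \<phi>i i x \<in> T i" if i: "i \<in> I" for i
  proof -
    have "AE y in uniform_measure M (T i). y \<in> T i" by (simp add: AE_cond[OF pos(2)[OF i]])
    then have "AE y in distr (uniform_measure M (S i)) M (\<phi>i i). y \<in> T i" by (subst iso(3)[OF i])
    moreover have "{x \<in> space M. x \<in> T i} = T i \<inter> space M" by auto
    ultimately have "AE x in uniform_measure M (S i). \<phi>i i x \<in> T i"
      using iso(1)[OF i] T[OF i] by (subst (asm) AE_distr_iff) auto
    then show ?thesis by (simp add: AE_cond[OF pos(1)[OF i]])
  qed
  have inS: "AE x in M. x \<in> T i \<longrightarrow> \<psi>i i x \<in> S i" if i: "i \<in> I" for i
  proof -
    have "AE y in uniform_measure M (S i). y \<in> S i" by (simp add: AE_cond[OF pos(1)[OF i]])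
    then have "AE y in distr (uniform_measure M (T i)) M (\<psi>i i). y \<in> S i" by (subst iso(4)[OF i])
    moreover have "{x \<in> space M. x \<in> S i} = S i \<inter> space M" by auto
    ultimately have "AE x in uniform_measure M (T i). \<psi>i i x \<in> S i"
      using iso(2)[OF i] S[OF i] by (subst (asm) AE_distr_iff) auto
    then show ?thesis by (simp add: AE_cond[OF pos(2)[OF i]])
  qed
  have "AE x in M. \<forall>i\<in>I. x \<in> S i \<longrightarrow> \<psi>i i (\<phi>i i x) = x \<and> \<phi>i i x \<in> T i"
  proof (intro AE_finite_allI fin)
    fix i assume "i \<in> I"
    from iso(5)[OF this] inT[OF this]
    show "AE x in M. x \<in> S i \<longrightarrow> \<psi>i i (\<phi>i i x) = x \<and> \<phi>i i x \<in> T i" by eventually_elim simp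
  qed
  then have inv1: "AE x in M. x \<in> A \<longrightarrow> \<psi> (\<phi> x) = x" and inT': "AE x in M. \<forall>i\<in>I. x \<in> S i \<longrightarrow> \<phi> x \<in> T i"
    using pS(1) by (eventually_elim; force simp: \<phi>(2) \<psi>(2))+
  have "AE x in M. \<forall>i\<in>I. x \<in> T i \<longrightarrow> \<phi>i i (\<psi>i i x) = x \<and> \<psi>i i x \<in> S i"
  proof (intro AE_finite_allI fin)
    fix i assume "i \<in> I"
    from iso(6)[OF this] inS[OF this]
    show "AE x in M. x \<in> T i \<longrightarrow> \<phi>i i (\<psi>i i x) = x \<and> \<psi>i i x \<in> S i" by eventually_elim simp
  qed
  then have inv2: "AE x in M. x \<in> B \<longrightarrow> \<phi> (\<psi> x) = x"
    using pT(1) by (eventually_elim; force simp: \<phi>(2) \<psi>(2))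
  have "prob (A \<inter> (\<phi> -` E \<inter> space M)) / prob A = prob (B \<inter> E) / prob B" if E: "E \<in> events" for E
  proof -
    have \<phi>E: "\<phi> -` E \<inter> space M \<in> events" using \<phi>(1) E by (rule measurable_sets)
    have "prob (S i \<inter> (\<phi> -` E \<inter> space M)) / prob A = prob (T i \<inter> E) / prob B" if i: "i \<in> I" for i
    proof -
      have \<phi>iE: "\<phi>i i -` E \<inter> space M \<in> events" using iso(1)[OF i] E by (rule measurable_sets)
      have "S i \<inter> (\<phi> -` E \<inter> space M) = S i \<inter> (\<phi>i i -` E \<inter> space M)"
        using \<phi>(2)[OF i] by auto
      moreover have "measure (distr (uniform_measure M (S i)) M (\<phi>i i)) E = measure (uniform_measure M (T i)) E"
        by (simp add: iso(3)[OF i])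
      then have "prob (S i \<inter> (\<phi>i i -` E \<inter> space M)) / prob (S i) = prob (T i \<inter> E) / prob (T i)"
        using iso(1)[OF i] E \<phi>iE by (simp add: measure_distr prob_cond[OF pos(1)[OF i]] prob_cond[OF pos(2)[OF i]])
      ultimately show ?thesis using S[OF i] T[OF i] c(1)[OF i] A B by (simp add: field_simps)
    qed
    then have "(\<Sum>i\<in>I. prob (S i \<inter> (\<phi> -` E \<inter> space M)) / prob A) = (\<Sum>i\<in>I. prob (T i \<inter> E) / prob B)"
      by (intro sum.cong) auto
    then show ?thesis using pS(2)[OF \<phi>E] pT(2)[OF E] by (simp add: sum_divide_distrib)
  qed
  then have "invertible_mp_map (uniform_measure M A) (uniform_measure M B) \<phi>"
    by (intro invertible_mp_mapI[of A B \<phi> \<psi>] A B \<phi> \<psi> inv1 inv2)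
  then show ?thesis using \<phi>(1) inT' by blast
qed

text \<open>The part of A where X = c is cut into pieces of relative mass
  \<open>pmf \<gamma> i\<close>, one for each i with first component c; B is cut likewise by second
  components. A map sending the i-th piece of A onto the i-th piece of B makes the pair
  \<open>(X x, X (\<phi> x))\<close> follow \<gamma>. Cutting to arbitrary masses is possible
  because there are no atoms.\<close>

theorem realise_coupling:
  fixes X :: "'x \<Rightarrow> 'c" and \<gamma> :: "('c \<times> 'c) pmf"
  assumes X: "simple_function M X" and A: "A \<in> events" "prob A > 0" and B: "B \<in> events" "prob B > 0"
    and fin: "finite (set_pmf \<gamma>)"
    and fst: "\<And>c. pmf (map_pmf fst \<gamma>) c = prob (A \<inter> (X -` {c} \<inter> space M)) / prob A"
    and snd: "\<And>c. pmf (map_pmf snd \<gamma>) c = prob (B \<inter> (X -` {c} \<inter> space M)) / prob B"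
  shows "\<exists>\<phi> G. invertible_mp_map (uniform_measure M A) (uniform_measure M B) \<phi> \<and> G \<in> events \<and>
    measure (uniform_measure M A) G \<ge> 1 - measure_pmf.prob \<gamma> Bad \<and> (\<forall>x\<in>G. (X x, X (\<phi> x)) \<notin> Bad)"
proof -
  let ?I = "set_pmf \<gamma>"
  have XE: "X -` {c} \<inter> space M \<in> events" for c
    using X by (simp add: simple_functionD(2))
  have "\<exists>S. (\<forall>i\<in>?I. S i \<in> events \<and> S i \<subseteq> A \<and> X ` S i \<subseteq> {fst i} \<and> prob (S i) = pmf \<gamma> i * prob A) \<and> disjoint_family_on S ?I"
  proof -
    have "\<forall>c. \<exists>S. (\<forall>i\<in>{i\<in>?I. fst i = c}. S i \<in> events \<and> S i \<subseteq> A \<inter> (X -` {c} \<inter> space M) \<and> prob (S i) = pmf \<gamma> i * prob A) \<and>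
      disjoint_family_on S {i\<in>?I. fst i = c}"
    proof (rule allI, rule split_event_finite)
      fix c
      \<comment> \<open>The prescribed masses over c add up to the first marginal of \<gamma> at c,
        so they fit into the level set.\<close>
      have "(\<Sum>i\<in>{i\<in>?I. fst i = c}. pmf \<gamma> i) = measure \<gamma> {i\<in>?I. fst i = c}"
        using fin by (simp add: measure_measure_pmf_finite)
      also have "\<dots> = pmf (map_pmf fst \<gamma>) c"
        unfolding pmf_map by (intro measure_pmf.finite_measure_eq_AE) (auto simp: AE_measure_pmf_iff)
      finally show "(\<Sum>i\<in>{i\<in>?I. fst i = c}. pmf \<gamma> i * prob A) \<le> prob (A \<inter> (X -` {c} \<inter> space M))"
        using A by (simp add: fst sum_distrib_right[symmetric])
    qed (use fin A XE in auto)
    from choice[OF this]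
    obtain S where "\<forall>c. (\<forall>i\<in>{i\<in>?I. fst i = c}. S c i \<in> events \<and> S c i \<subseteq> A \<inter> (X -` {c} \<inter> space M) \<and> prob (S c i) = pmf \<gamma> i * prob A) \<and>
      disjoint_family_on (S c) {i\<in>?I. fst i = c}" by blast
    then have S: "\<And>c i. i \<in> ?I \<Longrightarrow> fst i = c \<Longrightarrow> S c i \<in> events \<and> S c i \<subseteq> A \<inter> (X -` {c} \<inter> space M) \<and> prob (S c i) = pmf \<gamma> i * prob A"
      "\<And>c. disjoint_family_on (S c) {i\<in>?I. fst i = c}" by blast+
    have "disjoint_family_on (\<lambda>i. S (fst i) i) ?I"
      unfolding disjoint_family_on_def
    proof (intro ballI impI)
      fix i j assume ij: "i \<in> ?I" "j \<in> ?I" "i \<noteq> j"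
      show "S (fst i) i \<inter> S (fst j) j = {}"
      proof (cases "fst i = fst j")
        case True
        then show ?thesis using disjoint_family_onD[OF S(2)[of "fst i"], of i j] ij by simp
      next
        case False
        have "S (fst i) i \<subseteq> X -` {fst i}" "S (fst j) j \<subseteq> X -` {fst j}"
          using S(1)[OF ij(1) refl] S(1)[OF ij(2) refl] by simp_all
        then show ?thesis using False by (metis disjoint_iff subsetD vimage_singleton_eq)
      qed
    qed
    moreover have "\<forall>i\<in>?I. S (fst i) i \<in> events \<and> S (fst i) i \<subseteq> A \<and> X ` S (fst i) i \<subseteq> {fst i} \<and> prob (S (fst i) i) = pmf \<gamma> i * prob A"
    proof
      fix i assume "i \<in> ?I"
      from S(1)[OF this refl]
      show "S (fst i) i \<in> events \<and> S (fst i) i \<subseteq> A \<and> X ` S (fst i) i \<subseteq> {fst i} \<and> prob (S (fst i) i) = pmf \<gamma> i * prob A"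
        unfolding image_subset_iff_subset_vimage by simp
    qed
    ultimately show ?thesis by (intro exI[of _ "\<lambda>i. S (fst i) i"] conjI)
  qed
  then obtain S where S': "(\<forall>i\<in>?I. S i \<in> events \<and> S i \<subseteq> A \<and> X ` S i \<subseteq> {fst i} \<and> prob (S i) = pmf \<gamma> i * prob A) \<and>
    disjoint_family_on S ?I" by (elim exE) (rule that)
  note S = bspec[OF conjunct1[OF S']] conjunct2[OF S']
  have "\<exists>T. (\<forall>i\<in>?I. T i \<in> events \<and> T i \<subseteq> B \<and> X ` T i \<subseteq> {snd i} \<and> prob (T i) = pmf \<gamma> i * prob B) \<and> disjoint_family_on T ?I"
  proof -
    have "\<forall>c. \<exists>S. (\<forall>i\<in>{i\<in>?I. snd i = c}. S i \<in> events \<and> S i \<subseteq> B \<inter> (X -` {c} \<inter> space M) \<and> prob (S i) = pmf \<gamma> i * prob B) \<and>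
      disjoint_family_on S {i\<in>?I. snd i = c}"
    proof (rule allI, rule split_event_finite)
      fix c
      have "(\<Sum>i\<in>{i\<in>?I. snd i = c}. pmf \<gamma> i) = measure \<gamma> {i\<in>?I. snd i = c}"
        using fin by (simp add: measure_measure_pmf_finite)
      also have "\<dots> = pmf (map_pmf snd \<gamma>) c"
        unfolding pmf_map by (intro measure_pmf.finite_measure_eq_AE) (auto simp: AE_measure_pmf_iff)
      finally show "(\<Sum>i\<in>{i\<in>?I. snd i = c}. pmf \<gamma> i * prob B) \<le> prob (B \<inter> (X -` {c} \<inter> space M))"
        using B by (simp add: snd sum_distrib_right[symmetric])
    qed (use fin B XE in auto)
    from choice[OF this]
    obtain S where "\<forall>c. (\<forall>i\<in>{i\<in>?I. snd i = c}. S c i \<in> events \<and> S c i \<subseteq> B \<inter> (X -` {c} \<inter> space M) \<and> prob (S c i) = pmf \<gamma> i * prob B) \<and>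
      disjoint_family_on (S c) {i\<in>?I. snd i = c}" by blast
    then have S: "\<And>c i. i \<in> ?I \<Longrightarrow> snd i = c \<Longrightarrow> S c i \<in> events \<and> S c i \<subseteq> B \<inter> (X -` {c} \<inter> space M) \<and> prob (S c i) = pmf \<gamma> i * prob B"
      "\<And>c. disjoint_family_on (S c) {i\<in>?I. snd i = c}" by blast+
    have "disjoint_family_on (\<lambda>i. S (snd i) i) ?I"
      unfolding disjoint_family_on_def
    proof (intro ballI impI)
      fix i j assume ij: "i \<in> ?I" "j \<in> ?I" "i \<noteq> j"
      show "S (snd i) i \<inter> S (snd j) j = {}"
      proof (cases "snd i = snd j")
        case True
        then show ?thesis using disjoint_family_onD[OF S(2)[of "snd i"], of i j] ij by simp
      next
        case False
        have "S (snd i) i \<subseteq> X -` {snd i}" "S (snd j) j \<subseteq> X -` {snd j}"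
          using S(1)[OF ij(1) refl] S(1)[OF ij(2) refl] by simp_all
        then show ?thesis using False by (metis disjoint_iff subsetD vimage_singleton_eq)
      qed
    qed
    moreover have "\<forall>i\<in>?I. S (snd i) i \<in> events \<and> S (snd i) i \<subseteq> B \<and> X ` S (snd i) i \<subseteq> {snd i} \<and> prob (S (snd i) i) = pmf \<gamma> i * prob B"
    proof
      fix i assume "i \<in> ?I"
      from S(1)[OF this refl]
      show "S (snd i) i \<in> events \<and> S (snd i) i \<subseteq> B \<and> X ` S (snd i) i \<subseteq> {snd i} \<and> prob (S (snd i) i) = pmf \<gamma> i * prob B"
        unfolding image_subset_iff_subset_vimage by simp
    qed
    ultimately show ?thesis by (intro exI[of _ "\<lambda>i. S (snd i) i"] conjI)
  qed
  then obtain T where T': "(\<forall>i\<in>?I. T i \<in> events \<and> T i \<subseteq> B \<and> X ` T i \<subseteq> {snd i} \<and> prob (T i) = pmf \<gamma> i * prob B) \<and>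
    disjoint_family_on T ?I" by (elim exE) (rule that)
  note T = bspec[OF conjunct1[OF T']] conjunct2[OF T']
  have sum1: "sum (pmf \<gamma>) ?I = 1" using fin by (intro sum_pmf_eq_1) auto
  have "\<exists>\<phi>\<in>M \<rightarrow>\<^sub>M M. invertible_mp_map (uniform_measure M A) (uniform_measure M B) \<phi> \<and>
    (AE x in M. \<forall>i\<in>?I. x \<in> S i \<longrightarrow> \<phi> x \<in> T i)"
  proof (rule glue_isomorphisms[OF fin A B])
    show "S i \<in> events \<and> S i \<subseteq> A \<and> prob (S i) = pmf \<gamma> i * prob A" if "i \<in> ?I" for i
      using S(1)[OF that] by simp
    show "T i \<in> events \<and> T i \<subseteq> B \<and> prob (T i) = pmf \<gamma> i * prob B" if "i \<in> ?I" for i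
      using T(1)[OF that] by simp
  qed (use S(2) T(2) sum1 pmf_positive in auto)
  then obtain \<phi> where \<phi>: "\<phi> \<in> M \<rightarrow>\<^sub>M M" "invertible_mp_map (uniform_measure M A) (uniform_measure M B) \<phi>"
    "AE x in M. \<forall>i\<in>?I. x \<in> S i \<longrightarrow> \<phi> x \<in> T i"
    by (elim bexE conjE) (rule that)
  \<comment> \<open>G is defined through the values themselves, so the pointwise claim holds on all
    of it; it contains, up to a null set, the pieces with index outside Bad.\<close>
  define G where "G = {x \<in> space M. (X x, X (\<phi> x)) \<notin> Bad}"
  have "simple_function M (\<lambda>x. (X x, X (\<phi> x)))"
    by (rule simple_function_Pair[OF X simple_function_comp[OF \<phi>(1) X]])
  then have "(\<lambda>x. (X x, X (\<phi> x))) -` (- Bad) \<inter> space M \<in> events"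
    by (rule measurable_sets[OF measurable_simple_function]) simp
  moreover have "G = (\<lambda>x. (X x, X (\<phi> x))) -` (- Bad) \<inter> space M" by (auto simp: G_def)
  ultimately have G: "G \<in> events" by simp
  let ?J = "?I - Bad"
  have "1 - measure_pmf.prob \<gamma> Bad = measure_pmf.prob \<gamma> (- Bad)"
    using measure_pmf.prob_compl[of Bad \<gamma>] by (simp add: Compl_eq_Diff_UNIV)
  also have "\<dots> = measure_pmf.prob \<gamma> ?J"
    by (intro measure_pmf.finite_measure_eq_AE) (auto simp: AE_measure_pmf_iff)
  also have "\<dots> = (\<Sum>i\<in>?J. prob (S i)) / prob A"
    using fin A S by (simp add: measure_measure_pmf_finite sum_divide_distrib)
  also have "(\<Sum>i\<in>?J. prob (S i)) = prob (\<Union>i\<in>?J. S i)"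
    using fin S by (intro finite_measure_finite_Union[symmetric]) (auto simp: disjoint_family_on_def)
  also have "\<dots> \<le> prob (A \<inter> G)"
  proof (intro finite_measure_mono_AE)
    show "AE x in M. x \<in> (\<Union>i\<in>?J. S i) \<longrightarrow> x \<in> A \<inter> G"
      using \<phi>(3)
    proof (rule AE_mp, intro AE_I2 impI)
      fix x assume x: "x \<in> space M" "\<forall>i\<in>?I. x \<in> S i \<longrightarrow> \<phi> x \<in> T i" "x \<in> (\<Union>i\<in>?J. S i)"
      then obtain i where i: "i \<in> ?I" "i \<notin> Bad" "x \<in> S i" "\<phi> x \<in> T i" by auto
      then have "(X x, X (\<phi> x)) = i" using S(1)[OF i(1)] T(1)[OF i(1)] by (auto simp: prod_eq_iff)
      then show "x \<in> A \<inter> G" using x(1) i S(1)[OF i(1)] by (auto simp: G_def)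
    qed
  qed (use A G in auto)
  finally have "1 - measure_pmf.prob \<gamma> Bad \<le> measure (uniform_measure M A) G"
    using A G by (simp add: prob_cond divide_right_mono)
  then show ?thesis using \<phi>(2) G by (intro exI[of _ \<phi>] exI[of _ G]) (auto simp: G_def)
qed

end

section \<open>Counting the words of the construction\<close>

lemma length_concat_uniform:
  "\<forall>w\<in>set ws. length w = H \<Longrightarrow> length (concat ws) = length ws * H"
  by (induction ws) auto

lemma take_drop_concat_uniform:
  "\<forall>w\<in>set ws. length w = H \<Longrightarrow> j < length ws \<Longrightarrow> b + r \<le> H \<Longrightarrow>
    take r (drop (j * H + b) (concat ws)) = take r (drop b (ws ! j))"
proof (induction ws arbitrary: j)
  case (Cons w ws)
  show ?case
  proof (cases j)
    case 0
    then show ?thesis using Cons.prems by simp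
  next
    case (Suc i)
    have "drop (j * H + b) (concat (w # ws)) = drop (i * H + b) (concat ws)"
      using Cons.prems Suc by simp
    then show ?thesis using Cons Suc by simp
  qed
qed simp

lemma count_list_replicate: "count_list (replicate a x) z = (if x = z then a else 0)"
  by (induction a) auto

lemma count_list_concat_replicate:
  assumes "distinct is" "inj_on f (set is)" "j \<in> set is"
  shows "count_list (concat (map (\<lambda>i. replicate (m i) (f i)) is)) (f j) = m j"
proof -
  note rep = count_list_replicate
  have notin: "count_list (concat (map (\<lambda>i. replicate (m i) (f i)) js)) (f j) = 0" if "f j \<notin> f ` set js" for js
    using that by (induction js) (auto simp: rep)
  show ?thesis using assms
  proof (induction "is")
    case (Cons i js)
    show ?case
    proof (cases "i = j")
      case True
      then have "f j \<notin> f ` set js" using Cons.prems by (auto simp: inj_on_def)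
      then show ?thesis using True by (simp add: rep notin)
    next
      case False
      then have "f i \<noteq> f j" using Cons.prems by (auto simp: inj_on_def)
      then show ?thesis using Cons False by (simp add: rep inj_on_def)
    qed
  qed simp
qed

lemma count_list_concat_replicate_notin:
  "z \<notin> f ` set js \<Longrightarrow> count_list (concat (map (\<lambda>i. replicate (m i) (f i)) js)) z = 0"
  by (auto simp: count_list_0_iff)

lemma length_concat_replicate:
  "length (concat (map (\<lambda>i. replicate (m i) (f i)) js)) = (\<Sum>i\<leftarrow>js. m i)"
  by (induction js) auto

context E_construction
begin

section \<open>Elementary estimates of the parameters\<close>

abbreviation N :: "nat \<Rightarrow> nat" where "N n \<equiv> card (W n)"

definition h :: "nat \<Rightarrow> nat" where "h n = (\<Prod>i<n. k i)"

definition kp :: "nat \<Rightarrow> nat" where "kp n = short_length (\<epsilon> n) (k n)"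

text \<open>The words that may occur in the initial part: the last word of the enumeration is
  reserved for the end.\<close>

definition V :: "nat \<Rightarrow> 'a list set" where "V n = W n - {y n (N n)}"

definition \<tau> :: "nat \<Rightarrow> real" where "\<tau> n = overflow_prob (N n) (k n) (kp n)"

lemma eps_small: "\<epsilon> n < 1 / 2"
proof -
  have "(2::real) ^ 1 \<le> 2 ^ (n + 12)" by (intro power_increasing) auto
  then have "1 / 2 ^ (n + 12) \<le> (1 / 2 :: real)" by (simp add: field_simps)
  then show ?thesis using eps_less[of n] by linarith
qed

text \<open>The hypothesis \<open>\<epsilon> n * N n > 2\<close> together with the upper bound on
  \<open>\<epsilon> n\<close> forces exponential growth, which makes \<open>1 / N n\<close>
  summable.\<close>

lemma N_large: "real (N n) > 2 ^ (n + 12)"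
proof -
  have "2 < \<epsilon> n * real (N n)" by (rule eps_card)
  also have "\<dots> \<le> 1 / 2 ^ (n + 12) * real (N n)"
    using eps_less[of n] by (intro mult_right_mono) auto
  finally have "2 * 2 ^ (n + 12) < real (N n)" by (simp add: field_simps)
  moreover have "(0::real) < 2 ^ (n + 12)" by simp
  ultimately show ?thesis by linarith
qed

lemma N_gt: "N n > 2"
proof -
  have "(4::real) \<le> 2 ^ (n + 12)" using power_increasing[of 2 "n + 12" "2::real"] by simp
  then show ?thesis using N_large[of n] by linarith
qed

lemma finite_W: "finite (W n)"
  using N_gt[of n] by (metis card.infinite not_less_zero)

lemma W_nonempty: "W n \<noteq> {}"
  using N_gt[of n] by auto

lemma k_pos: "k n > 0"
  using k_ge_2[of n] by simp

lemma h_pos: "h n > 0"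
  by (simp add: h_def k_pos)

lemma h_Suc: "h (Suc n) = k n * h n"
  by (simp add: h_def)

lemma h_dvd: "m \<le> n \<Longrightarrow> h m dvd h n"
  by (induction n rule: dec_induct) (auto simp: h_Suc)

lemma h_mono: "m \<le> n \<Longrightarrow> h m \<le> h n"
  using h_dvd h_pos by (simp add: dvd_imp_le)

lemma h_ge: "h n \<ge> 2 ^ n"
proof (induction n)
  case (Suc n)
  then show ?case using mult_mono[OF k_ge_2[of n] Suc] by (simp add: h_Suc)
qed (simp add: h_def)

lemma W_length: "w \<in> W n \<Longrightarrow> length w = h n"
proof (induction n arbitrary: w)
  case 0
  then show ?case by (auto simp: W_0 h_def)
next
  case (Suc n)
  then obtain ws where "w = concat ws" "length ws = k n" "set ws \<subseteq> W n"
    by (auto simp: W_Suc next_words_def)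
  then show ?case using length_concat_uniform[of ws "h n"] Suc.IH by (auto simp: h_Suc)
qed

lemma kp_real: "real (kp n) = (1 - \<epsilon> n) * real (k n)"
proof -
  have "(1 - \<epsilon> n) * real (k n) \<in> \<int>"
    using eps_k_int[of n] by (simp add: left_diff_distrib)
  then have "real_of_int \<lfloor>(1 - \<epsilon> n) * real (k n)\<rfloor> = (1 - \<epsilon> n) * real (k n)"
    by simp
  moreover have "(1 - \<epsilon> n) * real (k n) \<ge> 0" using eps_small[of n] by simp
  ultimately show ?thesis by (simp add: kp_def short_length_def)
qed

lemma k_div_N: "real (k n div N n) = real (k n) / real (N n)" "k n div N n * N n = k n" "k n div N n > 0"
proof -
  show "real (k n div N n) = real (k n) / real (N n)"
    using card_dvd_k[of n] by (rule real_of_nat_div)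
  show *: "k n div N n * N n = k n" using card_dvd_k[of n] by simp
  show "k n div N n > 0" using * k_pos[of n] by (cases "k n div N n") auto
qed

text \<open>As \<open>\<epsilon> n * N n\<close> exceeds 1, the \<open>\<epsilon> n * k n\<close>
  places after the initial part have room for the \<open>k n / N n\<close> copies of the last
  word.\<close>

lemma kp_le: "kp n + k n div N n \<le> k n"
proof -
  have "real (k n) / real (N n) \<le> \<epsilon> n * real (k n)"
    using eps_card[of n] N_gt[of n] mult_right_mono[of 1 "\<epsilon> n * real (N n)" "real (k n)"]
    by (simp add: field_simps)
  then have "real (kp n + k n div N n) \<le> real (k n)"
    by (simp add: kp_real k_div_N(1) algebra_simps)
  then show ?thesis by linarith
qed

lemma kp_less: "kp n < k n"
  using kp_le[of n] k_div_N(3)[of n] by linarith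

lemma y_inj: "inj_on (y n) {1..N n}"
  using enum[of n] by (rule bij_betw_imp_inj_on)

lemma y_image: "y n ` {1..N n} = W n"
  using enum[of n] by (rule bij_betw_imp_surj_on)

lemma y_in: "i \<in> {1..N n} \<Longrightarrow> y n i \<in> W n"
  using y_image by blast

lemma y_last_ne: "i \<in> {1..<N n} \<Longrightarrow> y n (N n) \<noteq> y n i"
  using inj_onD[OF y_inj, of n "N n" i] N_gt[of n] by auto

lemma V_eq: "V n = y n ` {1..<N n}"
proof -
  have "{1..N n} = insert (N n) {1..<N n}" using N_gt[of n] by auto
  then have "W n = insert (y n (N n)) (y n ` {1..<N n})" using y_image[of n] by simp
  moreover have "y n (N n) \<notin> y n ` {1..<N n}"
    using y_last_ne by blast
  ultimately show ?thesis by (metis Diff_insert_absorb V_def)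
qed

lemma card_V: "card (V n) = N n - 1"
  using y_in[of "N n" n] N_gt[of n] finite_W[of n] by (simp add: V_def)

lemma finite_V: "finite (V n)"
  using finite_W by (simp add: V_def)

lemma card_V_pos: "card (V n) > 0"
  using card_V[of n] N_gt[of n] by simp

lemma V_nonempty: "V n \<noteq> {}"
  using card_V_pos[of n] by auto

section \<open>Initial parts and the number of words of the next level\<close>

definition adm :: "nat \<Rightarrow> 'a list list set" where
  "adm n = {xs. length xs = kp n \<and> set xs \<subseteq> V n \<and> (\<forall>i\<in>{1..<N n}. count_list xs (y n i) \<le> k n div N n)}"

lemma adm_nth: "xs \<in> adm n \<Longrightarrow> j < kp n \<Longrightarrow> xs ! j \<in> V n"
  by (auto simp: adm_def)

text \<open>An admissible initial part determines the whole word: the missing copies of each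
  \<open>y n i\<close> follow in the order of the enumeration, then the copies of the reserved word.
  Words of the next level thus correspond to admissible initial parts.\<close>

definition complete :: "nat \<Rightarrow> 'a list list \<Rightarrow> 'a list list" where
  "complete n xs = xs @ concat (map (\<lambda>i. replicate (k n div N n - count_list xs (y n i)) (y n i)) [1..<N n])
     @ replicate (k n div N n) (y n (N n))"

text \<open>The multiplicities in the middle part are forced by the uniform count
  \<open>k n div N n\<close>: the reserved word does not interfere, and the initial part leaves a
  known deficit.\<close>

lemma words_of_admissible:
  assumes w: "w \<in> W (Suc n)"
  obtains ws where "w = concat ws" "length ws = k n" "set ws \<subseteq> W n" "take (kp n) ws \<in> adm n"
    "ws = complete n (take (kp n) ws)" "\<forall>i\<in>{1..N n}. count_list ws (y n i) = k n div N n"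
proof -
  let ?q = "k n div N n"
  from w obtain ws m where ws: "w = concat ws" "length ws = k n" "set ws \<subseteq> W n"
    "\<forall>i\<in>{1..<N n}. count_list (take (kp n) ws) (y n i) \<le> ?q"
    "y n (N n) \<notin> set (take (kp n) ws)"
    "drop (k n - ?q) ws = replicate ?q (y n (N n))"
    "drop (kp n) (take (k n - ?q) ws) = concat (map (\<lambda>i. replicate (m i) (y n i)) [1..<N n])"
    "\<forall>i\<in>{1..N n}. count_list ws (y n i) = ?q"
    unfolding W_Suc next_words_def kp_def[symmetric] by blast
  let ?t = "take (kp n) ws"
  have t: "?t \<in> adm n"
    using ws(2-5) kp_less[of n] set_take_subset[of "kp n" ws] by (auto simp: adm_def V_def)
  have "take (k n - ?q) ws = ?t @ drop (kp n) (take (k n - ?q) ws)"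
    using kp_le[of n] by (metis add_le_imp_le_diff append_take_drop_id min.absorb1 take_take)
  then have split: "ws = ?t @ concat (map (\<lambda>i. replicate (m i) (y n i)) [1..<N n]) @ replicate ?q (y n (N n))"
    by (metis append.assoc append_take_drop_id ws(6,7))
  have m: "m i = ?q - count_list ?t (y n i)" if i: "i \<in> {1..<N n}" for i
  proof -
    have "count_list ws (y n i) = count_list ?t (y n i) + m i + 0"
    proof (subst split, unfold count_list_append add.assoc, intro arg_cong2[where f = "(+)"] refl)
      show "count_list (concat (map (\<lambda>i. replicate (m i) (y n i)) [1..<N n])) (y n i) = m i"
        using i by (intro count_list_concat_replicate inj_on_subset[OF y_inj[of n]]) auto
      have "y n (N n) \<noteq> y n i" using y_last_ne[OF i] .
      then show "count_list (replicate ?q (y n (N n))) (y n i) = 0" by (simp add: count_list_replicate)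
    qed
    then show ?thesis using ws(8) i by auto
  qed
  have "concat (map (\<lambda>i. replicate (m i) (y n i)) [1..<N n])
      = concat (map (\<lambda>i. replicate (?q - count_list ?t (y n i)) (y n i)) [1..<N n])"
    by (intro arg_cong[where f = concat] map_cong refl) (simp add: m)
  then have "ws = complete n ?t" unfolding complete_def using split by simp
  then show thesis using that ws t by blast
qed

lemma sum_count_adm:
  assumes "xs \<in> adm n"
  shows "(\<Sum>i\<in>{1..<N n}. count_list xs (y n i)) = kp n"
proof -
  have inj: "inj_on (y n) {1..<N n}" by (rule inj_on_subset[OF y_inj]) auto
  have "(\<Sum>i\<in>{1..<N n}. count_list xs (y n i)) = sum (count_list xs) (V n)"
    unfolding V_eq sum.reindex[OF inj] o_def ..
  also have "\<dots> = length xs" using assms finite_V by (intro sum_count_set) (auto simp: adm_def)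
  finally show ?thesis using assms by (simp add: adm_def)
qed

lemma complete_in_W:
  assumes xs: "xs \<in> adm n"
  shows "concat (complete n xs) \<in> W (Suc n)" "length (complete n xs) = k n" "set (complete n xs) \<subseteq> W n"
proof -
  let ?q = "k n div N n"
  let ?M = "concat (map (\<lambda>i. replicate (?q - count_list xs (y n i)) (y n i)) [1..<N n])"
  have lx: "length xs = kp n" and sx: "set xs \<subseteq> V n" and cx: "\<And>i. i \<in> {1..<N n} \<Longrightarrow> count_list xs (y n i) \<le> ?q"
    using xs by (auto simp: adm_def)
  \<comment> \<open>Used and missing copies together give \<open>k n div N n\<close> for each of the
    N n - 1 words, so the middle part ends exactly where the reserved word begins.\<close>
  have "length ?M + kp n = (\<Sum>i\<in>{1..<N n}. ?q - count_list xs (y n i)) + (\<Sum>i\<in>{1..<N n}. count_list xs (y n i))"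
    unfolding length_concat_replicate sum_count_adm[OF xs] by (simp add: interv_sum_list_conv_sum_set_nat)
  also have "\<dots> = (\<Sum>i\<in>{1..<N n}. ?q)" unfolding sum.distrib[symmetric]
    using cx by (intro sum.cong) auto
  also have "\<dots> = ?q * (N n - 1)" by simp
  also have "\<dots> = k n - ?q" using k_div_N(2)[of n] by (simp add: right_diff_distrib')
  finally have lM: "kp n + length ?M = k n - ?q" by simp
  have qk: "?q \<le> k n" by simp
  show len: "length (complete n xs) = k n"
  proof -
    have "length (complete n xs) = kp n + length ?M + ?q" by (simp add: complete_def lx)
    then show ?thesis using lM qk by linarith
  qed
  have yW: "y n i \<in> W n" if "i \<in> {1..<N n}" for i using that y_in by auto
  have yN: "y n (N n) \<in> W n" using y_in[of "N n" n] N_gt[of n] by simp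
  show setw: "set (complete n xs) \<subseteq> W n"
    using sx yW yN by (auto simp: complete_def V_def)
  have yNne: "y n (N n) \<noteq> y n i" if "i \<in> {1..<N n}" for i
    using y_last_ne[OF that] .
  have cM: "count_list ?M (y n i) = ?q - count_list xs (y n i)" if "i \<in> {1..<N n}" for i
    using that by (intro count_list_concat_replicate inj_on_subset[OF y_inj[of n]]) auto
  have "\<forall>i\<in>{1..N n}. count_list (complete n xs) (y n i) = ?q"
  proof
    fix i assume i: "i \<in> {1..N n}"
    show "count_list (complete n xs) (y n i) = ?q"
    proof (cases "i = N n")
      case True
      have "count_list xs (y n (N n)) = 0" using sx by (auto simp: count_list_0_iff V_def)
      moreover have "count_list ?M (y n (N n)) = 0"
      proof (rule count_list_concat_replicate_notin)
        show "y n (N n) \<notin> y n ` set [1..<N n]" using yNne by (metis atLeastLessThan_upt imageE)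
      qed
      ultimately show ?thesis using True by (simp add: complete_def count_list_replicate)
    next
      case False
      then have "i \<in> {1..<N n}" using i by auto
      then show ?thesis using cM[of i] cx[of i] yNne[of i] by (simp add: complete_def count_list_replicate)
    qed
  qed
  moreover have "take (kp n) (complete n xs) = xs" using lx by (simp add: complete_def)
  moreover have "drop (k n - ?q) (complete n xs) = replicate ?q (y n (N n))"
    using lM lx by (simp add: complete_def del: One_nat_def)
  moreover have "drop (kp n) (take (k n - ?q) (complete n xs)) = ?M"
    using lM lx by (simp add: complete_def del: One_nat_def)
  moreover have "y n (N n) \<notin> set xs" using sx by (auto simp: V_def)
  ultimately show "concat (complete n xs) \<in> W (Suc n)"
    unfolding W_Suc next_words_def kp_def[symmetric] using len setw cx by auto
qed

lemma concat_inj: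
  assumes "\<forall>w\<in>set ws. length w = H" "\<forall>w\<in>set us. length w = H" "length ws = length us" "concat ws = concat us"
  shows "ws = us"
proof (rule nth_equalityI)
  fix j assume j: "j < length ws"
  show "ws ! j = us ! j"
    using take_drop_concat_uniform[of ws H j 0 H] take_drop_concat_uniform[of us H j 0 H] assms j by simp
qed (rule assms(3))

lemma adm_complete_inj: "inj_on (\<lambda>xs. concat (complete n xs)) (adm n)"
proof (rule inj_onI)
  fix xs zs assume xs: "xs \<in> adm n" and zs: "zs \<in> adm n" and eq: "concat (complete n xs) = concat (complete n zs)"
  have "complete n xs = complete n zs"
    using complete_in_W(2,3)[OF xs] complete_in_W(2,3)[OF zs] W_length eq
    by (intro concat_inj[of _ "h n"]) auto
  then have "take (kp n) (complete n xs) = take (kp n) (complete n zs)" by simp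
  then show "xs = zs" using xs zs by (simp add: complete_def adm_def)
qed

lemma finite_adm: "finite (adm n)"
  by (rule finite_subset[OF _ finite_lists_length_eq[OF finite_V[of n], of "kp n"]]) (auto simp: adm_def)

text \<open>By definition \<tau> n is the proportion of sequences over V, of length
  \<open>kp n\<close>, that violate the frequency bound. The others are admissible, and different
  ones have different completions.\<close>

lemma card_W_Suc_ge: "real (N (Suc n)) \<ge> (1 - \<tau> n) * real (card (V n)) ^ kp n"
proof -
  \<comment> \<open>The support of \<open>Pi_pmf\<close>: functions that take the default value 0
    outside the index set.\<close>
  let ?\<Omega> = "PiE_dflt {..<kp n} 0 (\<lambda>_. {1..<N n})"
  let ?bad = "{c. \<exists>s\<in>{1..<N n}. real (card {j. j < kp n \<and> c j = s}) > real (k n) / real (N n)}"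
  have ne: "{1..<N n} \<noteq> {}" using N_gt[of n] by auto
  have fin: "finite ?\<Omega>" by (intro finite_PiE_dflt) auto
  have card\<Omega>: "card ?\<Omega> = card (V n) ^ kp n"
    using card_V[of n] by (subst card_PiE_dflt) auto
  have ne\<Omega>: "?\<Omega> \<noteq> {}" using card\<Omega> card_V_pos[of n] by (metis card.empty less_numeral_extra(3) zero_less_power)
  have "\<tau> n = real (card (?\<Omega> \<inter> ?bad)) / real (card ?\<Omega>)"
    unfolding \<tau>_def overflow_prob_def using ne fin ne\<Omega>
    by (subst Pi_pmf_of_set) (auto simp: measure_pmf_of_set)
  then have "(1 - \<tau> n) * real (card ?\<Omega>) = real (card ?\<Omega>) - real (card (?\<Omega> \<inter> ?bad))"
    using fin ne\<Omega> by (simp add: field_simps card_gt_0_iff)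
  also have "\<dots> = real (card (?\<Omega> - ?bad))"
    using fin card_mono[OF fin, of "?\<Omega> \<inter> ?bad"] by (subst card_Diff_subset_Int) (auto simp: of_nat_diff)
  finally have eq: "(1 - \<tau> n) * real (card ?\<Omega>) = real (card (?\<Omega> - ?bad))" .
  have le1: "card (?\<Omega> - ?bad) \<le> card (adm n)"
  proof (rule card_inj_on_le[of "\<lambda>c. map (\<lambda>j. y n (c j)) [0..<kp n]"])
    show "inj_on (\<lambda>c. map (\<lambda>j. y n (c j)) [0..<kp n]) (?\<Omega> - ?bad)"
    proof (rule inj_onI)
      fix c d assume c: "c \<in> ?\<Omega> - ?bad" and d: "d \<in> ?\<Omega> - ?bad"
        and eq: "map (\<lambda>j. y n (c j)) [0..<kp n] = map (\<lambda>j. y n (d j)) [0..<kp n]"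
      show "c = d"
      proof
        fix j
        show "c j = d j"
        proof (cases "j < kp n")
          case True
          then have "y n (c j) = y n (d j)" using arg_cong[OF eq, of "\<lambda>xs. xs ! j"] by simp
          moreover have "c j \<in> {1..<N n}" "d j \<in> {1..<N n}" using c d True by (auto simp: PiE_dflt_def)
          ultimately show ?thesis using inj_onD[OF y_inj, of n "c j" "d j"] by auto
        next
          case False
          then show ?thesis using c d by (auto simp: PiE_dflt_def)
        qed
      qed
    qed
    show "(\<lambda>c. map (\<lambda>j. y n (c j)) [0..<kp n]) ` (?\<Omega> - ?bad) \<subseteq> adm n"
    proof (rule image_subsetI)
      fix c assume "c \<in> ?\<Omega> - ?bad"
      then have c: "c \<in> ?\<Omega>" "c \<notin> ?bad" by blast+
      have cr: "c j \<in> {1..<N n}" if "j < kp n" for j using c that by (auto simp: PiE_dflt_def)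
      have "count_list (map (\<lambda>j. y n (c j)) [0..<kp n]) (y n i) \<le> k n div N n" if i: "i \<in> {1..<N n}" for i
      proof -
        have eq: "y n i = y n (c j) \<longleftrightarrow> c j = i" if "j < kp n" for j
          using inj_onD[OF y_inj, of n i "c j"] cr[OF that] i by auto
        have "count_list (map (\<lambda>j. y n (c j)) [0..<kp n]) (y n i) = card {j. j < kp n \<and> c j = i}"
          unfolding count_list_eq_length_filter length_filter_conv_card
          by (intro arg_cong[where f = card] Collect_cong) (simp add: eq cong: conj_cong)
        moreover have "real (card {j. j < kp n \<and> c j = i}) \<le> real (k n div N n)"
          using c(2) i by (auto simp: k_div_N(1) not_less)
        ultimately show ?thesis by simp
      qed
      moreover have "y n (c j) \<in> V n" if "j < kp n" for j using cr[OF that] by (auto simp: V_eq)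
      ultimately show "map (\<lambda>j. y n (c j)) [0..<kp n] \<in> adm n" by (auto simp: adm_def)
    qed
  qed (rule finite_adm)
  have "(\<lambda>xs. concat (complete n xs)) ` adm n \<subseteq> W (Suc n)"
    using complete_in_W(1) by (rule image_subsetI)
  then have le2: "card (adm n) \<le> N (Suc n)"
    by (rule card_inj_on_le[OF adm_complete_inj _ finite_W])
  have "real (card (?\<Omega> - ?bad)) \<le> real (N (Suc n))"
    using order_trans[OF le1 le2] by (simp only: of_nat_le_iff)
  then show ?thesis using eq unfolding card\<Omega> of_nat_power by (simp only:)
qed

lemma tau_range: "0 \<le> \<tau> n" "\<tau> n \<le> 1"
  by (auto simp: \<tau>_def overflow_prob_def)

text \<open>A number in the unit interval does not decrease when raised to a power with exponent at
  most 1; the index shift of the hypothesis is then undone.\<close>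

lemma summable_tau: "summable \<tau>"
proof -
  have "summable (\<lambda>n. \<tau> (Suc n) powr (1 / 2 ^ Suc n))"
    using summable_overflow by (simp add: \<tau>_def kp_def)
  then have "summable (\<lambda>n. \<tau> (Suc n))"
  proof (rule summable_comparison_test')
    fix n :: nat
    have "\<tau> (Suc n) \<le> \<tau> (Suc n) powr (1 / 2 ^ Suc n)"
    proof (cases "\<tau> (Suc n) = 0")
      case False
      have "(1::real) \<le> 2 ^ Suc n" by (rule one_le_power) simp
      then have "1 / 2 ^ Suc n \<le> (1::real)" by (simp add: field_simps)
      then have "\<tau> (Suc n) powr 1 \<le> \<tau> (Suc n) powr (1 / 2 ^ Suc n)"
        using tau_range[of "Suc n"] False by (intro powr_mono') auto
      then show ?thesis using tau_range[of "Suc n"] False by simp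
    qed simp
    then show "norm (\<tau> (Suc n)) \<le> \<tau> (Suc n) powr (1 / 2 ^ Suc n)" using tau_range[of "Suc n"] by simp
  qed
  then show ?thesis by (simp add: summable_Suc_iff)
qed

section \<open>Free blocks in words of higher levels\<close>

text \<open>A free start is the position, in an \<open>(n + d)\<close>-block, of an \<open>n\<close>-block that lies in the
  unconstrained initial part of its block at every intermediate level.\<close>

primrec free_starts :: "nat \<Rightarrow> nat \<Rightarrow> nat set" where
  "free_starts n 0 = {0}"
| "free_starts n (Suc d) = (\<lambda>(j, b). j * h (n + d) + b) ` ({..<kp (n + d)} \<times> free_starts n d)"

lemma free_starts_bound: "b \<in> free_starts n d \<Longrightarrow> h n dvd b \<and> b + h n \<le> h (n + d)"
proof (induction d arbitrary: b)
  case (Suc d)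
  then obtain j c where b: "b = j * h (n + d) + c" "j < kp (n + d)" "c \<in> free_starts n d" by auto
  have c: "h n dvd c" "c + h n \<le> h (n + d)" using Suc.IH[OF b(3)] by auto
  have "Suc j * h (n + d) \<le> k (n + d) * h (n + d)"
    using b(2) kp_less[of "n + d"] by (intro mult_right_mono) auto
  then show ?case using b(1) c h_dvd[of n "n + d"] by (auto simp: h_Suc)
qed simp

lemma free_starts_less: "b \<in> free_starts n d \<Longrightarrow> b < h (n + d)"
  using free_starts_bound[of b n d] h_pos[of n] by linarith

lemma finite_free_starts: "finite (free_starts n d)"
  by (induction d) auto

text \<open>The level n + l contributes exactly a factor \<open>1 - \<epsilon> (n + l)\<close> to
  the density; the product is bounded below by one minus the sum.\<close>

lemma card_free_starts: "real (card (free_starts n d)) \<ge> real (h (n + d)) / real (h n) * (1 - (\<Sum>l<d. \<epsilon> (n + l)))"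
proof -
  have eq: "real (card (free_starts n d)) = real (h (n + d)) / real (h n) * (\<Prod>l<d. 1 - \<epsilon> (n + l))"
  proof (induction d)
    case 0
    then show ?case using h_pos[of n] by simp
  next
    case (Suc d)
    have "inj_on (\<lambda>(j, b). j * h (n + d) + b) ({..<kp (n + d)} \<times> free_starts n d)"
    proof (rule inj_onI, clarify)
      fix j b j' b'
      assume *: "b \<in> free_starts n d" "b' \<in> free_starts n d" "j * h (n + d) + b = j' * h (n + d) + b'"
      have "(j * h (n + d) + b) div h (n + d) = j" "(j' * h (n + d) + b') div h (n + d) = j'"
        using free_starts_less[OF *(1)] free_starts_less[OF *(2)] by simp_all
      then show "j = j' \<and> b = b'" using *(3) by simp
    qed
    then have "card (free_starts n (Suc d)) = kp (n + d) * card (free_starts n d)"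
      by (simp add: card_image card_cartesian_product)
    then show ?case using Suc by (simp add: kp_real h_Suc)
  qed
  have "(\<Prod>l<d. 1 - \<epsilon> (n + l)) \<ge> 1 - (\<Sum>l<d. \<epsilon> (n + l))"
  proof (induction d)
    case (Suc d)
    have "0 \<le> 1 - \<epsilon> l \<and> 1 - \<epsilon> l \<le> 1" for l using eps_small[of l] eps_pos[of l] by linarith
    then have "(\<Prod>l<d. 1 - \<epsilon> (n + l)) \<le> 1" by (intro prod_le_1) blast
    then have "\<epsilon> (n + d) * (\<Prod>l<d. 1 - \<epsilon> (n + l)) \<le> \<epsilon> (n + d) * 1"
      using eps_pos[of "n + d"] by (intro mult_left_mono) auto
    then show ?case using Suc by (simp add: algebra_simps)
  qed simp
  then show ?thesis unfolding eq by (intro mult_left_mono) auto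
qed

lemma sum_eps_le: "(\<Sum>l<d. \<epsilon> (n + l)) \<le> 1 / 2 ^ n"
proof -
  have "(\<Sum>l<d. \<epsilon> (n + l)) \<le> (\<Sum>l<d. 1 / 2 ^ n * (1 / 2) ^ Suc l)"
  proof (intro sum_mono)
    fix l
    have "\<epsilon> (n + l) \<le> 1 / 2 ^ (n + l + 12)" using eps_less[of "n + l"] by simp
    also have "\<dots> \<le> 1 / 2 ^ (n + Suc l)" by (intro divide_left_mono power_increasing) auto
    finally show "\<epsilon> (n + l) \<le> 1 / 2 ^ n * (1 / 2) ^ Suc l" by (simp add: power_add field_simps)
  qed
  also have "\<dots> = 1 / 2 ^ n * (\<Sum>l<d. (1 / 2) ^ Suc l)" by (simp add: sum_distrib_left)
  also have "(\<Sum>l<d. (1 / 2 :: real) ^ Suc l) = 1 - (1 / 2) ^ d" by (induction d) (auto simp: field_simps)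
  also have "1 / 2 ^ n * (1 - (1 / 2) ^ d) \<le> 1 / 2 ^ n * (1 :: real)" by (intro mult_left_mono) auto
  finally show ?thesis by simp
qed

definition block :: "nat \<Rightarrow> 'a list \<Rightarrow> nat \<Rightarrow> 'a list" where
  "block n w b = take (h n) (drop b w)"

lemma block_concat:
  assumes "set ws \<subseteq> W (n + d)" "j < length ws" "b + h n \<le> h (n + d)"
  shows "block n (concat ws) (j * h (n + d) + b) = block n (ws ! j) b"
  unfolding block_def by (rule take_drop_concat_uniform) (use assms W_length in auto)

text \<open>The higher levels only locate an (n + 1)-block. In that block the free start points into
  the admissible initial part, which avoids the reserved word.\<close>

lemma free_block_in_V:
  assumes "w \<in> W (n + Suc d)" "b \<in> free_starts n (Suc d)"
  shows "block n w b \<in> V n"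
  using assms
proof (induction d arbitrary: w b)
  case 0
  obtain ws where ws: "w = concat ws" "length ws = k n" "set ws \<subseteq> W n" "take (kp n) ws \<in> adm n"
    using words_of_admissible 0 by (metis add.right_neutral add_Suc_right)
  have "b \<in> (\<lambda>j. j * h n) ` {..<kp n}" using 0(2) by (auto simp: image_iff)
  then obtain j where j: "b = j * h n" "j < kp n" by (elim imageE) (rule that, auto)
  have "block n w b = block n (ws ! j) 0"
    using block_concat[of ws n 0 j 0] ws j kp_less[of n] by simp
  also have "\<dots> = ws ! j"
  proof -
    have "ws ! j \<in> W n" using ws(2,3) j(2) kp_less[of n] by auto
    then show ?thesis by (simp add: block_def W_length)
  qed
  also have "\<dots> = take (kp n) ws ! j" using j by simp
  also have "\<dots> \<in> V n" using adm_nth[OF ws(4) j(2)] .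
  finally show ?case .
next
  case (Suc d)
  obtain ws where ws: "w = concat ws" "length ws = k (n + Suc d)" "set ws \<subseteq> W (n + Suc d)"
    using words_of_admissible Suc.prems(1) by (metis add_Suc_right)
  obtain j c where b: "b = j * h (n + Suc d) + c" "j < kp (n + Suc d)" "c \<in> free_starts n (Suc d)"
    using Suc.prems(2) by (auto simp del: free_starts.simps simp: free_starts.simps(2)[of n "Suc d"])
  have j: "j < length ws" using b(2) kp_less[of "n + Suc d"] ws(2) by simp
  have "block n w b = block n (ws ! j) c"
    unfolding ws(1) b(1) using ws(3) j free_starts_bound[OF b(3)] by (intro block_concat) auto
  moreover have "ws ! j \<in> W (n + Suc d)" using ws(3) j by auto
  ultimately show ?case using Suc.IH b(3) by simp
qed

section \<open>Counting the words with prescribed free blocks\<close>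

definition hits :: "nat \<Rightarrow> nat \<Rightarrow> nat set \<Rightarrow> nat" where
  "hits n l D = card ((\<lambda>b. b div h (n + l)) ` D)"

definition t_cost :: "nat \<Rightarrow> real" where "t_cost n = - ln (1 - \<tau> n)"

definition e_cost :: "nat \<Rightarrow> real" where "e_cost n = ln (real (N n) / real (card (V n)))"

text \<open>Since \<open>b div h (n + l)\<close> is the index of the (n + l)-block containing b,
  \<open>hits\<close> counts the blocks of that level that meet D. Each block of level n + l + 1
  that meets D pays \<open>t_cost (n + l)\<close> for the admissibility of its initial part, and
  each block of level n + l pays \<open>e_cost (n + l)\<close> for the reserved word.\<close>

definition cost :: "nat \<Rightarrow> nat \<Rightarrow> nat set \<Rightarrow> real" where
  "cost n d D = (\<Sum>l<d. real (hits n (Suc l) D) * t_cost (n + l) + real (hits n l D) * e_cost (n + l))"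

lemma e_cost_nonneg: "e_cost n \<ge> 0"
  using card_V[of n] card_V_pos[of n] by (simp add: e_cost_def)

text \<open>D is cut along q consecutive blocks of length \<open>h (n + d)\<close>. As
  \<open>h (n + l)\<close> divides this length, no smaller block meets two of the parts, so the
  counts add up.\<close>

lemma hits_split:
  assumes D: "D \<subseteq> {..<q * h (n + d)}" and l: "l \<le> d"
  shows "(\<Sum>j<q. hits n l {b. b < h (n + d) \<and> j * h (n + d) + b \<in> D}) = hits n l D"
proof -
  let ?H = "h (n + d)" and ?g = "h (n + l)"
  let ?D = "\<lambda>j. {b. b < ?H \<and> j * ?H + b \<in> D}"
  obtain r where r: "?H = r * ?g" using h_dvd[of "n + l" "n + d"] l by (auto simp: dvd_def mult.commute)
  have g: "?g > 0" by (rule h_pos)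
  let ?A = "\<lambda>j. (\<lambda>c. j * r + c) ` (\<lambda>b. b div ?g) ` ?D j"
  have sub: "c < r" if "c \<in> (\<lambda>b. b div ?g) ` ?D j" for c j
    using that r g by (auto simp: less_mult_imp_div_less)
  have "(\<lambda>b. b div ?g) ` D = (\<Union>j<q. ?A j)"
  proof (intro equalityI subsetI)
    fix c assume "c \<in> (\<lambda>b. b div ?g) ` D"
    then obtain b where b: "b \<in> D" "c = b div ?g" by auto
    have bq: "b div ?H < q" using b(1) D by (auto simp: less_mult_imp_div_less)
    have bb: "b = b div ?H * ?H + b mod ?H" by (simp add: div_mult_mod_eq)
    have "b div ?g = (b div ?H) * r + (b mod ?H) div ?g"
    proof -
      have "b div ?g = ((b mod ?H) + (b div ?H * r) * ?g) div ?g"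
        using bb r by (metis add.commute mult.assoc)
      then show ?thesis using g by simp
    qed
    moreover have "b mod ?H \<in> ?D (b div ?H)" using b(1) h_pos[of "n + d"] by (simp add: div_mult_mod_eq)
    ultimately have "c \<in> ?A (b div ?H)" using b(2) by blast
    then show "c \<in> (\<Union>j<q. ?A j)" using bq by blast
  next
    fix c assume "c \<in> (\<Union>j<q. ?A j)"
    then obtain j b where jb: "j < q" "b \<in> ?D j" "c = j * r + b div ?g" by auto
    have "c = (j * ?H + b) div ?g"
      using jb(3) g r by (simp add: mult.assoc[symmetric])
    then show "c \<in> (\<lambda>b. b div ?g) ` D" using jb(2) by blast
  qed
  then have "hits n l D = card (\<Union>j<q. ?A j)" by (simp add: hits_def)
  also have "\<dots> = (\<Sum>j<q. card (?A j))"
  proof (intro card_UN_disjoint ballI impI)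
    fix i j :: nat assume "i \<noteq> j"
    show "?A i \<inter> ?A j = {}"
    proof (rule ccontr)
      assume "?A i \<inter> ?A j \<noteq> {}"
      then obtain c c' where c: "c \<in> (\<lambda>b. b div ?g) ` ?D i" "c' \<in> (\<lambda>b. b div ?g) ` ?D j" "i * r + c = j * r + c'"
        by blast
      have "(i * r + c) div r = i" "(j * r + c') div r = j" using sub[OF c(1)] sub[OF c(2)] by simp_all
      then show False using c(3) \<open>i \<noteq> j\<close> by simp
    qed
  qed auto
  also have "\<dots> = (\<Sum>j<q. hits n l (?D j))"
    unfolding hits_def by (intro sum.cong refl card_image) (auto simp: inj_on_def)
  finally show ?thesis by simp
qed

lemma card_lists_prod:
  assumes "\<And>j. j < q \<Longrightarrow> finite (X j)"
  shows "card {xs. length xs = q \<and> (\<forall>j<q. xs ! j \<in> X j)} = (\<Prod>j<q. card (X j))"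
proof -
  have "bij_betw (\<lambda>xs. restrict ((!) xs) {..<q}) {xs. length xs = q \<and> (\<forall>j<q. xs ! j \<in> X j)} (PiE {..<q} X)"
  proof (rule bij_betw_byWitness[where f' = "\<lambda>f. map f [0..<q]"])
    show "\<forall>f\<in>PiE {..<q} X. restrict ((!) (map f [0..<q])) {..<q} = f"
      by (intro ballI ext) (simp add: PiE_def extensional_def restrict_def)
    show "\<forall>xs\<in>{xs. length xs = q \<and> (\<forall>j<q. xs ! j \<in> X j)}. map (restrict ((!) xs) {..<q}) [0..<q] = xs"
      by (intro ballI nth_equalityI) simp_all
    show "(\<lambda>xs. restrict ((!) xs) {..<q}) ` {xs. length xs = q \<and> (\<forall>j<q. xs ! j \<in> X j)} \<subseteq> PiE {..<q} X"
      by (intro image_subsetI PiE_I) simp_all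
    show "(\<lambda>f. map f [0..<q]) ` PiE {..<q} X \<subseteq> {xs. length xs = q \<and> (\<forall>j<q. xs ! j \<in> X j)}"
      by (intro image_subsetI) (simp add: PiE_mem)
  qed
  then show ?thesis using assms by (simp add: bij_betw_same_card card_PiE)
qed

text \<open>For a uniformly chosen word, the probability that the free blocks in D have prescribed
  contents is at most \<open>card (V n)\<close> to the power \<open>- card D\<close>, times
  \<open>exp (cost n d D)\<close>. In the induction a word is replaced by its initial part and the
  frequency condition is dropped, so that the count becomes a product over sub-blocks. Dropping the
  condition is paid once per large block, and only sub-blocks that meet D pay for the passage from V
  to W.\<close>

theorem free_block_density:
  assumes \<tau>1: "\<And>l. n \<le> l \<Longrightarrow> \<tau> l < 1" and D: "D \<subseteq> free_starts n d"
  shows "real (card {w \<in> W (n + d). \<forall>b\<in>D. block n w b = c b}) * real (card (V n)) ^ card D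
    \<le> real (N (n + d)) * exp (cost n d D)"
  using D
proof (induction d arbitrary: D c)
  case 0
  then consider "D = {}" | "D = {0}" by auto
  then show ?case
  proof cases
    case 1
    then show ?thesis by (simp add: cost_def)
  next
    case 2
    have "{w \<in> W (n + 0). \<forall>b\<in>D. block n w b = c b} \<subseteq> {c 0}" using 2 W_length by (auto simp: block_def)
    then have "card {w \<in> W (n + 0). \<forall>b\<in>D. block n w b = c b} \<le> 1"
      using card_mono[of "{c 0}"] by fastforce
    then have "real (card {w \<in> W (n + 0). \<forall>b\<in>D. block n w b = c b}) * real (card (V n)) \<le> 1 * real (card (V n))"
      by (intro mult_right_mono) auto
    also have "\<dots> \<le> real (N n)" using card_V[of n] by simp
    finally show ?thesis using 2 by (simp add: cost_def)
  qed
next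
  case (Suc d)
  let ?m = "n + d"
  let ?H = "h ?m" and ?q = "kp ?m"
  let ?N' = "real (card (V n))"
  let ?VV = "real (card (V ?m))"
  define E where "E j = {b. b < ?H \<and> j * ?H + b \<in> D}" for j
  define X where "X j = {w \<in> V ?m. \<forall>b\<in>E j. block n w b = c (j * ?H + b)}" for j
  have N': "?N' > 0" "?VV > 0" using card_V_pos by simp_all
  show ?case
  proof (cases "D = {}")
    case True
    then show ?thesis by (simp add: cost_def hits_def)
  next
    case False
    have E: "E j \<subseteq> free_starts n d" for j
    proof
      fix b assume "b \<in> E j"
      then have b: "b < ?H" "j * ?H + b \<in> free_starts n (Suc d)" using Suc.prems by (auto simp: E_def)
      then obtain j' b' where *: "j * ?H + b = j' * ?H + b'" "b' \<in> free_starts n d" by auto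
      have "(j * ?H + b) mod ?H = b" "(j' * ?H + b') mod ?H = b'"
        using b(1) free_starts_less[OF *(2)] by simp_all
      then show "b \<in> free_starts n d" using * by simp
    qed
    have Dq: "D \<subseteq> {..<?q * ?H}"
    proof
      fix b assume "b \<in> D"
      then obtain j' b' where *: "b = j' * ?H + b'" "j' < ?q" "b' \<in> free_starts n d" using Suc.prems by auto
      have "Suc j' * ?H \<le> ?q * ?H" using *(2) by (intro mult_right_mono) auto
      then show "b \<in> {..<?q * ?H}" using *(1) free_starts_less[OF *(3)] by simp
    qed
    have finE: "finite (E j)" for j by (simp add: E_def)
    have cardD: "card D = (\<Sum>j<?q. card (E j))"
    proof -
      have "D = (\<Union>j<?q. (\<lambda>b. j * ?H + b) ` E j)"
      proof (intro equalityI subsetI)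
        fix b assume b: "b \<in> D"
        then have "b div ?H < ?q" using Dq by (auto simp: less_mult_imp_div_less)
        moreover have "b mod ?H \<in> E (b div ?H)" using b h_pos[of ?m] by (simp add: E_def div_mult_mod_eq)
        ultimately show "b \<in> (\<Union>j<?q. (\<lambda>b. j * ?H + b) ` E j)"
          by (intro UN_I[of "b div ?H"] image_eqI[of _ _ "b mod ?H"]) (auto simp: div_mult_mod_eq)
      qed (auto simp: E_def)
      also have "card \<dots> = (\<Sum>j<?q. card ((\<lambda>b. j * ?H + b) ` E j))"
      proof (intro card_UN_disjoint ballI impI)
        fix i j :: nat assume "i \<noteq> j"
        show "(\<lambda>b. i * ?H + b) ` E i \<inter> (\<lambda>b. j * ?H + b) ` E j = {}"
        proof (rule ccontr)
          assume "\<not> ?thesis"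
          then obtain b b' where b: "b < ?H" "b' < ?H" "i * ?H + b = j * ?H + b'" by (auto simp: E_def)
          have "(i * ?H + b) div ?H = i" "(j * ?H + b') div ?H = j" using b(1,2) by simp_all
          then show False using b(3) \<open>i \<noteq> j\<close> by simp
        qed
      qed (use finE in auto)
      also have "\<dots> = (\<Sum>j<?q. card (E j))"
        by (intro sum.cong refl card_image) (auto simp: inj_on_def)
      finally show ?thesis .
    qed
    \<comment> \<open>A sub-block disjoint from D is free to be any element of V and costs nothing;
      otherwise \<open>hits n d (E j)\<close> is 1 and a single \<open>e_cost\<close> is
      paid.\<close>
    have step: "real (card (X j)) * ?N' ^ card (E j) \<le> ?VV * exp (real (hits n d (E j)) * e_cost ?m + cost n d (E j))"
      if "j < ?q" for j
    proof (cases "E j = {}")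
      case True
      then have "X j = V ?m" by (auto simp: X_def)
      then show ?thesis using True by (simp add: hits_def cost_def)
    next
      case False
      have "(\<lambda>b. b div ?H) ` E j = {0}" using False by (auto simp: E_def image_iff)
      then have hit: "hits n d (E j) = 1" by (simp add: hits_def)
      have "card (X j) \<le> card {w \<in> W ?m. \<forall>b\<in>E j. block n w b = c (j * ?H + b)}"
        by (intro card_mono) (auto simp: X_def V_def finite_W)
      then have "real (card (X j)) * ?N' ^ card (E j)
          \<le> real (card {w \<in> W ?m. \<forall>b\<in>E j. block n w b = c (j * ?H + b)}) * ?N' ^ card (E j)"
        by (intro mult_right_mono) auto
      also have "\<dots> \<le> real (N ?m) * exp (cost n d (E j))" by (rule Suc.IH[OF E])
      also have "real (N ?m) = ?VV * exp (e_cost ?m)"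
        using N'(2) N_gt[of ?m] by (simp add: e_cost_def)
      finally show ?thesis using hit by (simp add: exp_add algebra_simps)
    qed
    \<comment> \<open>Forgetting admissibility enlarges the set of initial parts and makes the
      coordinates independent.\<close>
    have "card {w \<in> W (n + Suc d). \<forall>b\<in>D. block n w b = c b}
        \<le> card {xs. length xs = ?q \<and> (\<forall>j<?q. xs ! j \<in> X j)}"
    proof (rule surj_card_le[of _ _ "\<lambda>xs. concat (complete ?m xs)"])
      show "finite {xs. length xs = ?q \<and> (\<forall>j<?q. xs ! j \<in> X j)}"
        by (rule finite_subset[OF _ finite_lists_length_eq[OF finite_V[of ?m], of ?q]])
          (auto simp: X_def set_conv_nth)
      show "{w \<in> W (n + Suc d). \<forall>b\<in>D. block n w b = c b} \<subseteq> (\<lambda>xs. concat (complete ?m xs)) ` {xs. length xs = ?q \<and> (\<forall>j<?q. xs ! j \<in> X j)}"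
      proof
        fix w assume w: "w \<in> {w \<in> W (n + Suc d). \<forall>b\<in>D. block n w b = c b}"
        then have "w \<in> W (Suc ?m)" by simp
        then obtain ws where ws: "w = concat ws" "length ws = k ?m" "set ws \<subseteq> W ?m" "take ?q ws \<in> adm ?m"
          "ws = complete ?m (take ?q ws)" by (rule words_of_admissible) blast
        have "take ?q ws ! j \<in> X j" if j: "j < ?q" for j
        proof -
          have jk: "j < length ws" using j kp_less[of ?m] ws(2) by simp
          have "block n (ws ! j) b = c (j * ?H + b)" if b: "b \<in> E j" for b
          proof -
            have "b + h n \<le> ?H" using b E free_starts_bound by blast
            then have "block n (ws ! j) b = block n w (j * ?H + b)"
              unfolding ws(1) using ws(3) jk by (intro block_concat[symmetric]) auto
            also have "\<dots> = c (j * ?H + b)" using w b by (auto simp: E_def)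
            finally show ?thesis .
          qed
          moreover have "take ?q ws ! j \<in> V ?m" using adm_nth[OF ws(4) j] .
          ultimately show ?thesis using j by (simp add: X_def)
        qed
        then show "w \<in> (\<lambda>xs. concat (complete ?m xs)) ` {xs. length xs = ?q \<and> (\<forall>j<?q. xs ! j \<in> X j)}"
          using ws by (intro image_eqI[of _ _ "take ?q ws"]) (auto simp: adm_def)
      qed
    qed
    also have "\<dots> = (\<Prod>j<?q. card (X j))"
      by (intro card_lists_prod) (simp add: X_def finite_V)
    finally have "real (card {w \<in> W (n + Suc d). \<forall>b\<in>D. block n w b = c b}) * ?N' ^ card D
        \<le> real (\<Prod>j<?q. card (X j)) * ?N' ^ card D"
      by (intro mult_right_mono) (simp_all only: of_nat_le_iff zero_le_power of_nat_0_le_iff)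
    also have "\<dots> = (\<Prod>j<?q. real (card (X j)) * ?N' ^ card (E j))"
      by (simp add: cardD power_sum prod.distrib)
    also have "\<dots> \<le> (\<Prod>j<?q. ?VV * exp (real (hits n d (E j)) * e_cost ?m + cost n d (E j)))"
      using step by (intro prod_mono) auto
    also have "\<dots> = ?VV ^ ?q * exp (\<Sum>j<?q. real (hits n d (E j)) * e_cost ?m + cost n d (E j))"
      by (simp add: prod.distrib exp_sum)
    \<comment> \<open>The lower bound for the number of words enters here: all sequences over V
      number at most \<open>exp (t_cost (n + d))\<close> times the words.\<close>
    also have "?VV ^ ?q \<le> real (N (Suc ?m)) * exp (t_cost ?m)"
    proof -
      have "1 - \<tau> ?m > 0" using \<tau>1[of ?m] by simp
      then show ?thesis using card_W_Suc_ge[of ?m] by (simp add: t_cost_def exp_minus field_simps)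
    qed
    also have "(\<Sum>j<?q. real (hits n d (E j)) * e_cost ?m + cost n d (E j)) = real (hits n d D) * e_cost ?m + cost n d D"
    proof -
      have hs: "(\<Sum>j<?q. real (hits n l (E j))) = real (hits n l D)" if "l \<le> d" for l
        using arg_cong[OF hits_split[OF Dq that], of real] unfolding E_def of_nat_sum .
      have "(\<Sum>j<?q. cost n d (E j)) = (\<Sum>l<d. \<Sum>j<?q. real (hits n (Suc l) (E j)) * t_cost (n + l) + real (hits n l (E j)) * e_cost (n + l))"
        unfolding cost_def by (rule sum.swap)
      also have "\<dots> = cost n d D"
        unfolding cost_def by (intro sum.cong refl) (simp add: sum.distrib sum_distrib_right[symmetric] hs)
      finally show ?thesis by (simp add: sum.distrib sum_distrib_right[symmetric] hs)
    qed
    finally have *: "real (card {w \<in> W (n + Suc d). \<forall>b\<in>D. block n w b = c b}) * ?N' ^ card D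
        \<le> real (N (Suc ?m)) * exp (t_cost ?m) * exp (real (hits n d D) * e_cost ?m + cost n d D)"
      by simp
    \<comment> \<open>D is nonempty and lies in one block of the top level, so that exactly one
      \<open>t_cost\<close> of this level is charged.\<close>
    have "(\<lambda>b. b div h (n + Suc d)) ` D = (\<lambda>b. 0) ` D"
    proof (intro image_cong refl)
      fix b assume "b \<in> D"
      then have "b < h (n + Suc d)" using Suc.prems free_starts_less[of b n "Suc d"] by blast
      then show "b div h (n + Suc d) = 0" by (rule div_less)
    qed
    then have "(\<lambda>b. b div h (n + Suc d)) ` D = {0}" using False by (simp add: image_constant_conv)
    then have "hits n (Suc d) D = 1" by (simp add: hits_def)
    then show ?thesis using * by (simp add: cost_def exp_add mult.assoc mult.commute mult.left_commute)
  qed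
qed

text \<open>An interval of length K meets at most \<open>K div g + 2\<close> cells of length g. The
  bound is weakened from level n + l to level n, so that it is uniform in l.\<close>

lemma hits_window:
  assumes "D \<subseteq> {i..<i + K}"
  shows "real (hits n l D) \<le> real K / real (h n) + 2"
proof -
  let ?g = "h (n + l)"
  have "(\<lambda>b. b div ?g) ` D \<subseteq> {i div ?g..(i + K) div ?g}"
  proof clarify
    fix b assume "b \<in> D"
    then have "i \<le> b" "b \<le> i + K" using assms by auto
    then show "b div ?g \<in> {i div ?g..(i + K) div ?g}" by (simp add: div_le_mono)
  qed
  then have "hits n l D \<le> card {i div ?g..(i + K) div ?g}"
    unfolding hits_def by (intro card_mono) auto
  also have "\<dots> \<le> K div ?g + 2"
  proof -
    have "i < ?g + i div ?g * ?g" "K < ?g + K div ?g * ?g"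
      using h_pos by (intro dividend_less_div_times; simp)+
    then have "i + K < (i div ?g + K div ?g + 2) * ?g" by (simp add: algebra_simps)
    then have "(i + K) div ?g < i div ?g + K div ?g + 2" by (rule less_mult_imp_div_less)
    then show ?thesis by simp
  qed
  finally have "real (hits n l D) \<le> real (K div ?g) + 2" by linarith
  also have "real (K div ?g) \<le> real K / real ?g" by (rule of_nat_div_le_of_nat)
  also have "\<dots> \<le> real K / real (h n)"
    using h_mono[of n "n + l"] h_pos[of n] by (intro divide_left_mono) auto
  finally show ?thesis by simp
qed

text \<open>Up to boundary effects this bounds the cost per n-block: \<open>2 * \<tau>\<close>
  dominates \<open>t_cost\<close> as soon as \<tau> is at most 1 / 2, and \<open>2 / N\<close>
  dominates \<open>e_cost\<close>.\<close>

definition total_cost :: "nat \<Rightarrow> real" where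
  "total_cost n = (\<Sum>l. 2 * \<tau> (n + l) + 2 / real (N (n + l)))"

lemma summable_cost: "summable (\<lambda>l. 2 * \<tau> l + 2 / real (N l))"
proof (intro summable_add summable_mult summable_tau)
  have "summable (\<lambda>l. 2 * (1 / 2 :: real) ^ l)" by (intro summable_mult summable_geometric) auto
  then show "summable (\<lambda>l. 2 / real (N l))"
  proof (rule summable_comparison_test')
    fix l :: nat
    have "(2::real) ^ l \<le> 2 ^ (l + 12)" by (intro power_increasing) auto
    then have "2 ^ l \<le> real (N l)" using N_large[of l] by linarith
    then have "2 / real (N l) \<le> 2 / 2 ^ l" using N_gt[of l] by (intro divide_left_mono) auto
    then show "norm (2 / real (N l)) \<le> 2 * (1 / 2) ^ l" by (simp add: power_one_over)
  qed
qed

lemma total_cost_tendsto: "total_cost \<longlonglongrightarrow> 0"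
proof -
  have "(\<lambda>n. \<Sum>l. (\<lambda>l. 2 * \<tau> l + 2 / real (N l)) (l + n)) \<longlonglongrightarrow> 0"
    using suminf_exist_split2[OF summable_cost] .
  then show ?thesis by (simp add: total_cost_def[abs_def] add.commute)
qed

lemma eventually_tau: "\<exists>n0. \<forall>l\<ge>n0. \<tau> l \<le> 1 / 2"
proof -
  have "\<forall>\<^sub>F l in sequentially. \<tau> l < 1 / 2"
    by (rule order_tendstoD(2)[OF summable_LIMSEQ_zero[OF summable_tau]]) simp
  then show ?thesis unfolding eventually_sequentially by (meson less_imp_le)
qed

text \<open>The hits at every level are bounded by the same factor, so the sum over the levels is a
  partial sum of the series in \<open>total_cost\<close>. The bound does not depend on d, which
  permits a limit over d.\<close>

lemma cost_window:
  assumes \<tau>2: "\<And>l. n \<le> l \<Longrightarrow> \<tau> l \<le> 1 / 2" and D: "D \<subseteq> {i..<i + K}"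
  shows "cost n d D \<le> (real K / real (h n) + 2) * total_cost n"
proof -
  have t: "0 \<le> t_cost l \<and> t_cost l \<le> 2 * \<tau> l" if "n \<le> l" for l
  proof -
    have "\<bar>ln (1 + (- \<tau> l)) - (- \<tau> l)\<bar> \<le> 2 * (- \<tau> l)\<^sup>2" 
      using tau_range[of l] \<tau>2[OF that] by (intro abs_ln_one_plus_x_minus_x_bound) auto
    moreover have "2 * (\<tau> l)\<^sup>2 \<le> \<tau> l"
      using tau_range[of l] \<tau>2[OF that] mult_left_mono[of "\<tau> l" "1 / 2" "\<tau> l"] by (simp add: power2_eq_square)
    ultimately show ?thesis using tau_range[of l] \<tau>2[OF that] by (simp add: t_cost_def)
  qed
  have e: "e_cost l \<le> 2 / real (N l)" for l
  proof -
    have "e_cost l \<le> real (N l) / real (card (V l)) - 1"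
      using card_V_pos[of l] N_gt[of l] by (simp only: e_cost_def) (intro ln_le_minus_one, simp)
    also have "\<dots> = 1 / (real (N l) - 1)" using card_V[of l] N_gt[of l] by (simp add: of_nat_diff field_simps)
    also have "\<dots> \<le> 2 / real (N l)" using N_gt[of l] by (simp add: field_simps)
    finally show ?thesis .
  qed
  have "cost n d D \<le> (\<Sum>l<d. (real K / real (h n) + 2) * (2 * \<tau> (n + l) + 2 / real (N (n + l))))"
    unfolding cost_def distrib_left
    using hits_window[OF D] t e e_cost_nonneg by (intro sum_mono add_mono mult_mono) auto
  also have "\<dots> = (real K / real (h n) + 2) * (\<Sum>l<d. 2 * \<tau> (n + l) + 2 / real (N (n + l)))"
    by (simp add: sum_distrib_left)
  also have "\<dots> \<le> (real K / real (h n) + 2) * total_cost n"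
    unfolding total_cost_def
    using tau_range summable_ignore_initial_segment[OF summable_cost, of n]
    by (intro mult_left_mono sum_le_suminf) (auto simp: add.commute)
  finally show ?thesis .
qed

lemma sublist_W:
  assumes "u \<in> W n" "w \<in> W (Suc n)"
  shows "sublist u w"
proof -
  obtain ws where ws: "w = concat ws" "\<forall>i\<in>{1..N n}. count_list ws (y n i) = k n div N n"
    using words_of_admissible[OF assms(2)] by metis
  obtain i where "i \<in> {1..N n}" "u = y n i" using assms(1) y_image[of n] by (metis imageE)
  then have "count_list ws u \<noteq> 0" using ws(2) k_div_N(3)[of n] by simp
  then have "u \<in> set ws" by (simp add: count_list_0_iff)
  then obtain as bs where "ws = as @ u # bs" by (meson split_list)
  then show ?thesis using ws(1) by (auto simp: sublist_def)
qed

end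

section \<open>Distributions of finitely valued functions\<close>

definition law :: "'b measure \<Rightarrow> ('b \<Rightarrow> 'c) \<Rightarrow> 'c pmf" where
  "law M f = Abs_pmf (distr M (count_space UNIV) f)"

context prob_space
begin

text \<open>A probability measure on a discrete space comes from a pmf if almost every point has
  positive mass. The values of f of mass zero are finitely many, hence together negligible.\<close>

lemma measure_law_eq:
  assumes f: "simple_function M f"
  shows "measure_pmf (law M f) = distr M (count_space UNIV) f"
proof -
  let ?D = "distr M (count_space UNIV) f"
  have mf: "f \<in> M \<rightarrow>\<^sub>M count_space UNIV" by (rule measurable_simple_function[OF f])
  interpret D: prob_space ?D by (rule prob_space_distr[OF mf])
  let ?Z = "{c \<in> f ` space M. measure ?D {c} = 0}"
  have finZ: "finite ?Z" using f by (auto simp: simple_function_def)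
  have "measure ?D ?Z = (\<Sum>c\<in>?Z. measure ?D {c})"
    using finZ by (intro D.finite_measure_eq_sum_singleton) auto
  also have "\<dots> = 0" by simp
  finally have "?Z \<in> null_sets ?D" by (intro null_setsI) (auto simp: D.emeasure_eq_measure)
  moreover have "{c \<in> space M. measure ?D {f c} = 0} \<subseteq> f -` ?Z \<inter> space M" by auto
  ultimately have "AE x in M. f x \<notin> ?Z"
    using AE_distr_iff[OF mf, of "\<lambda>c. c \<notin> ?Z"] AE_not_in[of ?Z ?D] by auto
  then have "AE x in M. measure ?D {f x} \<noteq> 0" by (rule AE_mp) auto
  then have "AE c in ?D. measure ?D {c} \<noteq> 0" using AE_distr_iff[OF mf] by auto
  then show ?thesis unfolding law_def
    by (intro Abs_pmf_inverse) (simp add: D.prob_space_axioms)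
qed

lemma prob_law:
  assumes f: "simple_function M f"
  shows "measure (law M f) S = prob (f -` S \<inter> space M)"
  unfolding measure_law_eq[OF f] by (intro measure_distr measurable_simple_function f) simp

lemma pmf_law:
  assumes f: "simple_function M f"
  shows "pmf (law M f) c = prob (f -` {c} \<inter> space M)"
  using prob_law[OF f, of "{c}"] by (simp add: measure_pmf_single)

lemma set_law:
  assumes f: "simple_function M f"
  shows "set_pmf (law M f) \<subseteq> f ` space M"
proof
  fix c assume "c \<in> set_pmf (law M f)"
  then have "prob (f -` {c} \<inter> space M) \<noteq> 0" by (simp add: set_pmf_iff pmf_law[OF f])
  then have "f -` {c} \<inter> space M \<noteq> {}" by (metis measure_empty)
  then show "c \<in> f ` space M" by blast
qed

lemma finite_set_law:
  assumes f: "simple_function M f"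
  shows "finite (set_pmf (law M f))"
  using f finite_subset[OF set_law[OF f]] by (simp add: simple_function_def)

lemma simple_function_comp_any: "simple_function M f \<Longrightarrow> simple_function M (\<lambda>x. g (f x))"
  using simple_function_compose[of M f g] by (simp add: o_def)

lemma map_law:
  assumes f: "simple_function M f"
  shows "map_pmf g (law M f) = law M (\<lambda>x. g (f x))"
  by (rule pmf_eqI) (simp add: pmf_map prob_law[OF f] pmf_law[OF simple_function_comp_any[OF f]] vimage_def)

lemma law_measure_preserving:
  assumes f: "simple_function M f" and T: "T \<in> M \<rightarrow>\<^sub>M M" "distr M M T = M"
  shows "law M (\<lambda>x. f (T x)) = law M f"
proof -
  have "distr M (count_space UNIV) (\<lambda>x. f (T x)) = distr (distr M M T) (count_space UNIV) f"
    using measurable_simple_function[OF f] T(1) by (subst distr_distr) (auto simp: o_def)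
  then show ?thesis unfolding law_def T(2) by simp
qed

lemma simple_function_map_list:
  assumes "\<And>i. i \<in> set is \<Longrightarrow> simple_function M (f i)"
  shows "simple_function M (\<lambda>x. map (\<lambda>i. f i x) is)"
  using assms
proof (induction "is")
  case (Cons i js)
  have "simple_function M (\<lambda>x. (\<lambda>(a, b). a # b) (f i x, map (\<lambda>i. f i x) js))"
    by (rule simple_function_comp_any, rule simple_function_Pair) (use Cons in auto)
  then show ?case by simp
qed simp

end

section \<open>The shift on the system\<close>

definition right_shift :: "(int \<Rightarrow> 'a) \<Rightarrow> int \<Rightarrow> 'a" where
  "right_shift x = (\<lambda>i. x (i - 1))"

definition window :: "int \<Rightarrow> nat \<Rightarrow> (int \<Rightarrow> 'a) \<Rightarrow> 'a list" where
  "window i r x = map (\<lambda>j. x (i + int j)) [0..<r]"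

lemma length_window [simp]: "length (window i r x) = r"
  by (simp add: window_def)

lemma nth_window [simp]: "j < r \<Longrightarrow> window i r x ! j = x (i + int j)"
  by (simp add: window_def)

lemma map_upto_window: "map x [i..j] = window i (nat (j - i + 1)) x"
  by (rule nth_equalityI) (auto simp: nth_upto)

lemma take_drop_window: "j + s \<le> r \<Longrightarrow> take s (drop j (window i r x)) = window (i + int j) s x"
  by (rule nth_equalityI) (auto simp: ac_simps)

lemma in_word_system_iff:
  "x \<in> word_system W \<longleftrightarrow> (\<forall>i r. \<exists>n. \<exists>w\<in>W n. sublist (window i r x) w)"
proof
  assume x: "x \<in> word_system W"
  show "\<forall>i r. \<exists>n. \<exists>w\<in>W n. sublist (window i r x) w"
  proof (intro allI)
    fix i r
    have "\<exists>n. \<exists>w\<in>W n. sublist (map x [i..i + int r - 1]) w" using x by (simp add: word_system_def)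
    then show "\<exists>n. \<exists>w\<in>W n. sublist (window i r x) w" by (simp add: map_upto_window)
  qed
next
  assume "\<forall>i r. \<exists>n. \<exists>w\<in>W n. sublist (window i r x) w"
  then show "x \<in> word_system W" by (simp add: word_system_def map_upto_window)
qed

lemma window_left_shift: "window i r (left_shift x) = window (i + 1) r x"
  by (simp add: window_def left_shift_def ac_simps)

lemma window_right_shift: "window i r (right_shift x) = window (i - 1) r x"
  by (auto simp: window_def right_shift_def algebra_simps)

lemma left_shift_system: "x \<in> word_system W \<Longrightarrow> left_shift x \<in> word_system W"
  by (simp add: in_word_system_iff window_left_shift)

lemma right_shift_system: "x \<in> word_system W \<Longrightarrow> right_shift x \<in> word_system W"
  by (simp add: in_word_system_iff window_right_shift)

lemma left_right_shift [simp]: "left_shift (right_shift x) = x" "right_shift (left_shift x) = x"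
  by (simp_all add: left_shift_def right_shift_def)

lemma left_shift_funpow: "(left_shift ^^ n) x = (\<lambda>i. x (i + int n))"
  by (induction n arbitrary: x) (auto simp: left_shift_def ac_simps)

lemma right_shift_funpow: "(right_shift ^^ n) x = (\<lambda>i. x (i - int n))"
  by (induction n arbitrary: x) (auto simp: right_shift_def algebra_simps)

locale E_system = E_construction W \<epsilon> k y + prob_space \<mu>
  for W :: "nat \<Rightarrow> 'a::finite list set" and \<epsilon> k y and \<mu> :: "(int \<Rightarrow> 'a) measure" +
  assumes freq: "is_frequency_measure W \<mu>"
begin

abbreviation \<Omega> :: "(int \<Rightarrow> 'a) set" where "\<Omega> \<equiv> word_system W"

lemma space_mu: "space \<mu> = \<Omega>"
  and sets_mu: "sets \<mu> = sets (restrict_space (\<Pi>\<^sub>M i\<in>(UNIV :: int set). count_space UNIV) \<Omega>)"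
  and distr_shift: "distr \<mu> \<mu> left_shift = \<mu>"
  using freq by (auto simp: is_frequency_measure_def)

lemma coordinate_measurable [measurable]: "(\<lambda>x. x i) \<in> \<mu> \<rightarrow>\<^sub>M count_space UNIV"
proof -
  have "(\<lambda>x. x i) \<in> restrict_space (\<Pi>\<^sub>M i\<in>(UNIV :: int set). count_space UNIV) \<Omega> \<rightarrow>\<^sub>M count_space (UNIV :: 'a set)"
    by (intro measurable_restrict_space1 measurable_component_singleton) simp
  then show ?thesis using measurable_cong_sets[OF sets_mu refl] by blast
qed

text \<open>The sigma-algebra of \<mu> is the trace of the product one, so it suffices to test
  coordinates and to stay inside \<Omega>.\<close>

lemma measurable_into_mu:
  assumes "\<And>i. (\<lambda>x. f x i) \<in> M \<rightarrow>\<^sub>M count_space UNIV" "\<And>x. x \<in> space M \<Longrightarrow> f x \<in> \<Omega>"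
  shows "f \<in> M \<rightarrow>\<^sub>M \<mu>"
proof -
  have "(\<lambda>x. (\<lambda>i. f x i)) \<in> M \<rightarrow>\<^sub>M (\<Pi>\<^sub>M i\<in>(UNIV :: int set). count_space (UNIV :: 'a set))"
    using assms(1) by (intro measurable_PiM_single') auto
  then have "f \<in> M \<rightarrow>\<^sub>M restrict_space (\<Pi>\<^sub>M i\<in>(UNIV :: int set). count_space UNIV) \<Omega>"
    using assms(2) by (intro measurable_restrict_space2) auto
  then show ?thesis using measurable_cong_sets[OF refl sets_mu] by blast
qed

lemma left_shift_measurable: "left_shift \<in> \<mu> \<rightarrow>\<^sub>M \<mu>"
  by (rule measurable_into_mu) (auto simp: left_shift_def[abs_def] space_mu left_shift_system[unfolded left_shift_def])

lemma right_shift_measurable: "right_shift \<in> \<mu> \<rightarrow>\<^sub>M \<mu>"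
  by (rule measurable_into_mu) (auto simp: right_shift_def[abs_def] space_mu right_shift_system[unfolded right_shift_def])

lemma bij_left_shift: "bij_betw left_shift \<Omega> \<Omega>"
  by (rule bij_betw_byWitness[where f' = right_shift]) (auto intro: left_shift_system right_shift_system)

lemma mp_automorphism_shift: "mp_automorphism \<mu> left_shift"
proof -
  have inv: "the_inv_into \<Omega> left_shift x = right_shift x" if "x \<in> \<Omega>" for x
    using bij_left_shift that right_shift_system[OF that] by (intro the_inv_into_f_eq) (auto simp: bij_betw_def)
  have "the_inv_into (space \<mu>) left_shift \<in> \<mu> \<rightarrow>\<^sub>M \<mu>"
    using right_shift_measurable by (subst measurable_cong[of _ _ right_shift]) (auto simp: space_mu inv)
  then show ?thesis
    using left_shift_measurable bij_left_shift distr_shift prob_space_axioms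
    by (simp add: mp_automorphism_def space_mu)
qed

lemma funpow_measurable: "left_shift ^^ n \<in> \<mu> \<rightarrow>\<^sub>M \<mu>"
  by (induction n) (auto intro: measurable_compose_rev[OF left_shift_measurable] simp: o_def[abs_def] id_def)

lemma funpow_system: "x \<in> \<Omega> \<Longrightarrow> (left_shift ^^ n) x \<in> \<Omega>"
  by (induction n) (auto intro: left_shift_system)

lemma distr_funpow: "distr \<mu> \<mu> (left_shift ^^ n) = \<mu>"
proof (induction n)
  case 0
  then show ?case by (simp add: id_def)
next
  case (Suc n)
  have "distr \<mu> \<mu> (left_shift ^^ Suc n) = distr (distr \<mu> \<mu> (left_shift ^^ n)) \<mu> left_shift"
    using left_shift_measurable funpow_measurable by (subst distr_distr) auto
  then show ?case using Suc distr_shift by (simp add: o_def)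
qed

lemma simple_coordinate: "simple_function \<mu> (\<lambda>x. x i)"
proof -
  have "{x \<in> space \<mu>. x i = c} \<in> sets \<mu>" for c :: 'a by measurable
  moreover have "(\<lambda>x. x i) -` {c} \<inter> space \<mu> = {x \<in> space \<mu>. x i = c}" for c :: 'a by auto
  ultimately show ?thesis unfolding simple_function_def by (metis finite)
qed

lemma simple_window: "simple_function \<mu> (window i r)"
  unfolding window_def[abs_def] by (intro simple_function_map_list simple_coordinate)

lemma frequency_limit:
  assumes "\<And>n. w n \<in> W n"
  shows "(\<lambda>n. real (occurrences u (w n)) / real (length (w n))) \<longlonglongrightarrow> pmf (law \<mu> (window 0 (length u))) u"
proof -
  have "pmf (law \<mu> (window 0 (length u))) u = prob {x \<in> space \<mu>. map x [0..int (length u) - 1] = u}"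
    unfolding pmf_law[OF simple_window] by (intro arg_cong[where f = prob]) (auto simp: map_upto_window)
  then show ?thesis using freq assms by (auto simp: is_frequency_measure_def)
qed

section \<open>Aperiodicity and absence of atoms\<close>

text \<open>A periodic point of period \<open>p\<close> has at most \<open>p\<close> subwords of a given length, but every long
  subword of a point of the system contains all words of \<open>W n\<close>.\<close>

lemma contains_all_words:
  assumes x: "x \<in> \<Omega>" and u: "u \<in> W n"
  shows "\<exists>i. window i (h n) x = u"
proof -
  \<comment> \<open>Twice the block length guarantees a complete (n + 1)-block inside the window,
    wherever the window lies in the word.\<close>
  let ?r = "2 * h (Suc n)"
  have hh: "h (Suc n) > 0" by (rule h_pos)
  obtain m w where w: "w \<in> W m" "sublist (window 0 ?r x) w"
    using x unfolding in_word_system_iff by blast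
  obtain ps ss where pw: "w = ps @ window 0 ?r x @ ss" using w(2) by (auto simp: sublist_def)
  have len: "length ps + ?r \<le> h m" using W_length[OF w(1)] pw by simp
  have "Suc n \<le> m"
  proof (rule ccontr)
    assume "\<not> Suc n \<le> m"
    then have "h m \<le> h (Suc n)" by (intro h_mono) simp
    then show False using len hh by linarith
  qed
  \<comment> \<open>An aligned segment of the right length in a word of higher level is itself a
    word of level n + 1.\<close>
  have chop: "take (h (Suc n)) (drop (j * h (Suc n)) v) \<in> W (Suc n)"
    if "v \<in> W (Suc n + d)" "Suc j * h (Suc n) \<le> h (Suc n + d)" for d v j
    using that
  proof (induction d arbitrary: v j)
    case 0
    then have "Suc j * h (Suc n) \<le> 1 * h (Suc n)" by simp
    then have "Suc j \<le> 1" using hh by (simp only: mult_le_cancel2)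
    then show ?case using 0 W_length[of v "Suc n"] by simp
  next
    case (Suc d)
    obtain vs where vs: "v = concat vs" "length vs = k (Suc n + d)" "set vs \<subseteq> W (Suc n + d)"
      using words_of_admissible[of v "Suc n + d"] Suc.prems(1) by (metis add_Suc_right)
    obtain r where r: "h (Suc n + d) = r * h (Suc n)" using h_dvd[of "Suc n" "Suc n + d"] by (metis dvdE le_add1 mult.commute)
    have rpos: "r > 0" using r h_pos[of "Suc n + d"] by (cases r) auto
    have "Suc j * h (Suc n) \<le> (k (Suc n + d) * r) * h (Suc n)" using Suc.prems(2) r by (simp add: h_Suc)
    then have "Suc j \<le> k (Suc n + d) * r" using hh by (simp only: mult_le_cancel2)
    then have q: "j div r < length vs" using vs(2) by (simp add: less_mult_imp_div_less)
    have jj: "j = j div r * r + j mod r" by (simp add: div_mult_mod_eq)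
    have mr: "Suc (j mod r) * h (Suc n) \<le> h (Suc n + d)"
      unfolding r using rpos by (intro mult_right_mono) (auto simp: Suc_le_eq)
    have "j * h (Suc n) = j div r * h (Suc n + d) + j mod r * h (Suc n)"
      by (subst jj) (simp only: r distrib_right mult.assoc)
    then have "take (h (Suc n)) (drop (j * h (Suc n)) v) = take (h (Suc n)) (drop (j mod r * h (Suc n)) (vs ! (j div r)))"
      unfolding vs(1) using vs(3) W_length q mr
      by (simp only:) (intro take_drop_concat_uniform, auto)
    also have "\<dots> \<in> W (Suc n)" using Suc.IH[OF subsetD[OF vs(3) nth_mem[OF q]] mr] .
    finally show ?case .
  qed
  \<comment> \<open>Adding 1 skips the block that may have begun before the window; the j-th block
    starts inside it and ends before it does.\<close>
  define j where "j = length ps div h (Suc n) + 1"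
  have j1: "length ps \<le> j * h (Suc n)"
    using dividend_less_div_times[OF hh, of "length ps"] unfolding j_def by simp
  have j2: "Suc j * h (Suc n) \<le> length ps + ?r"
    using div_times_less_eq_dividend[of "length ps" "h (Suc n)"] unfolding j_def by simp
  obtain d where d: "m = Suc n + d" using \<open>Suc n \<le> m\<close> le_Suc_ex by blast
  let ?v = "take (h (Suc n)) (drop (j * h (Suc n)) w)"
  have "?v \<in> W (Suc n)" using chop[of w d j] w(1) j2 len d by simp
  moreover have "?v = window (int (j * h (Suc n) - length ps)) (h (Suc n)) x"
  proof -
    have le: "j * h (Suc n) - length ps + h (Suc n) \<le> ?r" using j1 j2 by simp
    have "?v = take (h (Suc n)) (drop (j * h (Suc n) - length ps) (window 0 ?r x @ ss))"
      unfolding pw using j1 by simp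
    also have "\<dots> = take (h (Suc n)) (drop (j * h (Suc n) - length ps) (window 0 ?r x))"
      using le by simp
    also have "\<dots> = window (int (j * h (Suc n) - length ps)) (h (Suc n)) x"
      using take_drop_window[OF le, of 0 x] by simp
    finally show ?thesis .
  qed
  ultimately have "sublist u (window (int (j * h (Suc n) - length ps)) (h (Suc n)) x)"
    using sublist_W[OF u] by simp
  then obtain as bs where ab: "window (int (j * h (Suc n) - length ps)) (h (Suc n)) x = as @ u @ bs"
    by (auto simp: sublist_def)
  have lu: "length as + h n \<le> h (Suc n)"
    using arg_cong[OF ab, of length] W_length[OF u] by simp
  have "u = take (h n) (drop (length as) (window (int (j * h (Suc n) - length ps)) (h (Suc n)) x))"
    unfolding ab using W_length[OF u] by simp
  then show ?thesis unfolding take_drop_window[OF lu] by blast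
qed

lemma not_periodic:
  assumes x: "x \<in> \<Omega>" and p: "p > 0"
  shows "(left_shift ^^ p) x \<noteq> x"
proof
  assume per: "(left_shift ^^ p) x = x"
  have per1: "x (i + int p) = x i" for i using fun_cong[OF per, of i] by (simp add: left_shift_funpow)
  have per2: "x (i + int q * int p) = x i" for i q
  proof (induction q)
    case (Suc q)
    have "x (i + int (Suc q) * int p) = x ((i + int q * int p) + int p)" by (simp add: algebra_simps)
    then show ?case using Suc per1 by simp
  qed simp
  have per3: "x i = x (i mod int p)" for i
  proof (cases "i div int p \<ge> 0")
    case True
    then obtain q where q: "i div int p = int q" using nonneg_int_cases by blast
    have "i = i mod int p + int q * int p" unfolding q[symmetric] by (simp add: mod_div_mult_eq)
    then show ?thesis using per2[of "i mod int p" q] by simp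
  next
    case False
    define q where "q = nat (- (i div int p))"
    have q: "i div int p = - int q" using False by (simp add: q_def)
    have "i + int q * int p = i mod int p"
      using div_mult_mod_eq[of i "int p"] q by simp
    then show ?thesis using per2[of i q] by simp
  qed
  \<comment> \<open>Level p suffices, since \<open>N p\<close> exceeds \<open>2 ^ (p + 12)\<close>
    and hence the at most p windows of a point of period p.\<close>
  define n where "n = p"
  have "W n \<subseteq> (\<lambda>i. window i (h n) x) ` {0..<int p}"
  proof
    fix u assume "u \<in> W n"
    then obtain i where i: "window i (h n) x = u" using contains_all_words[OF x] by blast
    have "window i (h n) x = window (i mod int p) (h n) x"
      by (rule nth_equalityI) (use per3 in \<open>auto simp: mod_add_left_eq\<close>, metis mod_add_left_eq per3)
    moreover have "i mod int p \<in> {0..<int p}" using p by simp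
    ultimately show "u \<in> (\<lambda>i. window i (h n) x) ` {0..<int p}" using i by blast
  qed
  then have "N n \<le> card {0..<int p}" by (intro surj_card_le) auto
  then have "real (N n) \<le> real n" by (simp add: n_def)
  moreover have "real n < 2 ^ n" using of_nat_less_two_power[of n] by simp
  moreover have "(2::real) ^ n \<le> 2 ^ (n + 12)" by (intro power_increasing) auto
  ultimately show False using N_large[of n] by linarith
qed

lemma singleton_event: "x \<in> \<Omega> \<Longrightarrow> {x} \<in> events"
proof -
  assume x: "x \<in> \<Omega>"
  have "{z \<in> space \<mu>. \<forall>i. z i = x i} \<in> sets \<mu>" by measurable
  moreover have "{z \<in> space \<mu>. \<forall>i. z i = x i} = {x}" using x by (auto simp: space_mu)
  ultimately show ?thesis by simp
qed

text \<open>The backward orbit of x consists of distinct points by aperiodicity, and invariance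
  gives them all the same mass. Infinitely many equal masses in a probability space are
  zero.\<close>

lemma prob_singleton: assumes x: "x \<in> \<Omega>" shows "prob {x} = 0"
proof (rule ccontr)
  assume ne: "prob {x} \<noteq> 0"
  let ?x = "\<lambda>n. (right_shift ^^ n) x"
  have xin: "?x n \<in> \<Omega>" for n using x by (induction n) (auto intro: right_shift_system)
  have inv: "(left_shift ^^ n) (?x n) = x" for n by (auto simp: left_shift_funpow right_shift_funpow)
  have eq: "prob {?x n} = prob {x}" for n
  proof -
    have "prob {x} = measure (distr \<mu> \<mu> (left_shift ^^ n)) {x}" by (simp add: distr_funpow)
    also have "\<dots> = prob ((left_shift ^^ n) -` {x} \<inter> space \<mu>)"
      by (intro measure_distr funpow_measurable singleton_event x)
    also have "(left_shift ^^ n) -` {x} \<inter> space \<mu> = {?x n}"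
    proof (intro equalityI subsetI)
      fix z assume "z \<in> (left_shift ^^ n) -` {x} \<inter> space \<mu>"
      then have "(left_shift ^^ n) z = x" by simp
      then have "z = ?x n" by (auto simp: left_shift_funpow right_shift_funpow)
      then show "z \<in> {?x n}" by simp
    qed (use inv xin in \<open>simp add: space_mu\<close>)
    finally show ?thesis by simp
  qed
  have ne2: "?x i \<noteq> ?x j" if "i < j" for i j
  proof
    assume e: "?x i = ?x j"
    have "(left_shift ^^ (j - i)) x = x"
    proof
      fix l
      have "x (l + int (j - i)) = ?x i (l + int j)" using that by (simp add: right_shift_funpow of_nat_diff algebra_simps)
      also have "\<dots> = x l" unfolding e by (simp add: right_shift_funpow)
      finally show "(left_shift ^^ (j - i)) x l = x l" by (simp add: left_shift_funpow)
    qed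
    then show False using not_periodic[OF x, of "j - i"] that by simp
  qed
  have inj: "inj ?x" by (rule linorder_injI) (rule ne2)
  have pos: "prob {x} > 0" using ne by (simp add: zero_less_measure_iff)
  obtain q :: nat where q: "1 / prob {x} < real q" using reals_Archimedean2 by blast
  have "prob (?x ` {..<q}) = (\<Sum>z\<in>?x ` {..<q}. prob {z})"
    using xin by (intro finite_measure_eq_sum_singleton) (auto intro: singleton_event)
  also have "\<dots> = (\<Sum>i<q. prob {?x i})"
    by (rule sum.reindex_cong[where l = ?x]) (auto intro: inj_on_subset[OF inj])
  also have "\<dots> = real q * prob {x}" by (simp add: eq)
  also have "\<dots> > 1" using q pos by (simp add: field_simps)
  finally show False using prob_le_1[of "?x ` {..<q}"] by simp
qed

section \<open>Coding points by real numbers\<close>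

definition bit :: "nat \<Rightarrow> (int \<Rightarrow> 'a) \<Rightarrow> real" where
  "bit n x = (if x (snd (from_nat n :: 'a \<times> int)) = fst (from_nat n :: 'a \<times> int) then 1 else 0)"

text \<open>The bits are the indicators of the events \<open>x i = a\<close>, listed through an
  enumeration of the pairs (a, i). The digits 0 and 1 in base 3 leave a gap: a tail is at most 1 /
  2, so a leading 0 gives at most 1 / 6 and a leading 1 at least 1 / 3. In base 2 the digits would
  not be determined by the sum.\<close>

definition embed :: "(int \<Rightarrow> 'a) \<Rightarrow> real" where
  "embed x = (\<Sum>n. (1 / 3) ^ Suc n * bit n x)"

text \<open>For a coded point this is the tail of the expansion after n digits, computed from the
  real number alone, so that it is visibly Borel.\<close>

primrec remainder :: "nat \<Rightarrow> real \<Rightarrow> real" where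
  "remainder 0 r = r"
| "remainder (Suc n) r = 3 * remainder n r - (if remainder n r \<ge> 1 / 3 then 1 else 0)"

lemma bit_range: "0 \<le> bit n x" "bit n x \<le> 1"
  by (simp_all add: bit_def)

lemma summable_bits: "summable (\<lambda>k. (1 / 3) ^ Suc k * bit (n + k) x)"
proof (rule summable_comparison_test')
  show "summable (\<lambda>k. (1 / 3 :: real) ^ Suc k)" by (simp add: summable_geometric)
  show "norm ((1 / 3) ^ Suc k * bit (n + k) x) \<le> (1 / 3) ^ Suc k" for k
    using bit_range[of "n + k" x] by (simp add: abs_mult mult_left_le)
qed

lemma remainder_embed:
  "remainder n (embed x) = (\<Sum>k. (1 / 3) ^ Suc k * bit (n + k) x) \<and>
    (remainder n (embed x) \<ge> 1 / 3 \<longleftrightarrow> bit n x = 1)"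
proof -
  define t where "t n = (\<Sum>k. (1 / 3) ^ Suc k * bit (n + k) x)" for n
  have t0: "0 \<le> t n" for n unfolding t_def using bit_range by (intro suminf_nonneg summable_bits) simp
  have t1: "t n \<le> 1 / 2" for n
  proof -
    have "t n \<le> (\<Sum>k. (1 / 3) ^ Suc k)"
      unfolding t_def using bit_range[of _ x]
      by (intro suminf_le summable_bits) (auto simp: summable_geometric mult_left_le)
    also have "\<dots> = 1 / 2" using suminf_geometric[of "1 / 3 :: real"] suminf_mult[of "\<lambda>k. (1/3::real) ^ k" "1 / 3"]
      by (simp add: summable_geometric)
    finally show ?thesis .
  qed
  have ts: "t n = (bit n x + t (Suc n)) / 3" for n
  proof -
    have "t n = (1 / 3) ^ Suc 0 * bit (n + 0) x + (\<Sum>k. (1 / 3) ^ Suc (Suc k) * bit (n + Suc k) x)"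
      unfolding t_def by (subst suminf_split_head[OF summable_bits]) simp
    also have "(\<Sum>k. (1 / 3) ^ Suc (Suc k) * bit (n + Suc k) x) = 1 / 3 * t (Suc n)"
      unfolding t_def by (subst suminf_mult[OF summable_bits, symmetric]) (simp add: mult.assoc)
    finally show ?thesis by simp
  qed
  have third: "t n \<ge> 1 / 3 \<longleftrightarrow> bit n x = 1" for n
    using ts[of n] t0[of "Suc n"] t1[of "Suc n"] by (auto simp: bit_def split: if_splits)
  have "remainder n (embed x) = t n"
  proof (induction n)
    case 0
    then show ?case by (simp add: embed_def t_def)
  next
    case (Suc n)
    have "bit n x = (if t n \<ge> 1 / 3 then 1 else 0)" using third[of n] by (auto simp: bit_def split: if_splits)
    then show ?case using Suc ts[of n] by simp
  qed
  then show ?thesis using third[of n] unfolding t_def by simp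
qed

text \<open>For a coded point the condition holds exactly for the codes m of the letter
  \<open>x i\<close>; \<open>LEAST\<close> selects one of them measurably. For other reals the value
  is arbitrary.\<close>

definition decode0 :: "real \<Rightarrow> int \<Rightarrow> 'a" where
  "decode0 r i = from_nat (LEAST m. remainder (to_nat (from_nat m :: 'a, i)) r \<ge> 1 / 3)"

lemma decode0_embed: "decode0 (embed x) = x"
proof
  fix i
  have eq: "remainder (to_nat (a, i)) (embed x) \<ge> 1 / 3 \<longleftrightarrow> x i = a" for a
    using conjunct2[OF remainder_embed[of "to_nat (a, i)" x]] by (simp only: bit_def from_nat_to_nat fst_conv snd_conv) simp
  have "x i = from_nat (LEAST m. x i = from_nat m)"
    by (rule LeastI[of "\<lambda>m. x i = from_nat m" "to_nat (x i)"]) simp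
  then show "decode0 (embed x) i = x i" unfolding decode0_def eq by simp
qed

lemma remainder_measurable [measurable]: "remainder n \<in> borel_measurable borel"
  by (induction n) (simp_all add: measurable_ident)

lemma decode0_measurable [measurable]: "(\<lambda>r. decode0 r i) \<in> borel \<rightarrow>\<^sub>M count_space UNIV"
proof -
  have "(\<lambda>r. LEAST m. remainder (to_nat (from_nat m :: 'a, i)) r \<ge> 1 / 3) \<in> borel \<rightarrow>\<^sub>M count_space UNIV"
    by measurable
  then show ?thesis
    unfolding decode0_def by (rule measurable_compose) simp
qed

text \<open>Membership in \<Omega> is a countable conjunction, over starting points and lengths, of
  countable disjunctions over words, each involving finitely many coordinates.\<close>

lemma pred_decode0: "Measurable.pred borel (\<lambda>r. decode0 r \<in> \<Omega>)"
proof -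
  let ?P = "\<lambda>u. \<exists>n. \<exists>w\<in>W n. sublist u w"
  have eq: "decode0 r \<in> \<Omega> \<longleftrightarrow>
      (\<forall>i l. \<exists>u. (length u = l \<and> ?P u) \<and> (\<forall>j<l. decode0 r (i + int j) = u ! j))" for r
  proof -
    have iff: "?P (window i l x) \<longleftrightarrow> (\<exists>u. (length u = l \<and> ?P u) \<and> (\<forall>j<l. x (i + int j) = u ! j))" for x :: "int \<Rightarrow> 'a" and i l
    proof
      assume "\<exists>u. (length u = l \<and> ?P u) \<and> (\<forall>j<l. x (i + int j) = u ! j)"
      then obtain u where u: "length u = l" "?P u" "\<forall>j<l. x (i + int j) = u ! j" by blast
      have "window i l x = u" by (rule nth_equalityI) (use u in auto)
      then show "?P (window i l x)" using u by simp
    qed (intro exI[of _ "window i l x"], simp)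
    show ?thesis unfolding in_word_system_iff iff ..
  qed
  show ?thesis unfolding eq by measurable
qed

text \<open>Reals that do not decode to a point of \<Omega> are sent to a fixed point x0. Fibres of
  \<open>embed\<close> are empty or singletons, so the image measure has no atoms.\<close>

lemma ex_coded_space: "\<exists>D. coded_space \<mu> embed D"
proof -
  obtain x0 where x0: "x0 \<in> \<Omega>" using not_empty space_mu by auto
  define D where "D r = (if decode0 r \<in> \<Omega> then decode0 r else x0)" for r
  have D: "D \<in> borel \<rightarrow>\<^sub>M \<mu>"
  proof (rule measurable_into_mu)
    fix i
    have "(\<lambda>r. if decode0 r \<in> \<Omega> then decode0 r i else x0 i) \<in> borel \<rightarrow>\<^sub>M count_space UNIV"
    proof (rule measurable_If[OF decode0_measurable])
      show "{r \<in> space borel. decode0 r \<in> \<Omega>} \<in> sets borel" using pred_decode0 by (simp only: pred_def)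
    qed simp
    moreover have "(\<lambda>r. D r i) = (\<lambda>r. if decode0 r \<in> \<Omega> then decode0 r i else x0 i)" by (auto simp: D_def)
    ultimately show "(\<lambda>r. D r i) \<in> borel \<rightarrow>\<^sub>M count_space UNIV" by simp
  qed (simp add: D_def x0)
  have DF: "D (embed x) = x" if "x \<in> \<Omega>" for x using that by (simp add: D_def decode0_embed)
  have "bit n \<in> borel_measurable \<mu>" for n unfolding bit_def[abs_def] by measurable
  then have F: "embed \<in> borel_measurable \<mu>" unfolding embed_def[abs_def] by (intro borel_measurable_suminf) measurable
  have "prob (embed -` {r} \<inter> space \<mu>) = 0" for r
  proof (cases "embed -` {r} \<inter> space \<mu> = {}")
    case False
    then obtain x where x: "x \<in> \<Omega>" "embed x = r" by (auto simp: space_mu)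
    have "embed -` {r} \<inter> space \<mu> = {x}"
    proof (intro equalityI subsetI)
      fix z assume "z \<in> embed -` {r} \<inter> space \<mu>"
      then have "z \<in> \<Omega>" "embed z = r" by (auto simp: space_mu)
      then show "z \<in> {x}" using DF[of z] DF[OF x(1)] x(2) by simp
    qed (use x in \<open>simp add: space_mu\<close>)
    then show ?thesis using prob_singleton[OF x(1)] by simp
  qed simp
  then have "coded_space \<mu> embed D"
    using D DF F by unfold_locales (auto simp: space_mu)
  then show ?thesis by blast
qed

section \<open>Approximation of events by cylinders\<close>

definition cyl :: "nat \<Rightarrow> 'a list set \<Rightarrow> (int \<Rightarrow> 'a) set" where
  "cyl s Q = {x \<in> \<Omega>. window (- int s) (2 * s + 1) x \<in> Q}"

lemma cyl_event: "cyl s Q \<in> events"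
proof -
  have "cyl s Q = window (- int s) (2 * s + 1) -` Q \<inter> space \<mu>" by (auto simp: cyl_def space_mu)
  then show ?thesis using measurable_sets[OF measurable_simple_function[OF simple_window]] by simp
qed

lemma cyl_mono:
  assumes "s \<le> s'"
  shows "\<exists>Q'. cyl s Q = cyl s' Q'"
proof -
  have eq: "window (- int s) (2 * s + 1) x = take (2 * s + 1) (drop (s' - s) (window (- int s') (2 * s' + 1) x))" for x
    using assms by (subst take_drop_window) (auto simp: of_nat_diff)
  have "cyl s Q = cyl s' {v. take (2 * s + 1) (drop (s' - s) v) \<in> Q}"
    unfolding cyl_def mem_Collect_eq by (simp only: eq[symmetric])
  then show ?thesis by blast
qed

lemma cyl_Un: "\<exists>s Q. cyl s1 Q1 \<union> cyl s2 Q2 = cyl s Q"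
proof -
  obtain Q1' Q2' where "cyl s1 Q1 = cyl (max s1 s2) Q1'" "cyl s2 Q2 = cyl (max s1 s2) Q2'"
    using cyl_mono by (metis max.cobounded1 max.cobounded2)
  moreover have "cyl (max s1 s2) Q1' \<union> cyl (max s1 s2) Q2' = cyl (max s1 s2) (Q1' \<union> Q2')" by (auto simp: cyl_def)
  ultimately show ?thesis by metis
qed

definition approximable :: "(int \<Rightarrow> 'a) set \<Rightarrow> bool" where
  "approximable A \<longleftrightarrow> A \<in> events \<and> (\<forall>e>0. \<exists>s Q. prob ((A - cyl s Q) \<union> (cyl s Q - A)) < e)"

lemma approximable_Un:
  assumes "approximable A" "approximable B"
  shows "approximable (A \<union> B)"
  unfolding approximable_def
proof (intro conjI allI impI)
  show "A \<union> B \<in> events" using assms by (auto simp: approximable_def)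
  fix e :: real assume "e > 0"
  then obtain s1 Q1 s2 Q2 where a: "prob ((A - cyl s1 Q1) \<union> (cyl s1 Q1 - A)) < e / 2"
    and b: "prob ((B - cyl s2 Q2) \<union> (cyl s2 Q2 - B)) < e / 2"
    using assms unfolding approximable_def by (meson half_gt_zero)
  obtain s Q where sQ: "cyl s1 Q1 \<union> cyl s2 Q2 = cyl s Q" using cyl_Un by blast
  have ev: "A \<in> events" "B \<in> events" using assms by (auto simp: approximable_def)
  have "prob ((A \<union> B - cyl s Q) \<union> (cyl s Q - (A \<union> B)))
      \<le> prob (((A - cyl s1 Q1) \<union> (cyl s1 Q1 - A)) \<union> ((B - cyl s2 Q2) \<union> (cyl s2 Q2 - B)))"
    using ev cyl_event by (intro finite_measure_mono) (auto simp: sQ[symmetric])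
  also have "\<dots> \<le> prob ((A - cyl s1 Q1) \<union> (cyl s1 Q1 - A)) + prob ((B - cyl s2 Q2) \<union> (cyl s2 Q2 - B))"
    using ev cyl_event by (intro measure_Un_le) auto
  finally have "prob ((A \<union> B - cyl s Q) \<union> (cyl s Q - (A \<union> B))) < e" using a b by linarith
  then show "\<exists>s Q. prob ((A \<union> B - cyl s Q) \<union> (cyl s Q - (A \<union> B))) < e" by blast
qed

text \<open>Half of the error is spent on a finite subunion, by continuity from below, and half on
  approximating that subunion by a cylinder.\<close>

lemma approximable_UN:
  assumes A: "\<And>i :: nat. approximable (A i)"
  shows "approximable (\<Union>i. A i)"
  unfolding approximable_def
proof (intro conjI allI impI)
  have ev: "A i \<in> events" for i using A by (simp add: approximable_def)
  then show "(\<Union>i. A i) \<in> events" by blast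
  fix e :: real assume e: "e > 0"
  let ?B = "\<lambda>n. \<Union>i\<le>n. A i"
  have evB: "?B n \<in> events" for n using ev by blast
  have apB: "approximable (?B n)" for n
  proof (induction n)
    case (Suc n)
    have "?B (Suc n) = ?B n \<union> A (Suc n)" by (auto simp: atMost_Suc)
    then show ?case using approximable_Un[OF Suc A] by simp
  qed (use A in simp)
  have "(\<lambda>n. prob (?B n)) \<longlonglongrightarrow> prob (\<Union>n. ?B n)"
    using evB by (intro finite_Lim_measure_incseq) (auto simp: incseq_def intro: order_trans)
  moreover have "(\<Union>n. ?B n) = (\<Union>i. A i)" by auto
  ultimately have "(\<lambda>n. prob (?B n)) \<longlonglongrightarrow> prob (\<Union>i. A i)" by simp
  then have "\<forall>\<^sub>F n in sequentially. prob (\<Union>i. A i) - e / 2 < prob (?B n)"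
    using e by (intro order_tendstoD(1)) auto
  then obtain n where n: "prob (\<Union>i. A i) - e / 2 < prob (?B n)" by (auto simp: eventually_sequentially)
  obtain s Q where sQ: "prob ((?B n - cyl s Q) \<union> (cyl s Q - ?B n)) < e / 2"
    using apB[of n] e unfolding approximable_def by (meson half_gt_zero)
  have U: "(\<Union>i. A i) \<in> events" using ev by blast
  have "prob (((\<Union>i. A i) - cyl s Q) \<union> (cyl s Q - (\<Union>i. A i)))
      \<le> prob (((\<Union>i. A i) - ?B n) \<union> ((?B n - cyl s Q) \<union> (cyl s Q - ?B n)))"
    using U evB[of n] cyl_event by (intro finite_measure_mono) auto
  also have "\<dots> \<le> prob ((\<Union>i. A i) - ?B n) + prob ((?B n - cyl s Q) \<union> (cyl s Q - ?B n))"
    using U evB[of n] cyl_event by (intro measure_Un_le) auto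
  also have "prob ((\<Union>i. A i) - ?B n) = prob (\<Union>i. A i) - prob (?B n)"
    using U evB[of n] by (intro finite_measure_Diff) auto
  finally have "prob (((\<Union>i. A i) - cyl s Q) \<union> (cyl s Q - (\<Union>i. A i))) < e" using n sQ by linarith
  then show "\<exists>s Q. prob (((\<Union>i. A i) - cyl s Q) \<union> (cyl s Q - (\<Union>i. A i))) < e" by blast
qed

lemma cyl_approximable: "approximable (cyl s Q)"
  unfolding approximable_def using cyl_event by (auto intro!: exI[of _ s] exI[of _ Q])

lemma approximable_compl:
  assumes "approximable A"
  shows "approximable (\<Omega> - A)"
  unfolding approximable_def
proof (intro conjI allI impI)
  have A: "A \<in> events" using assms by (simp add: approximable_def)
  then show "\<Omega> - A \<in> events" using sets.compl_sets[OF A] by (simp add: space_mu)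
  fix e :: real assume "e > 0"
  then obtain s Q where sQ: "prob ((A - cyl s Q) \<union> (cyl s Q - A)) < e"
    using assms unfolding approximable_def by blast
  have "A \<subseteq> \<Omega>" using sets.sets_into_space[OF A] by (simp add: space_mu)
  then have "(\<Omega> - A - cyl s (- Q)) \<union> (cyl s (- Q) - (\<Omega> - A)) = (A - cyl s Q) \<union> (cyl s Q - A)"
    by (auto simp: cyl_def)
  then show "\<exists>s Q. prob ((\<Omega> - A - cyl s Q) \<union> (cyl s Q - (\<Omega> - A))) < e" using sQ by metis
qed

text \<open>The approximable events form a sigma-algebra containing the cylinders.\<close>

lemma events_approximable:
  assumes A: "A \<in> events"
  shows "approximable A"
proof -
  let ?S = "{A. approximable A}"
  have sub: "?S \<subseteq> Pow \<Omega>" using sets.sets_into_space by (auto simp: approximable_def space_mu[symmetric])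
  have sa: "sigma_algebra \<Omega> ?S"
    unfolding sigma_algebra_iff2
  proof (intro conjI ballI allI impI)
    have "cyl 0 {} = {}" by (simp add: cyl_def)
    then show "{} \<in> ?S" using cyl_approximable[of 0 "{}"] by simp
  qed (use sub approximable_compl approximable_UN in \<open>auto simp: image_subset_iff\<close>)
  interpret sigma_algebra \<Omega> ?S by (rule sa)
  let ?M = "sigma \<Omega> ?S"
  have setsM: "sets ?M = ?S" using sub by (simp add: sigma_sets_eq)
  have spM: "space ?M = \<Omega>" using sub by simp
  \<comment> \<open>Inclusion of sigma-algebras is expressed as measurability of the identity, which
    needs testing only on coordinates.\<close>
  have "(\<lambda>x. x) \<in> ?M \<rightarrow>\<^sub>M \<mu>"
  proof (rule measurable_into_mu)
    fix i :: int
    have "(\<lambda>x. x i) -` {c} \<inter> \<Omega> \<in> ?S" for c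
    proof -
      define s where "s = nat \<bar>i\<bar>"
      have "(\<lambda>x. x i) -` {c} \<inter> \<Omega> = cyl s {v. v ! nat (i + int s) = c}"
      proof -
        have "nat (i + int s) < 2 * s + 1" "- int s + int (nat (i + int s)) = i" by (auto simp: s_def)
        then show ?thesis by (auto simp: cyl_def)
      qed
      then show ?thesis using cyl_approximable by simp
    qed
    then have "simple_function ?M (\<lambda>x. x i)" by (simp add: simple_function_def spM setsM)
    then show "(\<lambda>x. x i) \<in> ?M \<rightarrow>\<^sub>M count_space UNIV" by (rule measurable_simple_function)
  qed (simp add: spM)
  then have "(\<lambda>x. x) -` A \<inter> space ?M \<in> sets ?M" using A by (rule measurable_sets)
  moreover have "A \<subseteq> \<Omega>" using sets.sets_into_space[OF A] by (simp add: space_mu)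
  ultimately show ?thesis by (simp add: spM setsM Int_absorb2)
qed

section \<open>Labels of partition cells as functions of finite windows\<close>

lemma cell_unique:
  assumes P: "finite_measurable_partition \<mu> P" and A: "A \<in> P" "x \<in> A"
  shows "cell P x = A"
  unfolding cell_def
proof (rule the_equality)
  fix B assume "B \<in> P \<and> x \<in> B"
  then show "B = A" using P A unfolding finite_measurable_partition_def
    by (metis IntI disjointD empty_iff partition_onD2)
qed (use A in simp)

lemma cell_in:
  assumes P: "finite_measurable_partition \<mu> P" and x: "x \<in> \<Omega>"
  shows "cell P x \<in> P" "x \<in> cell P x"
proof -
  obtain A where "A \<in> P" "x \<in> A"
    using P x by (auto simp: finite_measurable_partition_def partition_on_def space_mu[symmetric])
  then show "cell P x \<in> P" "x \<in> cell P x" using cell_unique[OF P] by auto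
qed

lemma simple_cell:
  assumes P: "finite_measurable_partition \<mu> P"
  shows "simple_function \<mu> (cell P)"
proof -
  have sub: "cell P ` space \<mu> \<subseteq> P" using cell_in(1)[OF P] by (auto simp: space_mu)
  have "cell P -` {A} \<inter> space \<mu> \<in> events" if "A \<in> cell P ` space \<mu>" for A
  proof -
    have AP: "A \<in> P" using that sub by blast
    then have ev: "A \<in> events" using P by (auto simp: finite_measurable_partition_def)
    have "cell P -` {A} \<inter> space \<mu> = A"
      using cell_unique[OF P AP] cell_in(2)[OF P] sets.sets_into_space[OF ev] by (auto simp: space_mu)
    then show ?thesis using ev by simp
  qed
  moreover have "finite (cell P ` space \<mu>)"
    using sub P finite_subset by (auto simp: finite_measurable_partition_def)
  ultimately show ?thesis by (simp add: simple_function_def)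
qed

text \<open>All cells are approximated by cylinders of a common radius s. Outside the union of the
  error sets, a cell contains x exactly if the window of x lies in the corresponding set
  \<open>Q A\<close>, so the window determines the label.\<close>

lemma cell_code:
  assumes P: "finite_measurable_partition \<mu> P" and e: "e > 0"
  shows "\<exists>s code. prob {x \<in> space \<mu>. cell P x \<noteq> code (window (- int s) (2 * s + 1) x)} < e"
proof -
  have finP: "finite P" and PE: "P \<subseteq> events" using P by (auto simp: finite_measurable_partition_def)
  \<comment> \<open>The summand 1 keeps q positive and makes the final estimate strict.\<close>
  define q where "q = real (card P) + 1"
  have q: "q > 0" by (simp add: q_def)
  have "\<forall>A\<in>P. \<exists>s Q. prob ((A - cyl s Q) \<union> (cyl s Q - A)) < e / q"
    using events_approximable PE e q unfolding approximable_def by (meson divide_pos_pos subsetD)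
  then obtain sA QA where sQ: "\<And>A. A \<in> P \<Longrightarrow> prob ((A - cyl (sA A) (QA A)) \<union> (cyl (sA A) (QA A) - A)) < e / q"
    by metis
  define s where "s = (\<Sum>A\<in>P. sA A)"
  have "sA A \<le> s" if "A \<in> P" for A unfolding s_def using finP that by (simp add: member_le_sum)
  then have "\<forall>A\<in>P. \<exists>Q. cyl (sA A) (QA A) = cyl s Q" using cyl_mono by blast
  then obtain Q where Q: "\<And>A. A \<in> P \<Longrightarrow> cyl (sA A) (QA A) = cyl s (Q A)" by metis
  define E where "E A = (A - cyl s (Q A)) \<union> (cyl s (Q A) - A)" for A
  have E: "prob (E A) < e / q" "E A \<in> events" if "A \<in> P" for A
    using sQ[OF that] that PE cyl_event by (auto simp: E_def Q)
  define code where "code v = (THE A. A \<in> P \<and> v \<in> Q A)" for v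
  let ?w = "window (- int s) (2 * s + 1)"
  have "{x \<in> space \<mu>. cell P x \<noteq> code (?w x)} \<subseteq> (\<Union>A\<in>P. E A)"
  proof
    fix x assume x: "x \<in> {x \<in> space \<mu>. cell P x \<noteq> code (?w x)}"
    show "x \<in> (\<Union>A\<in>P. E A)"
    proof (rule ccontr)
      assume "\<not> ?thesis"
      then have iff: "x \<in> A \<longleftrightarrow> ?w x \<in> Q A" if "A \<in> P" for A
        using x that by (auto simp: E_def cyl_def space_mu)
      have "code (?w x) = cell P x"
        unfolding code_def cell_def using iff by (intro arg_cong[where f = The]) auto
      then show False using x by simp
    qed
  qed
  then have "prob {x \<in> space \<mu>. cell P x \<noteq> code (?w x)} \<le> prob (\<Union>A\<in>P. E A)"
    using E(2) finP by (intro finite_measure_mono) auto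
  also have "\<dots> \<le> (\<Sum>A\<in>P. prob (E A))"
    using E(2) finP by (intro finite_measure_subadditive_finite) auto
  also have "\<dots> \<le> (\<Sum>A\<in>P. e / q)" using E(1) by (intro sum_mono) (simp add: less_imp_le)
  also have "\<dots> = real (card P) * (e / q)" by simp
  also have "\<dots> < q * (e / q)" using e q by (intro mult_strict_right_mono) (auto simp: q_def)
  also have "\<dots> = e" using q by simp
  finally show ?thesis by blast
qed

end

section \<open>The law of a window together with the positions of its free blocks\<close>

text \<open>Bolzano-Weierstrass for one point of X at a time, passing to a further subsequence at
  each step.\<close>

lemma finite_diagonal:
  fixes f :: "nat \<Rightarrow> 'x \<Rightarrow> real"
  assumes "finite X" "\<And>d x. 0 \<le> f d x \<and> f d x \<le> 1"
  shows "\<exists>r. strict_mono r \<and> (\<forall>x\<in>X. convergent (\<lambda>d. f (r d) x))"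
  using assms(1)
proof (induction X rule: finite_induct)
  case empty
  then show ?case by (intro exI[of _ id]) (auto simp: strict_mono_def)
next
  case (insert x X)
  then obtain r where r: "strict_mono r" "\<forall>x\<in>X. convergent (\<lambda>d. f (r d) x)" by blast
  have "\<forall>d. f (r d) x \<in> {0..1}" using assms(2) by simp
  then obtain l r' where r': "strict_mono r'" "((\<lambda>d. f (r d) x) \<circ> r') \<longlonglongrightarrow> l"
    using compact_Icc[of "0::real" 1] unfolding compact_def by meson
  have "convergent (\<lambda>d. f ((r \<circ> r') d) z)" if "z \<in> insert x X" for z
  proof (cases "z = x")
    case True
    then show ?thesis using r'(2) by (auto simp: o_def convergent_def)
  next
    case False
    then have "convergent (\<lambda>d. f (r d) z)" using r(2) that by simp
    then show ?thesis using convergent_subseq_convergent[OF _ r'(1)] by (fastforce simp: o_def)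
  qed
  then show ?case using strict_mono_o[OF r(1) r'(1)] by blast
qed

lemma measure_pmf_finite_support:
  assumes "finite X" "set_pmf p \<subseteq> X"
  shows "measure_pmf.prob p Z = (\<Sum>x\<in>X \<inter> Z. pmf p x)"
proof -
  have "measure_pmf.prob p Z = measure_pmf.prob p (X \<inter> Z)"
    using assms(2) by (intro measure_pmf.finite_measure_eq_AE) (auto simp: AE_measure_pmf_iff)
  then show ?thesis using assms(1) by (simp add: measure_measure_pmf_finite)
qed

lemma expectation_finite_support:
  fixes f :: "'x \<Rightarrow> real"
  assumes "finite X" "set_pmf p \<subseteq> X"
  shows "measure_pmf.expectation p f = (\<Sum>x\<in>X. pmf p x * f x)"
  using integral_measure_pmf_real[OF assms(1), of p f] assms(2) by (auto simp: mult.commute)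

context E_system
begin

definition starts :: "nat \<Rightarrow> nat \<Rightarrow> nat \<Rightarrow> nat \<Rightarrow> nat set" where
  "starts n K d i = {b. i + b \<in> free_starts n d \<and> b + h n \<le> K}"

definition samples :: "nat \<Rightarrow> nat \<Rightarrow> nat \<Rightarrow> (nat \<times> 'a list) set" where
  "samples n K d = {..h (n + d) - K} \<times> W (n + d)"

definition sample :: "nat \<Rightarrow> nat \<Rightarrow> nat \<Rightarrow> nat \<times> 'a list \<Rightarrow> nat set \<times> 'a list" where
  "sample n K d = (\<lambda>(i, w). (starts n K d i, take K (drop i w)))"

text \<open>A word of level n + d and a place of a window of length K in it are chosen uniformly;
  only the relative positions of the free n-blocks and the contents of the window are kept.\<close>

definition sample_pmf :: "nat \<Rightarrow> nat \<Rightarrow> nat \<Rightarrow> (nat set \<times> 'a list) pmf" where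
  "sample_pmf n K d = map_pmf (sample n K d) (pmf_of_set (samples n K d))"

definition window_states :: "nat \<Rightarrow> (nat set \<times> 'a list) set" where
  "window_states K = Pow {..<K} \<times> {u. length u = K}"

definition well_placed :: "nat \<Rightarrow> nat \<Rightarrow> nat set \<Rightarrow> 'a list \<Rightarrow> bool" where
  "well_placed n K s u \<longleftrightarrow> s \<subseteq> {..<K} \<and> length u = K \<and> (\<forall>b\<in>s. b + h n \<le> K \<and> block n u b \<in> V n) \<and>
    (\<forall>b\<in>s. \<forall>b'\<in>s. b < b' \<longrightarrow> b + h n \<le> b')"

lemma finite_window_states: "finite (window_states K)"
proof -
  have "finite {u :: 'a list. set u \<subseteq> UNIV \<and> length u = K}" by (rule finite_lists_length_eq) simp
  then show ?thesis by (simp add: window_states_def)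
qed

lemma samples_finite: "finite (samples n K d)" "samples n K d \<noteq> {}"
  using finite_W W_nonempty by (auto simp: samples_def)

lemma card_samples: "card (samples n K d) = (h (n + d) - K + 1) * N (n + d)"
  by (simp add: samples_def card_cartesian_product)

lemma set_sample_pmf: "set_pmf (sample_pmf n K d) = sample n K d ` samples n K d"
  using samples_finite by (simp add: sample_pmf_def)

lemma prob_sample_pmf:
  "measure_pmf.prob (sample_pmf n K d) Z
    = real (card {x \<in> samples n K d. sample n K d x \<in> Z}) / real (card (samples n K d))"
proof -
  have "samples n K d \<inter> sample n K d -` Z = {x \<in> samples n K d. sample n K d x \<in> Z}" by auto
  then show ?thesis
    using samples_finite by (simp add: sample_pmf_def measure_pmf_of_set)
qed

lemma block_take_drop: "b + h n \<le> K \<Longrightarrow> block n (take K (drop i w)) b = block n w (i + b)"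
  by (simp add: block_def drop_take min_def add.commute)

text \<open>In the word, free starts are multiples of \<open>h n\<close>, so two of them differ by
  at least \<open>h n\<close> wherever the window begins. The level must exceed n: for d = 0 the
  whole word is the free block and may be the reserved word.\<close>

lemma sample_well_placed:
  assumes hK: "K \<le> h (n + Suc d)" and su: "(s, u) \<in> set_pmf (sample_pmf n K (Suc d))"
  shows "well_placed n K s u"
proof -
  obtain i w where iw: "i \<le> h (n + Suc d) - K" "w \<in> W (n + Suc d)" "s = starts n K (Suc d) i" "u = take K (drop i w)"
    using su by (auto simp: set_sample_pmf sample_def samples_def simp del: add_Suc_right)
  have lu: "length u = K" using iw hK W_length[OF iw(2)] by simp
  have b: "i + b \<in> free_starts n (Suc d)" "b + h n \<le> K" if "b \<in> s" for b
    using that iw(3) by (simp_all add: starts_def del: free_starts.simps)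
  have "block n u b \<in> V n" if "b \<in> s" for b
    unfolding iw(4) block_take_drop[OF b(2)[OF that]] by (rule free_block_in_V[OF iw(2) b(1)[OF that]])
  moreover have "b + h n \<le> b'" if "b \<in> s" "b' \<in> s" "b < b'" for b b'
  proof -
    have "h n dvd i + b" "h n dvd i + b'" using free_starts_bound b(1) that by blast+
    then have "h n dvd (i + b') - (i + b)" by (rule dvd_diff_nat[rotated])
    then have "h n dvd b' - b" by simp
    then show ?thesis using that(3) dvd_imp_le[of "h n" "b' - b"] by simp
  qed
  moreover have "s \<subseteq> {..<K}" using b(2) h_pos[of n] by fastforce
  ultimately show ?thesis using lu b(2) by (auto simp: well_placed_def)
qed

lemma set_sample_states: "K \<le> h (n + d) \<Longrightarrow> set_pmf (sample_pmf n K d) \<subseteq> window_states K"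
proof
  fix x assume hK: "K \<le> h (n + d)" and "x \<in> set_pmf (sample_pmf n K d)"
  then obtain i w where iw: "i \<le> h (n + d) - K" "w \<in> W (n + d)" "x = (starts n K d i, take K (drop i w))"
    by (auto simp: set_sample_pmf sample_def samples_def)
  have "starts n K d i \<subseteq> {..<K}" using h_pos[of n] by (auto simp: starts_def)
  then show "x \<in> window_states K" using iw hK W_length[OF iw(2)] by (simp add: window_states_def)
qed

text \<open>Once the place i of the window is fixed, the set of positions is determined and the
  count for words with prescribed free blocks applies to the translate of s by i. The bound is then
  summed over the places i that produce s.\<close>

lemma sample_density:
  assumes \<tau>2: "\<And>l. n \<le> l \<Longrightarrow> \<tau> l \<le> 1 / 2" and K: "K = L * h n"
  shows "measure_pmf.prob (sample_pmf n K d) {(s', u). s' = s \<and> (\<forall>b\<in>s. block n u b = c b)} * real (card (V n)) ^ card s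
    \<le> measure_pmf.prob (sample_pmf n K d) {(s', u). s' = s} * exp ((real L + 2) * total_cost n)"
proof -
  let ?I = "{i. i \<le> h (n + d) - K \<and> starts n K d i = s}"
  let ?F = "\<lambda>i. {w \<in> W (n + d). \<forall>b\<in>s. block n w (i + b) = c b}"
  let ?C = "exp ((real L + 2) * total_cost n)"
  let ?Z = "{(s', u). s' = s \<and> (\<forall>b\<in>s. block n u b = c b)}"
  have finI: "finite ?I" by simp
  have "{x \<in> samples n K d. sample n K d x \<in> ?Z} = (SIGMA i:?I. ?F i)"
  proof -
    have "(\<forall>b\<in>s. block n (take K (drop i w)) b = c b) \<longleftrightarrow> (\<forall>b\<in>s. block n w (i + b) = c b)"
      if "starts n K d i = s" for i w
      using that block_take_drop by (auto simp: starts_def)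
    then show ?thesis by (auto simp: samples_def sample_def)
  qed
  then have c1: "card {x \<in> samples n K d. sample n K d x \<in> ?Z} = (\<Sum>i\<in>?I. card (?F i))"
    using finite_W by (simp add: card_SigmaI)
  have "{x \<in> samples n K d. sample n K d x \<in> {(s', u). s' = s}} = ?I \<times> W (n + d)"
    by (auto simp: samples_def sample_def)
  then have c2: "card {x \<in> samples n K d. sample n K d x \<in> {(s', u). s' = s}} = card ?I * N (n + d)"
    by (simp add: card_cartesian_product)
  have each: "real (card (?F i)) * real (card (V n)) ^ card s \<le> real (N (n + d)) * ?C" if i: "i \<in> ?I" for i
  proof -
    let ?D = "(+) i ` s"
    have s: "i + b \<in> free_starts n d" "b + h n \<le> K" if "b \<in> s" for b
      using i that by (auto simp: starts_def)
    have D: "?D \<subseteq> free_starts n d" using s(1) by blast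
    have DK: "?D \<subseteq> {i..<i + K}" using s(2) h_pos[of n] by fastforce
    have "?F i = {w \<in> W (n + d). \<forall>b\<in>?D. block n w b = c (b - i)}" by auto
    moreover have "card ?D = card s" by (rule card_image) simp
    moreover have "real (card {w \<in> W (n + d). \<forall>b\<in>?D. block n w b = c (b - i)}) * real (card (V n)) ^ card ?D
        \<le> real (N (n + d)) * exp (cost n d ?D)"
    proof (rule free_block_density[OF _ D])
      fix l assume "n \<le> l"
      then have "\<tau> l \<le> 1 / 2" by (rule \<tau>2)
      then show "\<tau> l < 1" by simp
    qed
    moreover have "cost n d ?D \<le> (real L + 2) * total_cost n"
      using cost_window[of n, OF \<tau>2 DK, of d] K h_pos[of n] by simp
    then have "real (N (n + d)) * exp (cost n d ?D) \<le> real (N (n + d)) * ?C" by (intro mult_left_mono) auto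
    ultimately show ?thesis by simp
  qed
  have "(\<Sum>i\<in>?I. real (card (?F i)) * real (card (V n)) ^ card s) \<le> (\<Sum>i\<in>?I. real (N (n + d)) * ?C)"
    by (rule sum_mono) (rule each)
  then have "real (\<Sum>i\<in>?I. card (?F i)) * real (card (V n)) ^ card s \<le> real (card ?I * N (n + d)) * ?C"
    by (simp add: sum_distrib_right mult.assoc)
  then have "real (\<Sum>i\<in>?I. card (?F i)) * real (card (V n)) ^ card s / real (card (samples n K d))
      \<le> real (card ?I * N (n + d)) * ?C / real (card (samples n K d))"
    by (intro divide_right_mono) auto
  then show ?thesis unfolding prob_sample_pmf c1 c2 by simp
qed

text \<open>Pairs of a window and a free block in it are counted twice. A free start at distance at
  least K from both ends of the word belongs to \<open>K - h n + 1\<close> windows, and at most 2 K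
  starts are closer to an end.\<close>

lemma sample_starts:
  assumes hK: "h n \<le> K" "K \<le> h (n + d)"
  shows "measure_pmf.expectation (sample_pmf n K d) (\<lambda>x. real (card (fst x)))
    \<ge> (real (card (free_starts n d)) - 2 * real K) * (real K - real (h n) + 1) / (real (h (n + d)) - real K + 1)"
proof -
  let ?H = "h (n + d)"
  let ?f = "free_starts n d"
  let ?S = "\<lambda>i. {b \<in> ?f. i \<le> b \<and> b + h n \<le> i + K}"
  define f' where "f' = {b \<in> ?f. K \<le> b \<and> b \<le> ?H - K}"
  have cS: "card (starts n K d i) = card (?S i)" for i
  proof -
    have "?S i = (+) i ` starts n K d i"
    proof (intro equalityI subsetI)
      fix b assume "b \<in> ?S i"
      then have "b = i + (b - i)" "b - i \<in> starts n K d i" by (auto simp: starts_def)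
      then show "b \<in> (+) i ` starts n K d i" by blast
    qed (auto simp: starts_def)
    then show ?thesis by (simp add: card_image)
  qed
  have f'fin: "finite f'" using finite_free_starts by (simp add: f'_def)
  have "card ?f \<le> card (f' \<union> ({..<K} \<union> {?H - K<..<?H}))"
    using f'fin free_starts_less[of _ n d] by (intro card_mono) (auto simp: f'_def)
  also have "\<dots> \<le> card f' + (card {..<K} + card {?H - K<..<?H})"
    by (meson add_left_mono card_Un_le le_trans)
  also have "\<dots> \<le> card f' + 2 * K" by simp
  finally have f': "real (card ?f) - 2 * real K \<le> real (card f')" by linarith
  have "card (f' \<times> {..K - h n}) \<le> card (SIGMA i:{..?H - K}. ?S i)"
  proof (rule card_inj_on_le[of "\<lambda>(b, t). (b - t, b)"])
    show "inj_on (\<lambda>(b, t). (b - t, b)) (f' \<times> {..K - h n})"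
      by (rule inj_onI) (auto simp: f'_def)
    show "(\<lambda>(b, t). (b - t, b)) ` (f' \<times> {..K - h n}) \<subseteq> (SIGMA i:{..?H - K}. ?S i)"
      using hK by (auto simp: f'_def)
    show "finite (SIGMA i:{..?H - K}. ?S i)" using finite_free_starts by auto
  qed
  then have le: "card f' * (K - h n + 1) \<le> (\<Sum>i\<in>{..?H - K}. card (?S i))"
    using finite_free_starts by (simp add: card_cartesian_product card_SigmaI)
  have "measure_pmf.expectation (sample_pmf n K d) (\<lambda>x. real (card (fst x)))
      = measure_pmf.expectation (pmf_of_set (samples n K d)) (\<lambda>(i, w). real (card (?S i)))"
    unfolding sample_pmf_def integral_map_pmf by (simp add: sample_def split_def cS)
  also have "\<dots> = (\<Sum>(i, w)\<in>samples n K d. real (card (?S i))) / real (card (samples n K d))"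
    using samples_finite by (simp add: integral_pmf_of_set)
  also have "(\<Sum>(i, w)\<in>samples n K d. real (card (?S i))) = real (\<Sum>i\<in>{..?H - K}. card (?S i)) * real (N (n + d))"
    unfolding samples_def by (simp add: sum.cartesian_product[symmetric] sum_distrib_left mult.commute)
  also have "\<dots> / real (card (samples n K d)) = real (\<Sum>i\<in>{..?H - K}. card (?S i)) / (real ?H - real K + 1)"
  proof -
    have "real (card (samples n K d)) = (real ?H - real K + 1) * real (N (n + d))"
      using hK by (simp only: card_samples of_nat_mult of_nat_add of_nat_diff of_nat_1)
    then show ?thesis using N_gt[of "n + d"] by simp
  qed
  also have "\<dots> \<ge> real (card f' * (K - h n + 1)) / (real ?H - real K + 1)"
  proof (rule divide_right_mono)
    show "real (card f' * (K - h n + 1)) \<le> real (\<Sum>i\<in>{..?H - K}. card (?S i))"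
      using le by (simp only: of_nat_le_iff)
    show "0 \<le> real ?H - real K + 1" using hK by simp
  qed
  finally have "real (card f') * (real K - real (h n) + 1) / (real ?H - real K + 1)
      \<le> measure_pmf.expectation (sample_pmf n K d) (\<lambda>x. real (card (fst x)))"
    using hK by (simp only: of_nat_mult of_nat_add of_nat_diff of_nat_1)
  moreover have "(real (card ?f) - 2 * real K) * (real K - real (h n) + 1) / (real ?H - real K + 1)
      \<le> real (card f') * (real K - real (h n) + 1) / (real ?H - real K + 1)"
    using f' hK by (intro divide_right_mono mult_right_mono) auto
  ultimately show ?thesis by linarith
qed

lemma filterlim_h: "filterlim (\<lambda>d. real (h (n + d))) at_top sequentially"
proof -
  have "filterlim (\<lambda>d. (2::real) ^ d) at_top sequentially"
    by real_asymp
  moreover have "\<forall>\<^sub>F d in sequentially. (2::real) ^ d \<le> real (h (n + d))"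
  proof (intro always_eventually allI)
    fix d
    have "(2::nat) ^ d \<le> 2 ^ (n + d)" by (intro power_increasing) auto
    then have "2 ^ d \<le> h (n + d)" using h_ge[of "n + d"] by linarith
    then show "(2::real) ^ d \<le> real (h (n + d))" by (metis of_nat_le_iff of_nat_numeral of_nat_power)
  qed
  ultimately show ?thesis by (rule filterlim_at_top_mono)
qed

text \<open>The frequency hypothesis concerns one word per level. Applied to the words with the most
  and with the fewest occurrences of u, it encloses the average over all words of the level.\<close>

lemma sample_word_limit:
  assumes u: "length u = K"
  shows "(\<lambda>d. measure_pmf.prob (sample_pmf n K d) {(s, u'). u' = u}) \<longlonglongrightarrow> pmf (law \<mu> (window 0 K)) u"
proof -
  let ?c = "pmf (law \<mu> (window 0 K)) u"
  let ?o = "\<lambda>w. real (occurrences u w)"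
  have ext: "\<exists>w\<in>W m. \<forall>w'\<in>W m. ?o w' \<le> ?o w" "\<exists>w\<in>W m. \<forall>w'\<in>W m. ?o w \<le> ?o w'" for m
  proof -
    have f: "finite (?o ` W m)" "?o ` W m \<noteq> {}" using finite_W W_nonempty by auto
    show "\<exists>w\<in>W m. \<forall>w'\<in>W m. ?o w' \<le> ?o w"
      using Max_in[OF f] Max_ge[OF f(1)] by (metis (no_types, lifting) imageE imageI)
    show "\<exists>w\<in>W m. \<forall>w'\<in>W m. ?o w \<le> ?o w'"
      using Min_in[OF f] Min_le[OF f(1)] by (metis (no_types, lifting) imageE imageI)
  qed
  obtain wM where wM: "\<And>m. wM m \<in> W m" "\<And>m w. w \<in> W m \<Longrightarrow> ?o w \<le> ?o (wM m)" using ext(1) by metis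
  obtain wm where wm: "\<And>m. wm m \<in> W m" "\<And>m w. w \<in> W m \<Longrightarrow> ?o (wm m) \<le> ?o w" using ext(2) by metis
  let ?avg = "\<lambda>d. (\<Sum>w\<in>W (n + d). ?o w) / real (N (n + d)) / real (h (n + d))"
  have "?avg \<longlonglongrightarrow> ?c"
  proof (rule tendsto_sandwich)
    show "(\<lambda>d. ?o (wm (n + d)) / real (h (n + d))) \<longlonglongrightarrow> ?c"
      using LIMSEQ_ignore_initial_segment[OF frequency_limit[of wm u, OF wm(1)], of n] W_length[OF wm(1)]
      by (simp add: u add.commute)
    show "(\<lambda>d. ?o (wM (n + d)) / real (h (n + d))) \<longlonglongrightarrow> ?c"
      using LIMSEQ_ignore_initial_segment[OF frequency_limit[of wM u, OF wM(1)], of n] W_length[OF wM(1)]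
      by (simp add: u add.commute)
    have Np: "real (N m) > 0" for m using N_gt[of m] by simp
    show "\<forall>\<^sub>F d in sequentially. ?o (wm (n + d)) / real (h (n + d)) \<le> ?avg d"
    proof (intro always_eventually allI divide_right_mono)
      fix d
      have "real (N (n + d)) * ?o (wm (n + d)) \<le> (\<Sum>w\<in>W (n + d). ?o w)"
        by (rule sum_bounded_below) (rule wm(2))
      then show "?o (wm (n + d)) \<le> (\<Sum>w\<in>W (n + d). ?o w) / real (N (n + d))"
        using Np[of "n + d"] by (simp add: field_simps)
    qed simp
    show "\<forall>\<^sub>F d in sequentially. ?avg d \<le> ?o (wM (n + d)) / real (h (n + d))"
    proof (intro always_eventually allI divide_right_mono)
      fix d
      have "(\<Sum>w\<in>W (n + d). ?o w) \<le> real (N (n + d)) * ?o (wM (n + d))"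
        by (rule sum_bounded_above) (rule wM(2))
      then show "(\<Sum>w\<in>W (n + d). ?o w) / real (N (n + d)) \<le> ?o (wM (n + d))"
        using Np[of "n + d"] by (simp add: field_simps)
    qed simp
  qed
  \<comment> \<open>Frequencies are normalised by the length of the word, sampling by the number of
    places of the window.\<close>
  moreover have "(\<lambda>d. real (h (n + d)) / (real (h (n + d)) - real K + 1)) \<longlonglongrightarrow> 1"
  proof -
    have "((\<lambda>t::real. t / (t - real K + 1)) \<longlongrightarrow> 1) at_top" by real_asymp
    then show ?thesis using filterlim_compose filterlim_h by blast
  qed
  ultimately have "(\<lambda>d. ?avg d * (real (h (n + d)) / (real (h (n + d)) - real K + 1))) \<longlonglongrightarrow> ?c * 1"
    by (rule tendsto_mult)
  moreover have "\<forall>\<^sub>F d in sequentially. ?avg d * (real (h (n + d)) / (real (h (n + d)) - real K + 1))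
      = measure_pmf.prob (sample_pmf n K d) {(s, u'). u' = u}"
  proof -
    have "\<forall>\<^sub>F d in sequentially. real K \<le> real (h (n + d))"
      using filterlim_h[of n, unfolded filterlim_at_top, rule_format, of "real K"] .
    then show ?thesis
    proof (rule eventually_mono)
      fix d assume "real K \<le> real (h (n + d))"
      then have hK: "K \<le> h (n + d)" by simp
      have "{x \<in> samples n K d. sample n K d x \<in> {(s, u'). u' = u}}
          = (\<lambda>(w, i). (i, w)) ` (SIGMA w:W (n + d). {i. i + length u \<le> length w \<and> take (length u) (drop i w) = u})"
        using hK W_length by (force simp: samples_def sample_def u image_iff)
      then have "card {x \<in> samples n K d. sample n K d x \<in> {(s, u'). u' = u}}
          = card (SIGMA w:W (n + d). {i. i + length u \<le> length w \<and> take (length u) (drop i w) = u})"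
        by (simp add: card_image inj_on_def split_def prod_eq_iff)
      also have "\<dots> = (\<Sum>w\<in>W (n + d). occurrences u w)"
        unfolding occurrences_def
        by (intro card_SigmaI finite_W ballI, rule finite_subset[of _ "{..h (n + d)}"]) (auto dest: W_length)
      finally have cc: "card {x \<in> samples n K d. sample n K d x \<in> {(s, u'). u' = u}} = (\<Sum>w\<in>W (n + d). occurrences u w)" .
      have "measure_pmf.prob (sample_pmf n K d) {(s, u'). u' = u}
          = (\<Sum>w\<in>W (n + d). ?o w) / (real (h (n + d) - K + 1) * real (N (n + d)))"
        unfolding prob_sample_pmf card_samples of_nat_mult cc of_nat_sum ..
      then show "?avg d * (real (h (n + d)) / (real (h (n + d)) - real K + 1))
          = measure_pmf.prob (sample_pmf n K d) {(s, u'). u' = u}"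
        using hK h_pos[of "n + d"] by (simp add: of_nat_diff add.commute)
    qed
  qed
  ultimately show ?thesis by (simp add: tendsto_cong)
qed

text \<open>For large d all sampling laws live on the same finite set of states, so a subsequence
  converges pointwise. The required properties are inequalities between finite sums or statements
  about supports, hence survive the limit, and convergence of word frequencies identifies the second
  marginal.\<close>

theorem window_law:
  assumes \<tau>2: "\<And>l. n \<le> l \<Longrightarrow> \<tau> l \<le> 1 / 2" and K: "K = L * h n" and L: "L > 0"
  obtains \<kappa> :: "(nat set \<times> 'a list) pmf"
  where "finite (set_pmf \<kappa>)" "map_pmf snd \<kappa> = law \<mu> (window 0 K)"
    "\<And>s u. (s, u) \<in> set_pmf \<kappa> \<Longrightarrow> well_placed n K s u"
    "\<And>s c. measure_pmf.prob \<kappa> {(s', u). s' = s \<and> (\<forall>b\<in>s. block n u b = c b)} * real (card (V n)) ^ card s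
      \<le> measure_pmf.prob \<kappa> {(s', u). s' = s} * exp ((real L + 2) * total_cost n)"
    "measure_pmf.expectation \<kappa> (\<lambda>x. real (card (fst x))) \<ge> (1 - 1 / 2 ^ n) * (real L - 1)"
proof -
  let ?X = "window_states K"
  let ?p = "\<lambda>d x. pmf (sample_pmf n K d) x"
  have finX: "finite ?X" by (rule finite_window_states)
  obtain d0 where d0: "\<And>d. d \<ge> d0 \<Longrightarrow> K \<le> h (n + d)"
  proof -
    have "\<forall>\<^sub>F d in sequentially. real K \<le> real (h (n + d))"
      using filterlim_h[of n, unfolded filterlim_at_top, rule_format, of "real K"] .
    then show thesis using that by (auto simp: eventually_sequentially)
  qed
  have "\<exists>r. strict_mono r \<and> (\<forall>x\<in>?X. convergent (\<lambda>d. ?p (r d) x))"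
    by (intro finite_diagonal finX) (simp add: pmf_le_1)
  then obtain r0 where r0: "strict_mono r0" "\<forall>x\<in>?X. convergent (\<lambda>d. ?p (r0 d) x)" by blast
  \<comment> \<open>The shift makes the window fit into the word and keeps the number of levels
    positive, as the free blocks require.\<close>
  define r where "r d = r0 (d + Suc d0)" for d
  have rge: "r d \<ge> Suc d0" for d using strict_mono_imp_increasing[OF r0(1), of "d + Suc d0"] by (simp add: r_def)
  have rmono: "strict_mono r" using r0(1) by (simp add: r_def strict_mono_def)
  have hK: "K \<le> h (n + r d)" for d using d0[of "r d"] rge[of d] by simp
  have sub: "set_pmf (sample_pmf n K (r d)) \<subseteq> ?X" for d by (rule set_sample_states[OF hK])
  define g where "g x = (if x \<in> ?X then lim (\<lambda>d. ?p (r d) x) else 0)" for x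
  have g: "(\<lambda>d. ?p (r d) x) \<longlonglongrightarrow> g x" for x
  proof (cases "x \<in> ?X")
    case True
    then have "convergent (\<lambda>d. ?p (r0 d) x)" using r0(2) by blast
    then have "convergent (\<lambda>d. ?p (r d) x)"
      unfolding r_def convergent_def using LIMSEQ_ignore_initial_segment by blast
    then show ?thesis using True by (simp add: g_def convergent_LIMSEQ_iff)
  next
    case False
    have "?p (r d) x = 0" for d
      using False subsetD[OF sub[of d], of x] by (auto simp: set_pmf_iff)
    then show ?thesis using False by (simp add: g_def)
  qed
  have g0: "g x \<ge> 0" for x by (rule LIMSEQ_le_const[OF g]) auto
  have "(\<lambda>d. \<Sum>x\<in>?X. ?p (r d) x) \<longlonglongrightarrow> sum g ?X" by (intro tendsto_sum g)
  moreover have "(\<Sum>x\<in>?X. ?p (r d) x) = 1" for d by (intro sum_pmf_eq_1 finX sub)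
  ultimately have "sum g ?X = 1" by (simp add: LIMSEQ_const_iff)
  then have "\<exists>p. \<forall>x. pmf p x = g x"
    using g0 by (intro ex_pmf_finite[OF finX]) (auto simp: g_def)
  then obtain \<kappa> where \<kappa>: "\<And>x. pmf \<kappa> x = g x" by blast
  have s\<kappa>: "set_pmf \<kappa> \<subseteq> ?X" by (auto simp: set_pmf_iff \<kappa> g_def split: if_splits)
  have fin\<kappa>: "finite (set_pmf \<kappa>)" using s\<kappa> finX finite_subset by blast
  have lim: "(\<lambda>d. measure_pmf.prob (sample_pmf n K (r d)) Z) \<longlonglongrightarrow> measure_pmf.prob \<kappa> Z" for Z
    unfolding measure_pmf_finite_support[OF finX sub] measure_pmf_finite_support[OF finX s\<kappa>] \<kappa>
    by (intro tendsto_sum g)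
  have 1: "map_pmf snd \<kappa> = law \<mu> (window 0 K)"
  proof (rule pmf_eqI)
    fix u :: "'a list"
    have eq: "pmf (map_pmf snd \<kappa>) u = measure_pmf.prob \<kappa> {(s, u'). u' = u}"
      unfolding pmf_map by (intro arg_cong[where f = "measure_pmf.prob \<kappa>"]) auto
    show "pmf (map_pmf snd \<kappa>) u = pmf (law \<mu> (window 0 K)) u"
    proof (cases "length u = K")
      case True
      have "(\<lambda>d. measure_pmf.prob (sample_pmf n K (r d)) {(s, u'). u' = u}) \<longlonglongrightarrow> pmf (law \<mu> (window 0 K)) u"
        using LIMSEQ_subseq_LIMSEQ[OF sample_word_limit[OF True] rmono] by (simp add: o_def)
      then show ?thesis unfolding eq using LIMSEQ_unique lim by blast
    next
      case False
      have "u \<notin> set_pmf (law \<mu> (window 0 K))" using set_law[OF simple_window, of 0 K] False by auto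
      moreover have "u \<notin> set_pmf (map_pmf snd \<kappa>)" using s\<kappa> False by (auto simp: window_states_def)
      ultimately have "pmf (map_pmf snd \<kappa>) u = 0" "pmf (law \<mu> (window 0 K)) u = 0"
        by (simp_all only: set_pmf_iff not_not)
      then show ?thesis by simp
    qed
  qed
  have 2: "well_placed n K s u" if "(s, u) \<in> set_pmf \<kappa>" for s u
  proof -
    have "g (s, u) \<noteq> 0" using that by (simp add: set_pmf_iff \<kappa>)
    \<comment> \<open>A state of positive mass in the limit has positive mass in some sampling
      law.\<close>
    have "\<exists>d. ?p (r d) (s, u) \<noteq> 0"
    proof (rule ccontr)
      assume "\<not> ?thesis"
      then have "(\<lambda>d. ?p (r d) (s, u)) = (\<lambda>d. 0)" by auto
      then show False using g[of "(s, u)"] \<open>g (s, u) \<noteq> 0\<close> by (simp add: LIMSEQ_const_iff)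
    qed
    then obtain d where "(s, u) \<in> set_pmf (sample_pmf n K (r d))" by (auto simp: set_pmf_iff)
    moreover obtain d' where "r d = Suc d'" using rge[of d] by (cases "r d") auto
    ultimately show ?thesis using sample_well_placed[of K n d' s u] hK[of d] by simp
  qed
  have 3: "measure_pmf.prob \<kappa> {(s', u). s' = s \<and> (\<forall>b\<in>s. block n u b = c b)} * real (card (V n)) ^ card s
      \<le> measure_pmf.prob \<kappa> {(s', u). s' = s} * exp ((real L + 2) * total_cost n)" for s c
    by (rule LIMSEQ_le[OF tendsto_mult_right[OF lim] tendsto_mult_right[OF lim]])
      (use sample_density[OF \<tau>2 K] in blast)
  have 4: "measure_pmf.expectation \<kappa> (\<lambda>x. real (card (fst x))) \<ge> (1 - 1 / 2 ^ n) * (real L - 1)"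
  proof -
    have "(\<lambda>d. measure_pmf.expectation (sample_pmf n K (r d)) (\<lambda>x. real (card (fst x))))
        \<longlonglongrightarrow> measure_pmf.expectation \<kappa> (\<lambda>x. real (card (fst x)))"
      unfolding expectation_finite_support[OF finX sub] expectation_finite_support[OF finX s\<kappa>] \<kappa>
      by (intro tendsto_sum tendsto_mult g tendsto_const)
    \<comment> \<open>As the word grows, the boundary term 2 K and the correction to its length
      disappear; the density of free starts times the number of windows per start remains.\<close>
    moreover have "(\<lambda>d. (real (h (n + r d)) / real (h n) * (1 - 1 / 2 ^ n) - 2 * real K) * (real K - real (h n) + 1) / (real (h (n + r d)) - real K + 1))
        \<longlonglongrightarrow> (1 - 1 / 2 ^ n) / real (h n) * (real K - real (h n) + 1)"
    proof -
      have "((\<lambda>t::real. (t * A - B) * C / (t - D + 1)) \<longlongrightarrow> A * C) at_top" for A B C D :: real by real_asymp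
      then have "((\<lambda>t::real. (t * ((1 - 1 / 2 ^ n) / real (h n)) - 2 * real K) * (real K - real (h n) + 1) / (t - real K + 1))
        \<longlongrightarrow> (1 - 1 / 2 ^ n) / real (h n) * (real K - real (h n) + 1)) at_top" .
      moreover have "filterlim (\<lambda>d. real (h (n + r d))) at_top sequentially"
        using filterlim_compose[OF filterlim_h filterlim_subseq[OF rmono]] .
      ultimately have "(\<lambda>d. (real (h (n + r d)) * ((1 - 1 / 2 ^ n) / real (h n)) - 2 * real K) * (real K - real (h n) + 1) / (real (h (n + r d)) - real K + 1))
        \<longlonglongrightarrow> (1 - 1 / 2 ^ n) / real (h n) * (real K - real (h n) + 1)"
        by (rule filterlim_compose)
      then show ?thesis by (simp add: mult.commute)
    qed
    moreover have "(real (h (n + r d)) / real (h n) * (1 - 1 / 2 ^ n) - 2 * real K) * (real K - real (h n) + 1) / (real (h (n + r d)) - real K + 1)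
        \<le> measure_pmf.expectation (sample_pmf n K (r d)) (\<lambda>x. real (card (fst x)))" for d
    proof -
      have hnK: "h n \<le> K" using K L by simp
      have "real (h (n + r d)) / real (h n) * (1 - 1 / 2 ^ n) \<le> real (h (n + r d)) / real (h n) * (1 - (\<Sum>l<r d. \<epsilon> (n + l)))"
        using sum_eps_le[of n "r d"] by (intro mult_left_mono) auto
      also have "\<dots> \<le> real (card (free_starts n (r d)))" by (rule card_free_starts)
      finally have "(real (h (n + r d)) / real (h n) * (1 - 1 / 2 ^ n) - 2 * real K) * (real K - real (h n) + 1) / (real (h (n + r d)) - real K + 1)
          \<le> (real (card (free_starts n (r d))) - 2 * real K) * (real K - real (h n) + 1) / (real (h (n + r d)) - real K + 1)"
        using hK[of d] hnK by (intro divide_right_mono mult_right_mono) auto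
      also have "\<dots> \<le> measure_pmf.expectation (sample_pmf n K (r d)) (\<lambda>x. real (card (fst x)))"
        by (rule sample_starts[OF hnK hK])
      finally show ?thesis .
    qed
    ultimately have "(1 - 1 / 2 ^ n) / real (h n) * (real K - real (h n) + 1) \<le> measure_pmf.expectation \<kappa> (\<lambda>x. real (card (fst x)))"
      by (intro LIMSEQ_le) auto
    moreover have "(1 - 1 / 2 ^ n) * (real L - 1) \<le> (1 - 1 / 2 ^ n) / real (h n) * (real K - real (h n) + 1)"
    proof -
      have "(1 - 1 / 2 ^ n) * (real L - 1) = (1 - 1 / 2 ^ n) / real (h n) * (real K - real (h n))"
        using h_pos[of n] by (simp add: K field_simps)
      also have "\<dots> \<le> (1 - 1 / 2 ^ n) / real (h n) * (real K - real (h n) + 1)"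
        by (intro mult_left_mono divide_nonneg_nonneg) auto
      finally show ?thesis .
    qed
    ultimately show ?thesis by linarith
  qed
  show thesis by (rule that[OF fin\<kappa> 1 2 3 4])
qed

end

section \<open>Loosely Bernoulli\<close>

text \<open>Write s for the variable drawn from the kernel \<zeta> and v for \<open>f s u\<close>.
  Given u, the variable s is independent of \<alpha>, so I(\<alpha>; v | s) \<le> I(\<alpha>; (v,
  s)) \<le> I(\<alpha>; (u, s)) = I(\<alpha>; u). Conditioning on \<alpha> in addition to s
  therefore lowers the entropy of v by at most the mutual information of \<alpha> and u.\<close>

lemma entropy_side_information:
  fixes q :: "'r pmf" and \<alpha> :: "'r \<Rightarrow> 'c" and u :: "'r \<Rightarrow> 'u" and \<zeta> :: "'u \<Rightarrow> 's pmf" and f :: "'s \<Rightarrow> 'u \<Rightarrow> 'v"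
  assumes finq: "finite (set_pmf q)" and fin\<zeta>: "\<And>\<rho>. \<rho> \<in> set_pmf q \<Longrightarrow> finite (set_pmf (\<zeta> (u \<rho>)))"
    and J: "J = bind_pmf q (\<lambda>\<rho>. map_pmf (Pair \<rho>) (\<zeta> (u \<rho>)))"
  shows "ent (map_pmf (\<lambda>j. (snd j, f (snd j) (u (fst j)))) J) - ent (map_pmf snd J) - mutual \<alpha> u q
    \<le> ent (map_pmf (\<lambda>j. ((\<alpha> (fst j), snd j), f (snd j) (u (fst j)))) J) - ent (map_pmf (\<lambda>j. (\<alpha> (fst j), snd j)) J)"
proof -
  have finJ: "finite (set_pmf J)" using finq fin\<zeta> by (simp add: J)
  let ?X = "measure_pmf.expectation q (\<lambda>\<rho>. ent (\<zeta> (u \<rho>)))"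
  \<comment> \<open>Any \<beta> that determines u leaves the same conditional entropy
    \<open>?X\<close> for s. It is used with u itself and with the pair (\<alpha>, u), and
    \<open>?X\<close> cancels.\<close>
  have X: "ent (map_pmf (\<lambda>j. (\<beta> (fst j), snd j)) J) = ent (map_pmf \<beta> q) + ?X"
    if \<beta>: "\<And>\<rho>. u \<rho> = w (\<beta> \<rho>)" for \<beta> :: "'r \<Rightarrow> 'y" and w
  proof -
    have fin\<beta>: "finite (set_pmf (map_pmf \<beta> q))" using finq by simp
    have fin\<zeta>\<beta>: "finite (set_pmf (\<zeta> (w b)))" if "b \<in> set_pmf (map_pmf \<beta> q)" for b
      using that fin\<zeta> by (auto simp: \<beta>)
    have "map_pmf (\<lambda>j. (\<beta> (fst j), snd j)) J = bind_pmf (map_pmf \<beta> q) (\<lambda>b. map_pmf (Pair b) (\<zeta> (w b)))"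
      by (simp add: J map_bind_pmf pmf.map_comp o_def bind_map_pmf \<beta>)
    moreover have "ent (bind_pmf (map_pmf \<beta> q) (\<lambda>b. map_pmf (Pair b) (\<zeta> (w b))))
        = ent (map_pmf \<beta> q) + measure_pmf.expectation (map_pmf \<beta> q) (\<lambda>b. ent (\<zeta> (w b)))"
      unfolding expectation_finite_pmf[OF fin\<beta>] by (rule ent_bind_Pair[of _ "\<lambda>b. \<zeta> (w b)", OF fin\<beta> fin\<zeta>\<beta>])
    ultimately show ?thesis by (simp add: integral_map_pmf \<beta>)
  qed
  let ?a = "\<lambda>j. \<alpha> (fst j)" and ?u = "\<lambda>j. u (fst j)" and ?v = "\<lambda>j. f (snd j) (u (fst j))"
  have 1: "ent (map_pmf (\<lambda>j. (?a j, ?u j, snd j, ?v j)) J) = ent (map_pmf (\<lambda>j. ((?a j, ?u j), snd j)) J)"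
    "ent (map_pmf (\<lambda>j. (?u j, snd j, ?v j)) J) = ent (map_pmf (\<lambda>j. (?u j, snd j)) J)"
    "ent (map_pmf (\<lambda>j. (?a j, snd j, ?v j)) J) = ent (map_pmf (\<lambda>j. ((?a j, snd j), ?v j)) J)"
    by (intro ent_map_cong_inj finJ; auto)+
  have 2: "map_pmf ?a J = map_pmf \<alpha> q"
    by (simp add: J map_bind_pmf pmf.map_comp o_def map_pmf_const bind_return_pmf' map_pmf_def[symmetric])
  show ?thesis
    using ent_submodular[OF finJ, of ?a ?u "\<lambda>j. (snd j, ?v j)"] ent_subadditive[OF finJ, of ?a snd]
      X[of snd "\<lambda>\<rho>. (\<alpha> \<rho>, u \<rho>)"] X[of "\<lambda>x. x" u] 1 2
    by (simp add: mutual_def)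
qed

text \<open>The hypothesis bounds the conditional probability of v given s by
  \<open>C / N ^ F s\<close>; the claim is the average of its negative logarithm.\<close>

lemma ent_ge_of_density:
  assumes fin: "finite (set_pmf p)" and N: "N > 0" and C: "C > 0"
    and d: "\<And>s v. (s, v) \<in> set_pmf p \<Longrightarrow> pmf p (s, v) * N ^ F s \<le> pmf (map_pmf fst p) s * C"
  shows "ent p - ent (map_pmf fst p) \<ge> measure_pmf.expectation p (\<lambda>x. real (F (fst x))) * ln N - ln C"
proof -
  have int: "integrable (measure_pmf p) g" for g :: "_ \<Rightarrow> real"
    by (rule integrable_measure_pmf_finite[OF fin])
  have "measure_pmf.expectation p (\<lambda>x. real (F (fst x)) * ln N - ln C)
    \<le> measure_pmf.expectation p (\<lambda>x. - ln (pmf p x) - - ln (pmf (map_pmf fst p) (fst x)))"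
  proof (intro integral_mono_AE int AE_pmfI)
    fix x assume x: "x \<in> set_pmf p"
    have pos: "pmf p x > 0" "pmf (map_pmf fst p) (fst x) > 0"
      using pmf_positive[OF x] pmf_map_pos[OF x] by auto
    have "pmf p x * N ^ F (fst x) \<le> pmf (map_pmf fst p) (fst x) * C"
      using d[of "fst x" "snd x"] x by simp
    then have "ln (pmf p x * N ^ F (fst x)) \<le> ln (pmf (map_pmf fst p) (fst x) * C)"
      using pos N C by (subst ln_le_cancel_iff) auto
    then show "real (F (fst x)) * ln N - ln C \<le> - ln (pmf p x) - - ln (pmf (map_pmf fst p) (fst x))"
      using pos N C by (simp add: ln_mult ln_realpow)
  qed
  then show ?thesis
    unfolding ent_map[OF fin] ent_expectation[OF fin] by (simp add: int)
qed

context E_system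
begin

section \<open>The joint process of labels and symbols\<close>

definition process :: "(int \<Rightarrow> 'a) set set \<Rightarrow> nat \<Rightarrow> (int \<Rightarrow> 'a) \<Rightarrow> ((int \<Rightarrow> 'a) set \<times> 'a) list" where
  "process P r x = map (\<lambda>i. (cell P ((left_shift ^^ i) x), x (int i))) [0..<r]"

lemma length_process [simp]: "length (process P r x) = r"
  by (simp add: process_def)

lemma nth_process: "i < r \<Longrightarrow> process P r x ! i = (cell P ((left_shift ^^ i) x), x (int i))"
  by (simp add: process_def)

lemma take_process: "take r (process P (r + s) x) = process P r x"
  by (rule nth_equalityI) (auto simp: nth_process)

lemma drop_process: "drop s (process P (s + r) x) = process P r ((left_shift ^^ s) x)"
proof (rule nth_equalityI)
  fix i assume i: "i < length (drop s (process P (s + r) x))"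
  have "(left_shift ^^ (s + i)) x = (left_shift ^^ i) ((left_shift ^^ s) x)"
    by (simp add: funpow_add[symmetric] add.commute del: funpow.simps flip: o_apply[of "left_shift ^^ i"])
  moreover have "x (int (s + i)) = (left_shift ^^ s) x (int i)" by (simp add: left_shift_funpow add.commute)
  ultimately show "drop s (process P (s + r) x) ! i = process P r ((left_shift ^^ s) x) ! i"
    using i by (simp add: nth_process)
qed simp

lemma simple_process:
  assumes P: "finite_measurable_partition \<mu> P"
  shows "simple_function \<mu> (process P r)"
  unfolding process_def[abs_def]
  by (intro simple_function_map_list simple_function_Pair simple_coordinate
      simple_function_comp[OF funpow_measurable simple_cell[OF P]])

lemma process_mutual_bound:
  assumes P: "finite_measurable_partition \<mu> P" and "\<delta> > 0"
  shows "\<exists>K0. \<forall>K\<ge>K0. \<forall>M. mutual (take M) (drop M) (law \<mu> (process P (M + K))) \<le> \<delta> * real K"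
proof (rule stationary_mutual_bound)
  note sp = simple_process[OF P]
  show "length xs = r" if "xs \<in> set_pmf (law \<mu> (process P r))" for r xs
    using subsetD[OF set_law[OF sp] that] by auto
  show "finite (set_pmf (law \<mu> (process P r)))" for r by (rule finite_set_law[OF sp])
  show "map_pmf (take r) (law \<mu> (process P (r + s))) = law \<mu> (process P r)" for r s
    by (simp add: map_law[OF sp] take_process)
  show "map_pmf (drop s) (law \<mu> (process P (s + r))) = law \<mu> (process P r)" for r s
    unfolding map_law[OF sp] drop_process
    by (rule law_measure_preserving[OF sp funpow_measurable distr_funpow])
qed (rule \<open>\<delta> > 0\<close>)

lemma map_snd_process: "map snd (process P r x) = window 0 r x"
  by (rule nth_equalityI) (auto simp: nth_process)

text \<open>Starts that are at least \<open>h n\<close> apart lie in different cells of length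
  \<open>h n\<close>, and the window consists of L such cells.\<close>

lemma well_placed_card:
  assumes wp: "well_placed n (L * h n) s u"
  shows "finite s" "card s \<le> L"
proof -
  have s: "s \<subseteq> {..<L * h n}" "\<And>b. b \<in> s \<Longrightarrow> b + h n \<le> L * h n"
    "\<And>b b'. b \<in> s \<Longrightarrow> b' \<in> s \<Longrightarrow> b < b' \<Longrightarrow> b + h n \<le> b'"
    using wp by (auto simp: well_placed_def)
  show fin: "finite s" using s(1) finite_subset by blast
  have lt: "b div h n < b' div h n" if "b \<in> s" "b' \<in> s" "b < b'" for b b'
  proof -
    have "b div h n + 1 = (b + h n) div h n" using h_pos[of n] by simp
    also have "\<dots> \<le> b' div h n" using s(3)[OF that] by (rule div_le_mono)
    finally show ?thesis by simp
  qed
  have "inj_on (\<lambda>b. b div h n) s"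
  proof (rule inj_onI)
    fix b b' assume "b \<in> s" "b' \<in> s" "b div h n = b' div h n"
    then show "b = b'" using lt[of b b'] lt[of b' b] by (cases b b' rule: linorder_cases) auto
  qed
  then have "card s = card ((\<lambda>b. b div h n) ` s)" by (simp add: card_image)
  also have "\<dots> \<le> card {..<L}"
  proof (intro card_mono image_subsetI)
    fix b assume "b \<in> s"
    then have "b < L * h n" using s(1) by auto
    then show "b div h n \<in> {..<L}" by (simp add: less_mult_imp_div_less)
  qed simp
  finally show "card s \<le> L" by simp
qed

section \<open>Names reconstructed from free blocks\<close>

definition blocks :: "nat \<Rightarrow> nat set \<Rightarrow> 'a list \<Rightarrow> 'a list list" where
  "blocks n s u = map (block n u) (sorted_list_of_set s)"

definition decode_name :: "nat \<Rightarrow> ('a list \<Rightarrow> 'c) \<Rightarrow> nat \<Rightarrow> 'a list list \<Rightarrow> 'c list" where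
  "decode_name \<sigma> code K z = map (\<lambda>i. code (take (2 * \<sigma> + 1) (drop (i - \<sigma>) (concat z)))) [0..<K]"

definition bad_positions :: "nat \<Rightarrow> ('a list \<Rightarrow> 'c) \<Rightarrow> 'c list \<Rightarrow> 'a list \<Rightarrow> nat set" where
  "bad_positions \<sigma> code p u = {i. \<sigma> \<le> i \<and> i + \<sigma> < length u \<and> p ! i \<noteq> code (take (2 * \<sigma> + 1) (drop (i - \<sigma>) u))}"

text \<open>The j-th free block of u is matched with the j-th block of z if the two are equal. At
  distance at least \<sigma> from the ends of the block, the code sees the same window on both
  sides, so the labels agree except at bad positions.\<close>

lemma fbar_decode_name:
  assumes wp: "well_placed n (L * h n) s u" and p: "length p = L * h n"
    and z: "length z = L" "set z \<subseteq> V n"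
  shows "fbar p (decode_name \<sigma> code (L * h n) z)
    \<le> 1 - ((real (card s) - real (mism (blocks n s u) z)) * (real (h n) - 2 * real \<sigma>)
      - real (card (bad_positions \<sigma> code p u))) / real (L * h n)"
proof -
  let ?K = "L * h n"
  let ?b = "\<lambda>j. sorted_list_of_set s ! j"
  let ?v = "blocks n s u"
  have fin: "finite s" and cs: "card s \<le> L" using well_placed_card[OF wp] by auto
  have lenu: "length u = ?K" using wp by (simp add: well_placed_def)
  have bin: "?b j \<in> s" if "j < card s" for j using that fin by (metis nth_mem set_sorted_list_of_set length_sorted_list_of_set)
  have bK: "?b j + h n \<le> ?K" if "j < card s" for j using bin[OF that] wp by (auto simp: well_placed_def)
  have gap: "?b j + h n \<le> ?b j'" if "j < j'" "j' < card s" for j j'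
  proof -
    have "?b j < ?b j'"
      using strict_sorted_list_of_set[of s] that fin by (simp add: sorted_wrt_iff_nth_less)
    then show ?thesis using wp bin that by (auto simp: well_placed_def)
  qed
  have lenv: "length ?v = card s" using fin by (simp add: blocks_def)
  define J where "J = {j. j < card s \<and> ?v ! j = z ! j}"
  define B where "B = bad_positions \<sigma> code p u"
  have B: "B \<subseteq> {..<?K}" using lenu by (auto simp: B_def bad_positions_def)
  have finB: "finite B" using B finite_subset by blast
  let ?G = "{..<?K} - B"
  have "card J + mism ?v z = card s"
  proof -
    have "mism ?v z = card {j. j < card s \<and> ?v ! j \<noteq> z ! j}"
      using mism_card[of ?v z] lenv cs z by simp
    moreover have "card (J \<union> {j. j < card s \<and> ?v ! j \<noteq> z ! j}) = card J + card {j. j < card s \<and> ?v ! j \<noteq> z ! j}"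
      by (intro card_Un_disjoint) (auto simp: J_def)
    moreover have "J \<union> {j. j < card s \<and> ?v ! j \<noteq> z ! j} = {..<card s}" by (auto simp: J_def)
    ultimately show ?thesis by simp
  qed
  then have cJ: "real (card J) = real (card s) - real (mism ?v z)" by linarith
  have cG: "real ?K - real (card ?G) = real (card B)"
    using B finB card_mono[OF _ B] by (simp add: card_Diff_subset of_nat_diff)
  have "fbar p (decode_name \<sigma> code ?K z)
      \<le> 1 - (real (card J) * (real (h n) - 2 * real \<sigma>) - (real ?K - real (card ?G))) / real ?K"
  proof (rule fbar_block_match[where b = ?b and F = "card s" and G = ?G and J = J and s = \<sigma>])
    show "length p = ?K" by (rule p)
    show "length (decode_name \<sigma> code ?K z) = ?K" by (simp add: decode_name_def)
    show "card s * h n \<le> ?K" using cs by (intro mult_right_mono) auto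
    fix j t assume j: "j \<in> J" and t: "\<sigma> \<le> t" "t < h n - \<sigma>" and G: "?b j + t \<in> ?G"
    have js: "j < card s" "?v ! j = z ! j" using j by (auto simp: J_def)
    have jz: "j < length z" using js cs z by simp
    have hz: "\<forall>w\<in>set z. length w = h n" using z(2) W_length by (auto simp: V_def)
    have "Suc j * h n \<le> L * h n" using jz z by (intro mult_right_mono) auto
    then have jK: "j * h n + t < ?K" using t by simp
    have r: "(t - \<sigma>) + (2 * \<sigma> + 1) \<le> h n" using t by simp
    have bl: "take (2 * \<sigma> + 1) (drop (t - \<sigma>) (block n u (?b j))) = take (2 * \<sigma> + 1) (drop (?b j + t - \<sigma>) u)"
    proof -
      have m: "min (2 * \<sigma> + 1) (h n - (t - \<sigma>)) = 2 * \<sigma> + 1" using r by linarith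
      have "t - \<sigma> + ?b j = ?b j + t - \<sigma>" using t(1) by linarith
      then show ?thesis unfolding block_def drop_take take_take drop_drop m by simp
    qed
    have "p ! (?b j + t) = code (take (2 * \<sigma> + 1) (drop (?b j + t - \<sigma>) u))"
      using G t bK[OF js(1)] lenu by (auto simp: B_def bad_positions_def)
    also have "\<dots> = code (take (2 * \<sigma> + 1) (drop (t - \<sigma>) (?v ! j)))"
      using bl js(1) fin by (simp add: blocks_def)
    also have "\<dots> = code (take (2 * \<sigma> + 1) (drop (j * h n + (t - \<sigma>)) (concat z)))"
      using take_drop_concat_uniform[OF hz jz r] js(2) by simp
    also have "\<dots> = decode_name \<sigma> code ?K z ! (j * h n + t)"
      using jK t by (simp add: decode_name_def)
    finally show "p ! (?b j + t) = decode_name \<sigma> code ?K z ! (j * h n + t)" .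
  qed (use gap bK in \<open>auto simp: J_def\<close>)
  then show ?thesis unfolding cJ unfolding cG unfolding B_def .
qed

text \<open>By invariance, each time of the window is miscoded with probability at most \<theta>;
  times too close to the ends are not counted as bad.\<close>

lemma expectation_bad_positions:
  assumes P: "finite_measurable_partition \<mu> P"
    and code: "prob {x \<in> space \<mu>. cell P x \<noteq> code (window (- int \<sigma>) (2 * \<sigma> + 1) x)} \<le> \<theta>"
  shows "measure_pmf.expectation (law \<mu> (process P (M + K)))
    (\<lambda>\<rho>. real (card (bad_positions \<sigma> code (map fst (drop M \<rho>)) (map snd (drop M \<rho>))))) \<le> real K * \<theta>"
proof -
  let ?q = "law \<mu> (process P (M + K))"
  note sp = simple_process[OF P]
  have finq: "finite (set_pmf ?q)" by (rule finite_set_law[OF sp])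
  have lenq: "length \<rho> = M + K" if "\<rho> \<in> set_pmf ?q" for \<rho> using subsetD[OF set_law[OF sp] that] by auto
  let ?bad = "\<lambda>i. {\<rho>. i \<in> bad_positions \<sigma> code (map fst (drop M \<rho>)) (map snd (drop M \<rho>))}"
  let ?E = "{x \<in> space \<mu>. cell P x \<noteq> code (window (- int \<sigma>) (2 * \<sigma> + 1) x)}"
  let ?f = "\<lambda>x. (cell P x, window (- int \<sigma>) (2 * \<sigma> + 1) x)"
  have "simple_function \<mu> ?f"
    by (rule simple_function_Pair[OF simple_cell[OF P] simple_window])
  then have "?f -` {(a, b). a \<noteq> code b} \<inter> space \<mu> \<in> events"
    by (rule measurable_sets[OF measurable_simple_function]) simp
  moreover have "?E = ?f -` {(a, b). a \<noteq> code b} \<inter> space \<mu>" by auto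
  ultimately have E: "?E \<in> events" by simp
  have each: "measure_pmf.prob ?q (?bad i) \<le> \<theta>" if i: "i < K" for i
  proof -
    have "process P (M + K) -` ?bad i \<inter> space \<mu> \<subseteq> (left_shift ^^ (M + i)) -` ?E \<inter> space \<mu>"
    proof
      fix x assume x: "x \<in> process P (M + K) -` ?bad i \<inter> space \<mu>"
      let ?T = "(left_shift ^^ (M + i)) x"
      have b: "\<sigma> \<le> i" "i + \<sigma> < K"
        "map fst (drop M (process P (M + K) x)) ! i \<noteq> code (take (2 * \<sigma> + 1) (drop (i - \<sigma>) (map snd (drop M (process P (M + K) x)))))"
      proof -
        have "i \<in> bad_positions \<sigma> code (map fst (drop M (process P (M + K) x))) (map snd (drop M (process P (M + K) x)))"
          using x by blast
        then show "\<sigma> \<le> i" "i + \<sigma> < K"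
          "map fst (drop M (process P (M + K) x)) ! i \<noteq> code (take (2 * \<sigma> + 1) (drop (i - \<sigma>) (map snd (drop M (process P (M + K) x)))))"
          unfolding bad_positions_def mem_Collect_eq length_map length_drop length_process diff_add_inverse by blast+
      qed
      have "map fst (drop M (process P (M + K) x)) ! i = cell P ?T"
        using i by (simp add: nth_process)
      moreover have "take (2 * \<sigma> + 1) (drop (i - \<sigma>) (map snd (drop M (process P (M + K) x)))) = window (- int \<sigma>) (2 * \<sigma> + 1) ?T"
      proof (rule nth_equalityI)
        fix j assume "j < length (take (2 * \<sigma> + 1) (drop (i - \<sigma>) (map snd (drop M (process P (M + K) x)))))"
        then have "j < 2 * \<sigma> + 1" by simp
        then show "take (2 * \<sigma> + 1) (drop (i - \<sigma>) (map snd (drop M (process P (M + K) x)))) ! j = window (- int \<sigma>) (2 * \<sigma> + 1) ?T ! j"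
          using b(1,2) by (simp add: nth_process left_shift_funpow of_nat_diff algebra_simps)
      qed (use b(1,2) in simp)
      moreover have "?T \<in> space \<mu>" using x funpow_system by (simp add: space_mu)
      ultimately show "x \<in> (left_shift ^^ (M + i)) -` ?E \<inter> space \<mu>" using b(3) x by auto
    qed
    then have "prob (process P (M + K) -` ?bad i \<inter> space \<mu>) \<le> prob ((left_shift ^^ (M + i)) -` ?E \<inter> space \<mu>)"
      by (rule finite_measure_mono) (rule measurable_sets[OF funpow_measurable E])
    also have "\<dots> = measure (distr \<mu> \<mu> (left_shift ^^ (M + i))) ?E"
      by (rule measure_distr[symmetric, OF funpow_measurable E])
    finally show ?thesis using code by (simp only: prob_law[OF sp] distr_funpow)
  qed
  have "measure_pmf.expectation ?q (\<lambda>\<rho>. real (card (bad_positions \<sigma> code (map fst (drop M \<rho>)) (map snd (drop M \<rho>)))))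
      = measure_pmf.expectation ?q (\<lambda>\<rho>. \<Sum>i<K. indicator (?bad i) \<rho>)"
  proof (intro integral_cong_AE AE_pmfI)
    fix \<rho> assume "\<rho> \<in> set_pmf ?q"
    then have "bad_positions \<sigma> code (map fst (drop M \<rho>)) (map snd (drop M \<rho>)) \<subseteq> {..<K}"
      using lenq by (auto simp: bad_positions_def)
    then have "{i \<in> {..<K}. \<rho> \<in> ?bad i} = bad_positions \<sigma> code (map fst (drop M \<rho>)) (map snd (drop M \<rho>))" by auto
    then show "real (card (bad_positions \<sigma> code (map fst (drop M \<rho>)) (map snd (drop M \<rho>)))) = (\<Sum>i<K. indicator (?bad i) \<rho>)"
      by (simp add: indicator_def sum.If_cases Int_def)
  qed auto
  also have "\<dots> = (\<Sum>i<K. measure_pmf.prob ?q (?bad i))"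
    by (subst Bochner_Integration.integral_sum) (auto intro: integrable_measure_pmf_finite finq)
  also have "\<dots> \<le> (\<Sum>i<K. \<theta>)" using each by (intro sum_mono) auto
  finally show ?thesis by simp
qed

text \<open>The law of a future name given the past is compared with the image of independent uniform
  blocks, which does not depend on the past.\<close>

theorem past_independent_coupling:
  assumes P: "finite_measurable_partition \<mu> P" and \<theta>: "0 < \<theta>" "\<theta> \<le> 1"
  shows "\<exists>K>0. \<forall>M. \<exists>\<Lambda> Z. finite (set_pmf \<Lambda>) \<and>
    map_pmf (\<lambda>(a, p, q). (a, p)) \<Lambda>
      = map_pmf (\<lambda>\<rho>. (map fst (take M \<rho>), map fst (drop M \<rho>))) (law \<mu> (process P (M + K))) \<and>
    map_pmf (\<lambda>(a, p, q). (a, q)) \<Lambda>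
      = pair_pmf (map_pmf (\<lambda>\<rho>. map fst (take M \<rho>)) (law \<mu> (process P (M + K)))) Z \<and>
    (\<forall>(a, p, q)\<in>set_pmf \<Lambda>. length p = K \<and> length q = K) \<and>
    measure_pmf.expectation \<Lambda> (\<lambda>(a, p, q). fbar p q) \<le> 9 * \<theta>"
proof -
  note sp = simple_process[OF P]
  obtain \<sigma> code where "prob {x \<in> space \<mu>. cell P x \<noteq> code (window (- int \<sigma>) (2 * \<sigma> + 1) x)} < \<theta>"
    using cell_code[OF P \<theta>(1)] by blast
  then have code: "prob {x \<in> space \<mu>. cell P x \<noteq> code (window (- int \<sigma>) (2 * \<sigma> + 1) x)} \<le> \<theta>" by simp
  obtain n0 where n0: "\<And>l. l \<ge> n0 \<Longrightarrow> \<tau> l \<le> 1 / 2" using eventually_tau by blast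
  have "\<forall>\<^sub>F n in sequentially. total_cost n < \<theta>\<^sup>2"
    using \<theta> by (intro order_tendstoD(2)[OF total_cost_tendsto]) auto
  moreover have "\<forall>\<^sub>F n in sequentially. (2 * real \<sigma> + 1) / \<theta> \<le> real (h n)"
    using filterlim_h[of 0, unfolded filterlim_at_top, rule_format, of "(2 * real \<sigma> + 1) / \<theta>"] by simp
  moreover have "\<forall>\<^sub>F n in sequentially. 1 / \<theta> \<le> (2::real) ^ n"
  proof -
    have "filterlim (\<lambda>n::nat. (2::real) ^ n) at_top sequentially" by real_asymp
    then show ?thesis by (simp add: filterlim_at_top)
  qed
  \<comment> \<open>These conditions keep \<tau> at most 1 / 2 from level n on, the cost of the
    constraints below \<open>\<theta>\<^sup>2\<close> per block, the margins of width \<sigma>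
    within a fraction \<theta> of a block, and the density of non-free blocks at most
    \<theta>.\<close>
  ultimately have "\<forall>\<^sub>F n in sequentially. n0 \<le> n \<and> total_cost n < \<theta>\<^sup>2 \<and> (2 * real \<sigma> + 1) / \<theta> \<le> real (h n) \<and> 1 / \<theta> \<le> (2::real) ^ n"
    using eventually_ge_at_top[of n0] by eventually_elim blast
  then obtain n where n: "n0 \<le> n" "total_cost n < \<theta>\<^sup>2" "(2 * real \<sigma> + 1) / \<theta> \<le> real (h n)" "1 / \<theta> \<le> (2::real) ^ n"
    using eventually_happens'[OF sequentially_bot] by blast
  have \<tau>2: "\<tau> l \<le> 1 / 2" if "n \<le> l" for l by (rule n0) (use n(1) that in linarith)
  have hn: "real (h n) > 0" using h_pos by simp
  have \<sigma>h: "2 * real \<sigma> \<le> \<theta> * real (h n)" using n(3) \<theta>(1) by (simp add: field_simps)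
  \<comment> \<open>With this choice \<open>\<delta> * K\<close> equals
    \<open>\<theta>\<^sup>2 * L\<close>, that is, the past contributes
    \<open>\<theta>\<^sup>2\<close> per block.\<close>
  define \<delta> where "\<delta> = \<theta>\<^sup>2 / real (h n)"
  have \<delta>: "\<delta> > 0" using \<theta> hn by (simp add: \<delta>_def)
  obtain K0 where K0: "\<And>K M. K \<ge> K0 \<Longrightarrow> mutual (take M) (drop M) (law \<mu> (process P (M + K))) \<le> \<delta> * real K"
    using process_mutual_bound[OF P \<delta>] by blast
  \<comment> \<open>L is large enough for the bound on the mutual information, and at least
    \<open>1 / \<theta>\<close>, so that the one block lost at the ends of the window is a fraction
    \<theta>.\<close>
  define L where "L = K0 + nat \<lceil>1 / \<theta>\<rceil> + 1"
  have "1 / \<theta> \<le> real (nat \<lceil>1 / \<theta>\<rceil>)" by (rule real_nat_ceiling_ge)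
  then have L: "L > 0" "K0 \<le> L" "1 / \<theta> \<le> real L" by (simp_all add: L_def)
  define K where "K = L * h n"
  have "L \<le> L * h n" using h_pos[of n] by simp
  then have KL: "K > 0" "K \<ge> K0" using L(1) h_pos[of n] order_trans[OF L(2)] by (simp_all add: K_def)
  obtain \<kappa> where \<kappa>: "finite (set_pmf \<kappa>)" "map_pmf snd \<kappa> = law \<mu> (window 0 K)"
    "\<And>s u. (s, u) \<in> set_pmf \<kappa> \<Longrightarrow> well_placed n K s u"
    "\<And>s c. measure_pmf.prob \<kappa> {(s', u). s' = s \<and> (\<forall>b\<in>s. block n u b = c b)} * real (card (V n)) ^ card s
      \<le> measure_pmf.prob \<kappa> {(s', u). s' = s} * exp ((real L + 2) * total_cost n)"
    "measure_pmf.expectation \<kappa> (\<lambda>x. real (card (fst x))) \<ge> (1 - 1 / 2 ^ n) * (real L - 1)"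
  proof (rule window_law[of n K L, OF _ K_def L(1)])
    show "\<tau> l \<le> 1 / 2" if "n \<le> l" for l by (rule \<tau>2[OF that])
  qed (rule that)
  define sw where "sw = (\<lambda>x :: nat set \<times> 'a list. (snd x, fst x))"
  \<comment> \<open>The conditional law of the positions given the window; the pair is swapped
    because disintegration conditions on the first component.\<close>
  obtain \<zeta> where "map_pmf sw \<kappa> = bind_pmf (map_pmf fst (map_pmf sw \<kappa>)) (\<lambda>u. map_pmf (Pair u) (\<zeta> u))"
    by (rule pmf_disintegrate)
  then have \<zeta>: "map_pmf sw \<kappa> = bind_pmf (law \<mu> (window 0 K)) (\<lambda>u. map_pmf (Pair u) (\<zeta> u))"
    by (simp add: pmf.map_comp o_def sw_def \<kappa>(2)[symmetric])
  show ?thesis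
  proof (intro exI[of _ K] conjI KL(1) allI)
    fix M
    define q where "q = law \<mu> (process P (M + K))"
    define \<alpha> where "\<alpha> = (\<lambda>\<rho> :: ((int \<Rightarrow> 'a) set \<times> 'a) list. map fst (take M \<rho>))"
    define pf where "pf = (\<lambda>\<rho> :: ((int \<Rightarrow> 'a) set \<times> 'a) list. map fst (drop M \<rho>))"
    define u where "u = (\<lambda>\<rho> :: ((int \<Rightarrow> 'a) set \<times> 'a) list. map snd (drop M \<rho>))"
    have finq: "finite (set_pmf q)" unfolding q_def by (rule finite_set_law[OF sp])
    have lenq: "length \<rho> = M + K" if "\<rho> \<in> set_pmf q" for \<rho> using subsetD[OF set_law[OF sp] that[unfolded q_def]] by auto
    have uq: "map_pmf u q = law \<mu> (window 0 K)"
    proof -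
      have "map_pmf u q = law \<mu> (\<lambda>x. window 0 K ((left_shift ^^ M) x))"
        unfolding q_def u_def map_law[OF sp] drop_process map_snd_process ..
      then show ?thesis using law_measure_preserving[OF simple_window funpow_measurable distr_funpow] by simp
    qed
    \<comment> \<open>Positions are drawn from the symbols of the window only, hence are independent
      of the past and of the labels once these symbols are given.\<close>
    define J where "J = bind_pmf q (\<lambda>\<rho>. map_pmf (Pair \<rho>) (\<zeta> (u \<rho>)))"
    have J\<kappa>: "map_pmf (\<lambda>j. (snd j, u (fst j))) J = \<kappa>"
    proof -
      have "map_pmf (\<lambda>j. (u (fst j), snd j)) J = map_pmf sw \<kappa>"
        unfolding \<zeta> uq[symmetric] by (simp add: J_def map_bind_pmf pmf.map_comp o_def bind_map_pmf)
      then have "map_pmf (\<lambda>x. (snd x, fst x)) (map_pmf (\<lambda>j. (u (fst j), snd j)) J) = map_pmf (\<lambda>x. (snd x, fst x)) (map_pmf sw \<kappa>)"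
        by simp
      then show ?thesis by (simp add: pmf.map_comp o_def sw_def)
    qed
    have wpJ: "well_placed n K (snd j) (u (fst j))" if "j \<in> set_pmf J" for j
    proof -
      have "(snd j, u (fst j)) \<in> set_pmf \<kappa>" unfolding J\<kappa>[symmetric] using that by auto
      then show ?thesis by (rule \<kappa>(3))
    qed
    have fin\<zeta>: "finite (set_pmf (\<zeta> (u \<rho>)))" if "\<rho> \<in> set_pmf q" for \<rho>
    proof (rule finite_subset)
      show "set_pmf (\<zeta> (u \<rho>)) \<subseteq> fst ` set_pmf \<kappa>"
      proof
        fix s assume "s \<in> set_pmf (\<zeta> (u \<rho>))"
        then have "(\<rho>, s) \<in> set_pmf J" using that by (auto simp: J_def)
        then have "(s, u \<rho>) \<in> set_pmf \<kappa>" unfolding J\<kappa>[symmetric] by force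
        then show "s \<in> fst ` set_pmf \<kappa>" by force
      qed
    qed (use \<kappa>(1) in simp)
    have finJ: "finite (set_pmf J)" using finq fin\<zeta> by (simp add: J_def)
    let ?v = "\<lambda>j. blocks n (snd j) (u (fst j))"
    let ?N = "real (card (V n))"
    let ?C = "exp ((real L + 2) * total_cost n)"
    define p where "p = map_pmf (\<lambda>j. ((\<alpha> (fst j), snd j), ?v j)) J"
    define ES where "ES = measure_pmf.expectation \<kappa> (\<lambda>x. real (card (fst x)))"
    have ES_J: "measure_pmf.expectation J (\<lambda>j. real (card (snd j))) = ES"
      unfolding ES_def J\<kappa>[symmetric] integral_map_pmf by simp
    have wpL: "finite (snd j)" "card (snd j) \<le> L" if "j \<in> set_pmf J" for j
      using well_placed_card wpJ[OF that] unfolding K_def by blast+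
    have ES_le: "ES \<le> real L"
    proof -
      have "ES \<le> measure_pmf.expectation J (\<lambda>j. real L)"
        unfolding ES_J[symmetric] using wpL by (intro integral_mono_AE integrable_measure_pmf_finite finJ AE_pmfI) auto
      then show ?thesis by simp
    qed
    \<comment> \<open>Under J, positions and window have the joint law \<kappa>, so its density
      bound makes the contents of the free blocks nearly uniform given their positions; the past is
      not yet a condition.\<close>
    have low: "ent (map_pmf (\<lambda>j. (snd j, ?v j)) J) - ent (map_pmf snd J) \<ge> ES * ln ?N - (real L + 2) * total_cost n"
    proof -
      let ?p = "map_pmf (\<lambda>j. (snd j, ?v j)) J"
      have "ent ?p - ent (map_pmf fst ?p) \<ge> measure_pmf.expectation ?p (\<lambda>x. real (card (fst x))) * ln ?N - ln ?C"
      proof (rule ent_ge_of_density)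
        show "finite (set_pmf ?p)" using finJ by simp
        show "?N > 0" using card_V_pos by simp
        fix s v assume sv: "(s, v) \<in> set_pmf ?p"
        then obtain j where j: "j \<in> set_pmf J" "s = snd j" "v = ?v j" by auto
        have fins: "finite s" using wpL(1)[OF j(1)] j(2) by simp
        define c where "c = block n (u (fst j))"
        have eq1: "pmf ?p (s, v) = measure_pmf.prob \<kappa> {(s', u'). s' = s \<and> (\<forall>b\<in>s. block n u' b = c b)}"
        proof -
          have "(\<lambda>j. (snd j, ?v j)) -` {(s, v)} = (\<lambda>j. (snd j, u (fst j))) -` {(s', u'). s' = s \<and> (\<forall>b\<in>s. block n u' b = c b)}"
            using fins j(2,3) by (auto simp: blocks_def c_def)
          then show ?thesis unfolding J\<kappa>[symmetric] pmf_map measure_map_pmf by simp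
        qed
        have eq2: "pmf (map_pmf fst ?p) s = measure_pmf.prob \<kappa> {(s', u'). s' = s}"
          unfolding J\<kappa>[symmetric] pmf_map measure_map_pmf by (simp add: vimage_def)
        show "pmf ?p (s, v) * ?N ^ card s \<le> pmf (map_pmf fst ?p) s * ?C"
          unfolding eq1 eq2 by (rule \<kappa>(4))
      qed simp
      then show ?thesis by (simp add: integral_map_pmf ES_J pmf.map_comp o_def)
    qed
    have "mutual \<alpha> u q \<le> mutual (take M) (drop M) q"
      unfolding \<alpha>_def u_def by (rule mutual_mono[OF finq])
    also have "\<dots> \<le> \<delta> * real K" unfolding q_def by (rule K0[OF KL(2)])
    finally have mut: "mutual \<alpha> u q \<le> \<theta>\<^sup>2 * real L" using hn by (simp add: \<delta>_def K_def)
    have "ent (map_pmf (\<lambda>j. (snd j, ?v j)) J) - ent (map_pmf snd J) - mutual \<alpha> u q \<le> ent p - ent (map_pmf fst p)"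
      unfolding p_def using entropy_side_information[where q = q and \<zeta> = \<zeta> and u = u and J = J and \<alpha> = \<alpha> and f = "blocks n", OF finq fin\<zeta> J_def] by (simp add: pmf.map_comp o_def)
    \<comment> \<open>Constraints contribute 3 and the past contributes 1 to the factor 4 in the
      deficit, as L is at least 1.\<close>
    moreover have "(real L + 2) * total_cost n \<le> (3 * real L) * \<theta>\<^sup>2"
    proof (rule order_trans)
      show "(real L + 2) * total_cost n \<le> (real L + 2) * \<theta>\<^sup>2" using n(2) by (intro mult_left_mono) auto
      show "(real L + 2) * \<theta>\<^sup>2 \<le> (3 * real L) * \<theta>\<^sup>2" using L(1) by (intro mult_right_mono) auto
    qed
    ultimately have deficit: "ES * ln ?N - (ent p - ent (map_pmf fst p)) \<le> 4 * real L * \<theta>\<^sup>2"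
    proof -
      have "(3 * real L) * \<theta>\<^sup>2 = 3 * (real L * \<theta>\<^sup>2)" "4 * real L * \<theta>\<^sup>2 = 4 * (real L * \<theta>\<^sup>2)"
        "\<theta>\<^sup>2 * real L = real L * \<theta>\<^sup>2" by simp_all
      then show "ES * ln ?N - (ent p - ent (map_pmf fst p)) \<le> 4 * real L * \<theta>\<^sup>2"
        if "ent (map_pmf (\<lambda>j. (snd j, ?v j)) J) - ent (map_pmf snd J) - mutual \<alpha> u q \<le> ent p - ent (map_pmf fst p)"
          "(real L + 2) * total_cost n \<le> (3 * real L) * \<theta>\<^sup>2"
        using low mut that by linarith
    qed
    have finp: "finite (set_pmf p)" using finJ by (simp add: p_def)
    have "\<exists>R. map_pmf fst R = p \<and> finite (set_pmf R) \<and>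
      map_pmf (\<lambda>((s, v), z). (s, z)) R = pair_pmf (map_pmf fst p) (replicate_pmf L (pmf_of_set (V n))) \<and>
      measure_pmf.expectation R (\<lambda>((s, v), z). real (mism v z)) \<le>
        (1 / \<theta>) * (measure_pmf.expectation p (\<lambda>(s, v). real (card (snd s))) * ln (card (V n)) - (ent p - ent (map_pmf fst p)))
        + real L / (1 / \<theta>)"
    proof (rule side_information_coupling[OF finp finite_V V_nonempty])
      show "1 \<le> 1 / \<theta>" using \<theta> by simp
      fix s v assume "(s, v) \<in> set_pmf p"
      then obtain j where j: "j \<in> set_pmf J" "snd s = snd j" "v = ?v j" by (auto simp: p_def)
      show "length v = card (snd s) \<and> card (snd s) \<le> L \<and> set v \<subseteq> V n"
        using wpL[OF j(1)] wpJ[OF j(1)] j(2,3) by (auto simp: blocks_def well_placed_def)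
    qed
    then obtain R where R: "map_pmf fst R = p" "finite (set_pmf R)"
      "map_pmf (\<lambda>((s, v), z). (s, z)) R = pair_pmf (map_pmf fst p) (replicate_pmf L (pmf_of_set (V n)))"
      "measure_pmf.expectation R (\<lambda>((s, v), z). real (mism v z)) \<le>
        (1 / \<theta>) * (measure_pmf.expectation p (\<lambda>(s, v). real (card (snd s))) * ln (card (V n)) - (ent p - ent (map_pmf fst p)))
        + real L / (1 / \<theta>)"
      by blast
    have "measure_pmf.expectation p (\<lambda>(s, v). real (card (snd s))) = ES"
      unfolding p_def integral_map_pmf by (simp add: ES_J)
    then have "measure_pmf.expectation R (\<lambda>((s, v), z). real (mism v z)) \<le> (1 / \<theta>) * (4 * real L * \<theta>\<^sup>2) + real L * \<theta>"
      using R(4) mult_left_mono[OF deficit, of "1 / \<theta>"] \<theta> by simp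
    also have "\<dots> = 5 * \<theta> * real L" using \<theta> by (simp add: power2_eq_square)
    finally have mismR: "measure_pmf.expectation R (\<lambda>((s, v), z). real (mism v z)) \<le> 5 * \<theta> * real L" .
    obtain \<xi> where "R = bind_pmf (map_pmf fst R) (\<lambda>x. map_pmf (Pair x) (\<xi> x))" by (rule pmf_disintegrate)
    then have \<xi>: "R = bind_pmf p (\<lambda>x. map_pmf (Pair x) (\<xi> x))" using R(1) by simp
    let ?g = "\<lambda>j. ((\<alpha> (fst j), snd j), ?v j)"
    \<comment> \<open>R knows only the past name, the positions and the block contents. Drawing z
      from the kernel given these data, on top of J, restores the future labels and symbols.\<close>
    define B where "B = bind_pmf J (\<lambda>j. map_pmf (Pair j) (\<xi> (?g j)))"
    have BR: "map_pmf (\<lambda>b. (?g (fst b), snd b)) B = R"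
      by (subst \<xi>) (simp add: B_def p_def map_bind_pmf pmf.map_comp o_def bind_map_pmf)
    have BJ: "map_pmf fst B = J"
      by (simp add: B_def map_bind_pmf pmf.map_comp o_def map_pmf_const bind_return_pmf')
    have Jq: "map_pmf fst J = q"
      by (simp add: J_def map_bind_pmf pmf.map_comp o_def map_pmf_const bind_return_pmf')
    have zB: "snd b \<in> set_pmf (replicate_pmf L (pmf_of_set (V n)))" if "b \<in> set_pmf B" for b
    proof -
      have "(?g (fst b), snd b) \<in> set_pmf R" unfolding BR[symmetric] using that by auto
      then have "((\<alpha> (fst (fst b)), snd (fst b)), snd b) \<in> set_pmf (map_pmf (\<lambda>((s, v), z). (s, z)) R)"
        by force
      then show ?thesis unfolding R(3) by simp
    qed
    have finB: "finite (set_pmf B)"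
    proof (rule finite_subset)
      show "set_pmf B \<subseteq> set_pmf J \<times> set_pmf (replicate_pmf L (pmf_of_set (V n)))"
      proof
        fix b assume b: "b \<in> set_pmf B"
        then have "fst b \<in> set_pmf J" unfolding BJ[symmetric] by auto
        then show "b \<in> set_pmf J \<times> set_pmf (replicate_pmf L (pmf_of_set (V n)))"
          using zB[OF b] by (cases b) auto
      qed
      show "finite (set_pmf J \<times> set_pmf (replicate_pmf L (pmf_of_set (V n))))"
        using finJ finite_set_replicate_pmf[of "pmf_of_set (V n)" L] finite_V V_nonempty by simp
    qed
    let ?d = "decode_name \<sigma> code K"
    define \<Lambda> where "\<Lambda> = map_pmf (\<lambda>b. (\<alpha> (fst (fst b)), pf (fst (fst b)), ?d (snd b))) B"
    define Z where "Z = map_pmf ?d (replicate_pmf L (pmf_of_set (V n)))"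
    have 1: "finite (set_pmf \<Lambda>)" using finB by (simp add: \<Lambda>_def)
    have "map_pmf (\<lambda>(a, p, q). (a, p)) \<Lambda> = map_pmf (\<lambda>\<rho>. (\<alpha> \<rho>, pf \<rho>)) (map_pmf fst (map_pmf fst B))"
      by (simp add: \<Lambda>_def pmf.map_comp o_def)
    then have 2: "map_pmf (\<lambda>(a, p, q). (a, p)) \<Lambda> = map_pmf (\<lambda>\<rho>. (\<alpha> \<rho>, pf \<rho>)) q"
      unfolding BJ Jq .
    \<comment> \<open>The list z is independent of past name and positions together, in particular
      of the past name.\<close>
    have 3: "map_pmf (\<lambda>(a, p, q). (a, q)) \<Lambda> = pair_pmf (map_pmf \<alpha> q) Z"
    proof -
      have "map_pmf (\<lambda>(a, p, q). (a, q)) \<Lambda> = map_pmf (\<lambda>(s, z). (fst s, ?d z)) (map_pmf (\<lambda>((s, v), z). (s, z)) R)"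
        unfolding BR[symmetric] by (simp add: \<Lambda>_def pmf.map_comp o_def)
      also have "\<dots> = pair_pmf (map_pmf fst (map_pmf fst p)) Z"
        unfolding R(3) Z_def by (simp only: map_pair)
      also have "map_pmf fst (map_pmf fst p) = map_pmf \<alpha> (map_pmf fst J)"
        by (simp add: p_def pmf.map_comp o_def)
      finally show ?thesis unfolding Jq .
    qed
    have 4: "\<forall>(a, p, q)\<in>set_pmf \<Lambda>. length p = K \<and> length q = K"
    proof -
      have "length (pf (fst (fst b))) = K" if "b \<in> set_pmf B" for b
      proof -
        have "fst (fst b) \<in> set_pmf q" unfolding Jq[symmetric] BJ[symmetric] using that by auto
        then show ?thesis using lenq by (simp add: pf_def)
      qed
      then show ?thesis by (auto simp: \<Lambda>_def decode_name_def)
    qed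
    have int: "integrable (measure_pmf B) f" for f :: "_ \<Rightarrow> real"
      by (rule integrable_measure_pmf_finite[OF finB])
    have eS: "measure_pmf.expectation B (\<lambda>b. real (card (snd (fst b)))) = ES"
      using ES_J unfolding BJ[symmetric] integral_map_pmf .
    have eM: "measure_pmf.expectation B (\<lambda>b. real (mism (?v (fst b)) (snd b))) \<le> 5 * \<theta> * real L"
      using mismR unfolding BR[symmetric] integral_map_pmf by simp
    have eB: "measure_pmf.expectation B (\<lambda>b. real (card (bad_positions \<sigma> code (pf (fst (fst b))) (u (fst (fst b)))))) \<le> real K * \<theta>"
      using expectation_bad_positions[OF P code, of M K]
      unfolding q_def[symmetric] Jq[symmetric] BJ[symmetric] integral_map_pmf pf_def u_def .
    let ?hs = "real (h n) - 2 * real \<sigma>"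
    have hs: "0 \<le> ?hs" using \<sigma>h \<theta> mult_right_mono[of \<theta> 1 "real (h n)"] by simp
    have Kp: "real K > 0" using KL(1) by simp
    have "measure_pmf.expectation \<Lambda> (\<lambda>(a, p, q). fbar p q) = measure_pmf.expectation B (\<lambda>b. fbar (pf (fst (fst b))) (?d (snd b)))"
      by (simp add: \<Lambda>_def)
    also have "\<dots> \<le> measure_pmf.expectation B (\<lambda>b. 1 - ((real (card (snd (fst b))) - real (mism (?v (fst b)) (snd b))) * ?hs
        - real (card (bad_positions \<sigma> code (pf (fst (fst b))) (u (fst (fst b)))))) / real K)"
    proof (intro integral_mono_AE int AE_pmfI)
      fix b assume b: "b \<in> set_pmf B"
      have j: "fst b \<in> set_pmf J" unfolding BJ[symmetric] using b by auto
      have \<rho>: "fst (fst b) \<in> set_pmf q" unfolding Jq[symmetric] using j by auto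
      show "fbar (pf (fst (fst b))) (?d (snd b)) \<le> 1 - ((real (card (snd (fst b))) - real (mism (?v (fst b)) (snd b))) * ?hs
        - real (card (bad_positions \<sigma> code (pf (fst (fst b))) (u (fst (fst b)))))) / real K"
        unfolding K_def
      proof (rule fbar_decode_name)
        show "well_placed n (L * h n) (snd (fst b)) (u (fst (fst b)))" using wpJ[OF j] by (simp add: K_def)
        show "length (pf (fst (fst b))) = L * h n" using lenq[OF \<rho>] by (simp add: pf_def K_def)
        show "length (snd b) = L" "set (snd b) \<subseteq> V n"
          using zB[OF b] finite_V V_nonempty by (auto simp: set_replicate_pmf_lists)
      qed
    qed
    also have "\<dots> = 1 - ((ES - measure_pmf.expectation B (\<lambda>b. real (mism (?v (fst b)) (snd b)))) * ?hs
        - measure_pmf.expectation B (\<lambda>b. real (card (bad_positions \<sigma> code (pf (fst (fst b))) (u (fst (fst b))))))) / real K"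
      by (simp add: int eS)
    also have "\<dots> \<le> 1 - ((ES - 5 * \<theta> * real L) * ?hs - real K * \<theta>) / real K"
      using eM eB hs Kp by (intro diff_left_mono divide_right_mono diff_mono mult_right_mono) auto
    \<comment> \<open>The losses are 2 \<theta> for blocks that are not free or are cut by the ends
      of the window, 5 \<theta> for mismatched blocks, \<theta> for the margins of the blocks and
      \<theta> for bad positions.\<close>
    also have "\<dots> \<le> 9 * \<theta>"
    proof -
      define x where "x = (ES - 5 * \<theta> * real L) / real L"
      have Lp: "real L > 0" using L(1) by simp
      have "0 \<le> 5 * \<theta> * real L" using \<theta> by simp
      then have "ES - 5 * \<theta> * real L \<le> real L" using ES_le by linarith
      then have x1: "x \<le> 1" unfolding x_def using Lp by (simp add: pos_divide_le_eq)
      have "(1 - 1 / 2 ^ n) * (real L - 1) \<ge> (1 - \<theta>) * (real L - 1)"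
      proof (rule mult_right_mono)
        show "1 - \<theta> \<le> 1 - 1 / 2 ^ n" using n(4) \<theta>(1) by (simp add: field_simps)
      qed (use L(1) in simp)
      moreover have "1 \<le> \<theta> * real L" using L(3) \<theta>(1) by (simp add: field_simps)
      then have "(1 - \<theta>) * (real L - 1) \<ge> (1 - \<theta>) * (real L - \<theta> * real L)"
        using \<theta> by (intro mult_left_mono) auto
      moreover have "(1 - \<theta>) * (real L - \<theta> * real L) \<ge> (1 - 2 * \<theta>) * real L"
      proof -
        have "(1 - \<theta>) * (real L - \<theta> * real L) - (1 - 2 * \<theta>) * real L = \<theta>\<^sup>2 * real L"
          by (simp add: algebra_simps power2_eq_square)
        moreover have "\<theta>\<^sup>2 * real L \<ge> 0" by simp
        ultimately show ?thesis by linarith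
      qed
      ultimately have "(1 - 2 * \<theta>) * real L \<le> ES" using \<kappa>(5) unfolding ES_def by linarith
      then have "(1 - 7 * \<theta>) * real L \<le> ES - 5 * \<theta> * real L" by (simp add: algebra_simps)
      then have x7: "1 - 7 * \<theta> \<le> x" unfolding x_def using Lp by (simp add: pos_le_divide_eq)
      have "((ES - 5 * \<theta> * real L) * ?hs - real K * \<theta>) / real K = x * (1 - 2 * real \<sigma> / real (h n)) - \<theta>"
        using Lp hn by (simp add: x_def K_def field_simps)
      moreover have "x * (1 - 2 * real \<sigma> / real (h n)) \<ge> x - \<theta>"
      proof -
        have r: "0 \<le> 2 * real \<sigma> / real (h n)" "2 * real \<sigma> / real (h n) \<le> \<theta>"
          using \<sigma>h hn by (simp_all add: field_simps)
        have "x * (2 * real \<sigma> / real (h n)) \<le> 1 * (2 * real \<sigma> / real (h n))"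
          using x1 r(1) by (rule mult_right_mono)
        then show ?thesis using r(2) by (simp add: right_diff_distrib)
      qed
      ultimately show ?thesis using x7 by linarith
    qed
    finally have 5: "measure_pmf.expectation \<Lambda> (\<lambda>(a, p, q). fbar p q) \<le> 9 * \<theta>" .
    show "\<exists>\<Lambda> Z. finite (set_pmf \<Lambda>) \<and>
      map_pmf (\<lambda>(a, p, q). (a, p)) \<Lambda>
        = map_pmf (\<lambda>\<rho>. (map fst (take M \<rho>), map fst (drop M \<rho>))) (law \<mu> (process P (M + K))) \<and>
      map_pmf (\<lambda>(a, p, q). (a, q)) \<Lambda>
        = pair_pmf (map_pmf (\<lambda>\<rho>. map fst (take M \<rho>)) (law \<mu> (process P (M + K)))) Z \<and>
      (\<forall>(a, p, q)\<in>set_pmf \<Lambda>. length p = K \<and> length q = K) \<and>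
      measure_pmf.expectation \<Lambda> (\<lambda>(a, p, q). fbar p q) \<le> 9 * \<theta>"
      by (rule exI[of _ \<Lambda>], rule exI[of _ Z], intro conjI)
        (rule 1, rule 2[unfolded q_def \<alpha>_def pf_def], rule 3[unfolded q_def \<alpha>_def], rule 4, rule 5)
  qed
qed

section \<open>Names of the past and past atoms\<close>

lemma right_funpow_measurable: "right_shift ^^ n \<in> \<mu> \<rightarrow>\<^sub>M \<mu>"
  by (induction n) (auto intro: measurable_compose_rev[OF right_shift_measurable] simp: o_def[abs_def] id_def)

lemma right_funpow_system: "x \<in> \<Omega> \<Longrightarrow> (right_shift ^^ n) x \<in> \<Omega>"
  by (induction n) (auto intro: right_shift_system)

text \<open>The labels at the times -m, ..., 0 in chronological order, so that a past name followed
  by an itinerary is a name of the process.\<close>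

definition past_name :: "(int \<Rightarrow> 'a) set set \<Rightarrow> nat \<Rightarrow> (int \<Rightarrow> 'a) \<Rightarrow> (int \<Rightarrow> 'a) set list" where
  "past_name P m x = map (\<lambda>j. cell P ((left_shift ^^ j) ((right_shift ^^ m) x))) [0..<Suc m]"

lemma simple_past_name:
  assumes P: "finite_measurable_partition \<mu> P"
  shows "simple_function \<mu> (past_name P m)"
  unfolding past_name_def[abs_def]
  by (intro simple_function_map_list simple_function_comp[OF right_funpow_measurable]
      simple_function_comp[OF funpow_measurable simple_cell[OF P]])

lemma simple_itinerary:
  assumes P: "finite_measurable_partition \<mu> P"
  shows "simple_function \<mu> (itinerary left_shift P K)"
  unfolding itinerary_def[abs_def]
  by (intro simple_function_map_list simple_function_comp[OF funpow_measurable simple_cell[OF P]])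

text \<open>Translation by m turns the times -m, ..., 0 and 1, ..., K into 0, ..., m and m + 1, ...,
  m + K; invariance leaves the law unchanged.\<close>

lemma law_past_itinerary:
  assumes P: "finite_measurable_partition \<mu> P"
  shows "law \<mu> (\<lambda>x. (past_name P m x, itinerary left_shift P K x))
    = map_pmf (\<lambda>\<rho>. (map fst (take (Suc m) \<rho>), map fst (drop (Suc m) \<rho>))) (law \<mu> (process P (Suc m + K)))"
proof -
  let ?f = "\<lambda>x. (past_name P m x, itinerary left_shift P K x)"
  have "?f ((left_shift ^^ m) y) = (map fst (take (Suc m) (process P (Suc m + K) y)), map fst (drop (Suc m) (process P (Suc m + K) y)))" for y
  proof -
    have inv: "(right_shift ^^ m) ((left_shift ^^ m) y) = y" by (simp add: left_shift_funpow right_shift_funpow)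
    have "past_name P m ((left_shift ^^ m) y) = map fst (take (Suc m) (process P (Suc m + K) y))"
      unfolding past_name_def inv take_process by (simp add: process_def del: upt_Suc)
    moreover have "itinerary left_shift P K ((left_shift ^^ m) y) = map fst (drop (Suc m) (process P (Suc m + K) y))"
      unfolding drop_process
    proof (rule nth_equalityI)
      fix i assume "i < length (itinerary left_shift P K ((left_shift ^^ m) y))"
      then have i: "i < K" by (simp add: itinerary_def del: upt_Suc)
      have "(left_shift ^^ Suc i) ((left_shift ^^ m) y) = (left_shift ^^ i) ((left_shift ^^ Suc m) y)"
        unfolding left_shift_funpow by (simp add: algebra_simps)
      then show "itinerary left_shift P K ((left_shift ^^ m) y) ! i = map fst (process P K ((left_shift ^^ Suc m) y)) ! i"
        using i by (simp add: itinerary_def nth_process del: upt_Suc funpow.simps)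
    qed (simp add: itinerary_def)
    ultimately show ?thesis by simp
  qed
  then have "law \<mu> (\<lambda>x. ?f ((left_shift ^^ m) x))
      = map_pmf (\<lambda>\<rho>. (map fst (take (Suc m) \<rho>), map fst (drop (Suc m) \<rho>))) (law \<mu> (process P (Suc m + K)))"
    by (simp only: map_law[OF simple_process[OF P]])
  then show ?thesis
    using law_measure_preserving[OF simple_function_Pair[OF simple_past_name[OF P] simple_itinerary[OF P]] funpow_measurable distr_funpow]
    by simp
qed

text \<open>A point lies in the i-th forward image of a cell if its label at time -i is that cell.
  This is entry \<open>m - i\<close> of the past name, hence the reversed index.\<close>

lemma past_atom_of_name:
  assumes P: "finite_measurable_partition \<mu> P" and ne: "past_name P m -` {a} \<inter> \<Omega> \<noteq> {}"
  shows "past_name P m -` {a} \<inter> \<Omega> \<in> past_atoms left_shift P m"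
proof -
  let ?B = "past_name P m -` {a} \<inter> \<Omega>"
  obtain x0 where x0: "x0 \<in> \<Omega>" "past_name P m x0 = a" using ne by auto
  have len: "length a = Suc m" using x0(2) by (auto simp: past_name_def simp del: upt_Suc)
  have aP: "a ! j \<in> P" if "j \<le> m" for j
  proof -
    have "a ! j = cell P ((left_shift ^^ j) ((right_shift ^^ m) x0))"
      using that x0(2) by (auto simp: past_name_def simp del: upt_Suc)
    then show ?thesis using cell_in(1)[OF P funpow_system[OF right_funpow_system[OF x0(1)]]] by simp
  qed
  have PO: "A \<subseteq> \<Omega>" if "A \<in> P" for A
    using P that sets.sets_into_space unfolding finite_measurable_partition_def space_mu[symmetric] by blast
  have nth: "past_name P m x ! (m - i) = cell P ((right_shift ^^ i) x)" if "i \<le> m" for i x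
  proof -
    have "(left_shift ^^ (m - i)) ((right_shift ^^ m) x) = (right_shift ^^ i) x"
      using that by (auto simp: left_shift_funpow right_shift_funpow of_nat_diff algebra_simps)
    then show ?thesis using that by (simp add: past_name_def del: upt_Suc)
  qed
  have rl: "(right_shift ^^ i) ((left_shift ^^ i) z) = z" "(left_shift ^^ i) ((right_shift ^^ i) z) = z" for i z
    by (simp_all add: left_shift_funpow right_shift_funpow)
  have "?B = (\<Inter>i\<le>m. (left_shift ^^ i) ` (a ! (m - i)))"
  proof (intro equalityI subsetI INT_I)
    fix x i assume x: "x \<in> ?B" and i: "i \<in> {..m}"
    have "(right_shift ^^ i) x \<in> cell P ((right_shift ^^ i) x)"
      using cell_in(2)[OF P right_funpow_system] x by blast
    then have "(right_shift ^^ i) x \<in> a ! (m - i)" using nth[of i x] i x by auto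
    then show "x \<in> (left_shift ^^ i) ` (a ! (m - i))" using rl(2)[of i x] by (metis imageI)
  next
    fix x assume x: "x \<in> (\<Inter>i\<le>m. (left_shift ^^ i) ` (a ! (m - i)))"
    have z: "(right_shift ^^ i) x \<in> a ! (m - i)" if "i \<le> m" for i
    proof -
      have "x \<in> (left_shift ^^ i) ` (a ! (m - i))" using INT_D[OF x, of i] that by simp
      then show ?thesis by (elim imageE) (simp add: rl)
    qed
    have "x \<in> \<Omega>" using z[of 0] PO[OF aP[of m]] by auto
    moreover have "past_name P m x = a"
    proof (rule nth_equalityI)
      fix j assume "j < length (past_name P m x)"
      then have j: "j \<le> m" by (simp add: past_name_def del: upt_Suc)
      then have "past_name P m x ! j = cell P ((right_shift ^^ (m - j)) x)" using nth[of "m - j" x] by simp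
      also have "\<dots> = a ! j" using cell_unique[OF P aP[OF j], of "(right_shift ^^ (m - j)) x"] z[of "m - j"] j by simp
      finally show "past_name P m x ! j = a ! j" .
    qed (simp add: len past_name_def del: upt_Suc)
    ultimately show "x \<in> ?B" by simp
  qed
  moreover have "\<forall>i\<le>m. a ! (m - i) \<in> P" using aP by simp
  ultimately show ?thesis
    unfolding past_atoms_def mem_Collect_eq using ne by (intro conjI exI[of _ "\<lambda>i. a ! (m - i)"])
qed

end

section \<open>Comparison of two pasts\<close>

lemma markov_pmf:
  fixes f :: "'x \<Rightarrow> real"
  assumes fin: "finite (set_pmf p)" and f: "\<And>x. x \<in> set_pmf p \<Longrightarrow> f x \<ge> 0" and t: "t > 0"
  shows "measure_pmf.prob p {x. f x \<ge> t} \<le> measure_pmf.expectation p f / t"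
proof -
  have "measure_pmf.expectation p (\<lambda>x. t * indicator {x. f x \<ge> t} x) \<le> measure_pmf.expectation p f"
    using f by (intro integral_mono_AE integrable_measure_pmf_finite fin AE_pmfI) (auto simp: indicator_def)
  then show ?thesis using t by (simp add: field_simps)
qed

text \<open>The two outer components are made conditionally independent given the common component
  q.\<close>

lemma glue_couplings:
  assumes "map_pmf snd \<gamma>1 = map_pmf snd \<gamma>2"
  shows "\<exists>T. map_pmf (\<lambda>(p, q, p'). (p, q)) T = \<gamma>1 \<and> map_pmf (\<lambda>(p, q, p'). (p', q)) T = \<gamma>2"
proof -
  obtain \<kappa> where "map_pmf prod.swap \<gamma>2 = bind_pmf (map_pmf fst (map_pmf prod.swap \<gamma>2)) (\<lambda>q. map_pmf (Pair q) (\<kappa> q))"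
    by (rule pmf_disintegrate)
  then have \<kappa>: "map_pmf prod.swap \<gamma>2 = bind_pmf (map_pmf snd \<gamma>1) (\<lambda>q. map_pmf (Pair q) (\<kappa> q))"
    by (simp add: pmf.map_comp o_def assms)
  define T where "T = bind_pmf \<gamma>1 (\<lambda>x. map_pmf (\<lambda>p'. (fst x, snd x, p')) (\<kappa> (snd x)))"
  have "map_pmf (\<lambda>(p, q, p'). (p, q)) T = \<gamma>1"
    by (simp add: T_def map_bind_pmf pmf.map_comp o_def map_pmf_const bind_return_pmf')
  moreover have "map_pmf (\<lambda>(p, q, p'). (p', q)) T = map_pmf prod.swap (map_pmf prod.swap \<gamma>2)"
    unfolding \<kappa> by (simp add: T_def map_bind_pmf pmf.map_comp o_def bind_map_pmf)
  ultimately show ?thesis by (auto simp: pmf.map_comp o_def)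
qed

context E_system
begin

text \<open>The law Z does not depend on the past. Markov's inequality selects the pasts whose
  future names are on average close to Z; two such pasts are joined through a common sample of Z,
  and the triangle inequality applies outside a small exceptional set given by a second use of
  Markov's inequality.\<close>

theorem loosely_Bernoulli_shift_process:
  assumes P: "finite_measurable_partition \<mu> P"
  shows "loosely_Bernoulli_process \<mu> left_shift P"
  unfolding loosely_Bernoulli_process_def
proof (intro allI impI)
  fix e :: real assume "e > 0"
  define e1 where "e1 = min e 1"
  have e1: "0 < e1" "e1 \<le> 1" "e1 \<le> e" using \<open>e > 0\<close> by (auto simp: e1_def)
  \<comment> \<open>With \<open>t = e1\<^sup>2 / 8\<close>, the ratio
    \<open>9 * \<theta> / t\<close> is \<open>9 / 10 * e1\<close>, which bounds the measure of the
    discarded pasts. For a retained past the distance reaches \<open>e1 / 2\<close> with probability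
    below \<open>t / (e1 / 2) = e1 / 4\<close>.\<close>
  define \<theta> where "\<theta> = e1 ^ 3 / 80"
  have "e1 ^ 3 \<le> 1" using e1 by (intro power_le_one) auto
  then have \<theta>: "0 < \<theta>" "\<theta> \<le> 1" using e1 by (auto simp: \<theta>_def)
  define t where "t = e1\<^sup>2 / 8"
  have t: "t > 0" using e1 by (simp add: t_def)
  obtain K where K: "K > 0" and KM: "\<And>M. \<exists>\<Lambda> Z. finite (set_pmf \<Lambda>) \<and>
    map_pmf (\<lambda>(a, p, q). (a, p)) \<Lambda>
      = map_pmf (\<lambda>\<rho>. (map fst (take M \<rho>), map fst (drop M \<rho>))) (law \<mu> (process P (M + K))) \<and>
    map_pmf (\<lambda>(a, p, q). (a, q)) \<Lambda>
      = pair_pmf (map_pmf (\<lambda>\<rho>. map fst (take M \<rho>)) (law \<mu> (process P (M + K)))) Z \<and>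
    (\<forall>(a, p, q)\<in>set_pmf \<Lambda>. length p = K \<and> length q = K) \<and>
    measure_pmf.expectation \<Lambda> (\<lambda>(a, p, q). fbar p q) \<le> 9 * \<theta>"
    using past_independent_coupling[OF P \<theta>] by blast
  obtain D where "coded_space \<mu> embed D" using ex_coded_space by blast
  then interpret C: coded_space \<mu> embed D .
  show "\<exists>K>0. \<forall>m>0. \<exists>\<G>\<subseteq>past_atoms left_shift P m. prob (\<Union>\<G>) > 1 - e \<and>
        (\<forall>A\<in>\<G>. \<forall>B\<in>\<G>. prob A > 0 \<longrightarrow> prob B > 0 \<longrightarrow>
           fbar_close left_shift P K (uniform_measure \<mu> A) (uniform_measure \<mu> B) e)"
  proof (intro exI[of _ K] conjI K allI impI)
    fix m :: nat assume "m > 0"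
    let ?pa = "past_name P m" and ?it = "itinerary left_shift P K"
    define Q where "Q = law \<mu> (\<lambda>x. (?pa x, ?it x))"
    have sf: "simple_function \<mu> (\<lambda>x. (?pa x, ?it x))"
      by (rule simple_function_Pair[OF simple_past_name[OF P] simple_itinerary[OF P]])
    \<comment> \<open>An atom of the past fixes m + 1 labels, at the times -m, ..., 0; hence the
      length \<open>Suc m\<close>.\<close>
    obtain \<Lambda> Z where "finite (set_pmf \<Lambda>)"
      "map_pmf (\<lambda>(a, p, q). (a, p)) \<Lambda>
        = map_pmf (\<lambda>\<rho>. (map fst (take (Suc m) \<rho>), map fst (drop (Suc m) \<rho>))) (law \<mu> (process P (Suc m + K)))"
      "map_pmf (\<lambda>(a, p, q). (a, q)) \<Lambda>
        = pair_pmf (map_pmf (\<lambda>\<rho>. map fst (take (Suc m) \<rho>)) (law \<mu> (process P (Suc m + K)))) Z"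
      "\<forall>(a, p, q)\<in>set_pmf \<Lambda>. length p = K \<and> length q = K"
      "measure_pmf.expectation \<Lambda> (\<lambda>(a, p, q). fbar p q) \<le> 9 * \<theta>"
      using KM[of "Suc m"] by blast
    moreover have "map_pmf (\<lambda>\<rho>. map fst (take (Suc m) \<rho>)) (law \<mu> (process P (Suc m + K))) = map_pmf fst Q"
      unfolding Q_def law_past_itinerary[OF P] by (simp only: pmf.map_comp o_def fst_conv)
    ultimately have \<Lambda>: "finite (set_pmf \<Lambda>)" "map_pmf (\<lambda>(a, p, q). (a, p)) \<Lambda> = Q"
      "map_pmf (\<lambda>(a, p, q). (a, q)) \<Lambda> = pair_pmf (map_pmf fst Q) Z"
      "\<forall>(a, p, q)\<in>set_pmf \<Lambda>. length p = K \<and> length q = K"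
      "measure_pmf.expectation \<Lambda> (\<lambda>(a, p, q). fbar p q) \<le> 9 * \<theta>"
      unfolding Q_def law_past_itinerary[OF P] by (simp_all only:)
    let ?S = "map_pmf fst Q"
    have \<Lambda>S: "map_pmf fst \<Lambda> = ?S" unfolding \<Lambda>(2)[symmetric] by (simp add: pmf.map_comp o_def split_def)
    obtain \<gamma> where "\<Lambda> = bind_pmf (map_pmf fst \<Lambda>) (\<lambda>a. map_pmf (Pair a) (\<gamma> a))" by (rule pmf_disintegrate)
    then have \<gamma>: "\<Lambda> = bind_pmf ?S (\<lambda>a. map_pmf (Pair a) (\<gamma> a))" unfolding \<Lambda>S .
    have in\<Lambda>: "(a, x) \<in> set_pmf \<Lambda>" if "a \<in> set_pmf ?S" "x \<in> set_pmf (\<gamma> a)" for a x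
      by (subst \<gamma>) (use that in auto)
    have fin\<gamma>: "finite (set_pmf (\<gamma> a))" if "a \<in> set_pmf ?S" for a
      by (rule finite_subset[of _ "snd ` set_pmf \<Lambda>"]) (use in\<Lambda>[OF that] \<Lambda>(1) in force)+
    have len\<gamma>: "length (fst x) = K" "length (snd x) = K" if "a \<in> set_pmf ?S" "x \<in> set_pmf (\<gamma> a)" for a x
      using bspec[OF \<Lambda>(4) in\<Lambda>[OF that]] by (auto simp: split_def)
    have finS: "finite (set_pmf ?S)" using \<Lambda>(1) unfolding \<Lambda>S[symmetric] by simp
    \<comment> \<open>Independence of past and sample means that for every past of positive mass the
      conditional law of the sample is Z itself.\<close>
    have \<gamma>snd: "map_pmf snd (\<gamma> a) = Z" if a: "a \<in> set_pmf ?S" for a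
    proof (rule pmf_eqI)
      fix z
      have "bind_pmf ?S (\<lambda>a. map_pmf (Pair a) (map_pmf snd (\<gamma> a))) = map_pmf (\<lambda>(a, p, q). (a, q)) \<Lambda>"
        by (subst \<gamma>) (simp add: map_bind_pmf pmf.map_comp o_def split_def)
      also have "\<dots> = bind_pmf ?S (\<lambda>a. map_pmf (Pair a) Z)"
        unfolding \<Lambda>(3) by (simp add: pair_pmf_def map_pmf_def)
      finally have eq: "bind_pmf ?S (\<lambda>a. map_pmf (Pair a) (map_pmf snd (\<gamma> a))) = bind_pmf ?S (\<lambda>a. map_pmf (Pair a) Z)" .
      have "pmf ?S a * pmf (map_pmf snd (\<gamma> a)) z = pmf ?S a * pmf Z z"
        unfolding pmf_bind_Pair[of ?S "\<lambda>a. map_pmf snd (\<gamma> a)" a z, symmetric] eq by (rule pmf_bind_Pair)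
      then show "pmf (map_pmf snd (\<gamma> a)) z = pmf Z z" using pmf_positive[OF a] by auto
    qed
    have \<gamma>fst: "pmf ?S a * pmf (map_pmf fst (\<gamma> a)) p = pmf Q (a, p)" for a p
    proof -
      have "bind_pmf ?S (\<lambda>a. map_pmf (Pair a) (map_pmf fst (\<gamma> a))) = map_pmf (\<lambda>(a, p, q). (a, p)) \<Lambda>"
        by (subst \<gamma>) (simp add: map_bind_pmf pmf.map_comp o_def split_def)
      also have "\<dots> = Q" by (rule \<Lambda>(2))
      finally show ?thesis using pmf_bind_Pair[of ?S "\<lambda>a. map_pmf fst (\<gamma> a)" a p] by simp
    qed
    define w where "w a = measure_pmf.expectation (\<gamma> a) (\<lambda>(p, q). fbar p q)" for a
    have w0: "w a \<ge> 0" if a: "a \<in> set_pmf ?S" for a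
      unfolding w_def
      by (intro integral_nonneg_AE AE_pmfI) (use len\<gamma>[OF a] in \<open>auto simp: split_def intro: fbar_nonneg\<close>)
    have "measure_pmf.expectation \<Lambda> (\<lambda>(a, p, q). fbar p q) = (\<Sum>a\<in>set_pmf ?S. pmf ?S a * w a)"
      by (subst \<gamma>, subst expectation_bind_finite[OF finS]) (use fin\<gamma> in \<open>auto simp: w_def\<close>)
    then have Ew: "measure_pmf.expectation ?S w \<le> 9 * \<theta>"
      using \<Lambda>(5) by (simp only: expectation_finite_pmf[OF finS])
    have "measure_pmf.prob ?S {a. w a \<ge> t} \<le> measure_pmf.expectation ?S w / t"
      by (rule markov_pmf[OF finS w0 t])
    also have "\<dots> \<le> 9 * \<theta> / t" using Ew t by (intro divide_right_mono) auto
    also have "\<dots> = 9 / 10 * e1" using e1 by (simp add: \<theta>_def t_def power2_eq_square power3_eq_cube)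
    also have "\<dots> < e1" using e1 by simp
    finally have small: "measure_pmf.prob ?S {a. w a \<ge> t} < e1" .
    define good where "good = {a \<in> set_pmf ?S. w a < t}"
    have "measure_pmf.prob ?S good = measure_pmf.prob ?S (- {a. w a \<ge> t})"
      by (intro measure_pmf.finite_measure_eq_AE) (auto simp: AE_measure_pmf_iff good_def)
    also have "\<dots> = 1 - measure_pmf.prob ?S {a. w a \<ge> t}"
      using measure_pmf.prob_compl[of "{a. w a \<ge> t}" ?S] by (simp add: Compl_eq_Diff_UNIV)
    finally have prgood: "measure_pmf.prob ?S good > 1 - e" using small e1(3) by linarith
    let ?B = "\<lambda>a. ?pa -` {a} \<inter> \<Omega>"
    have Slaw: "?S = law \<mu> ?pa" unfolding Q_def map_law[OF sf] by simp
    have Bev: "?B a \<in> events" for a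
      using measurable_sets[OF measurable_simple_function[OF simple_past_name[OF P, of m]], of "{a}"] by (simp add: space_mu)
    have Bpr: "prob (?B a) = pmf ?S a" for a
      unfolding Slaw pmf_law[OF simple_past_name[OF P]] space_mu ..
    have Bit: "prob (?B a \<inter> (?it -` {c} \<inter> space \<mu>)) = pmf Q (a, c)" for a c
      unfolding Q_def pmf_law[OF sf] by (intro arg_cong[where f = prob]) (auto simp: space_mu)
    have Bpos: "prob (?B a) > 0" if "a \<in> good" for a
      unfolding Bpr using that by (intro pmf_positive) (simp add: good_def)
    show "\<exists>\<G>\<subseteq>past_atoms left_shift P m. prob (\<Union>\<G>) > 1 - e \<and>
        (\<forall>A\<in>\<G>. \<forall>B\<in>\<G>. prob A > 0 \<longrightarrow> prob B > 0 \<longrightarrow>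
           fbar_close left_shift P K (uniform_measure \<mu> A) (uniform_measure \<mu> B) e)"
    proof (intro exI[of _ "?B ` good"] conjI ballI impI)
      show "?B ` good \<subseteq> past_atoms left_shift P m"
      proof (rule image_subsetI)
        fix a assume "a \<in> good"
        then have "?B a \<noteq> {}" using Bpos[of a] by (metis less_irrefl measure_empty)
        then show "?B a \<in> past_atoms left_shift P m" by (rule past_atom_of_name[OF P])
      qed
      have "prob (\<Union>(?B ` good)) = prob (?pa -` good \<inter> space \<mu>)"
        by (intro arg_cong[where f = prob]) (auto simp: space_mu)
      also have "\<dots> = measure_pmf.prob ?S good"
        unfolding Slaw prob_law[OF simple_past_name[OF P]] ..
      finally show "prob (\<Union>(?B ` good)) > 1 - e" using prgood by simp
    next
      fix A B assume AB: "A \<in> ?B ` good" "B \<in> ?B ` good"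
      obtain a b where ab: "a \<in> good" "A = ?B a" "b \<in> good" "B = ?B b" using AB by blast
      have aS: "a \<in> set_pmf ?S" "w a < t" and bS: "b \<in> set_pmf ?S" "w b < t" using ab by (auto simp: good_def)
      have "map_pmf snd (\<gamma> a) = map_pmf snd (\<gamma> b)" by (simp only: \<gamma>snd[OF aS(1)] \<gamma>snd[OF bS(1)])
      then obtain T where T: "map_pmf (\<lambda>(p, q, p'). (p, q)) T = \<gamma> a" "map_pmf (\<lambda>(p, q, p'). (p', q)) T = \<gamma> b"
        using glue_couplings by blast
      \<comment> \<open>The common sample of Z serves only as an intermediary in the triangle
        inequality and is now forgotten.\<close>
      define \<Gamma> where "\<Gamma> = map_pmf (\<lambda>(p, q, p'). (p, p')) T"
      have \<Gamma>1: "map_pmf fst \<Gamma> = map_pmf fst (\<gamma> a)" unfolding T(1)[symmetric] by (simp add: \<Gamma>_def pmf.map_comp o_def split_def)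
      have \<Gamma>2: "map_pmf snd \<Gamma> = map_pmf fst (\<gamma> b)" unfolding T(2)[symmetric] by (simp add: \<Gamma>_def pmf.map_comp o_def split_def)
      have fin\<Gamma>: "finite (set_pmf \<Gamma>)"
      proof (rule finite_subset)
        show "set_pmf \<Gamma> \<subseteq> set_pmf (map_pmf fst \<Gamma>) \<times> set_pmf (map_pmf snd \<Gamma>)" by force
        show "finite (set_pmf (map_pmf fst \<Gamma>) \<times> set_pmf (map_pmf snd \<Gamma>))"
          unfolding \<Gamma>1 \<Gamma>2 using fin\<gamma>[OF aS(1)] fin\<gamma>[OF bS(1)] by simp
      qed
      let ?Bad = "{(p, p'). \<not> fbar p p' < e}"
      let ?far = "{(p, q). fbar p q \<ge> e1 / 2}"
      have far: "measure_pmf.prob (\<gamma> c) ?far < e1 / 4" if c: "c \<in> set_pmf ?S" "w c < t" for c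
      proof -
        have "measure_pmf.prob (\<gamma> c) {x. (\<lambda>(p, q). fbar p q) x \<ge> e1 / 2} \<le> w c / (e1 / 2)"
          unfolding w_def
          by (rule markov_pmf[OF fin\<gamma>[OF c(1)]]) (use len\<gamma>[OF c(1)] e1 in \<open>auto simp: split_def intro: fbar_nonneg\<close>)
        also have "\<dots> < t / (e1 / 2)" using c(2) e1 by (intro divide_strict_right_mono) auto
        also have "\<dots> = e1 / 4" using e1 by (simp add: t_def power2_eq_square)
        finally show ?thesis by (simp add: split_def)
      qed
      have "measure_pmf.prob \<Gamma> ?Bad = measure_pmf.prob T {x. (\<lambda>(p, q, p'). \<not> fbar p p' < e) x}"
        unfolding \<Gamma>_def measure_map_pmf by (intro arg_cong[where f = "measure_pmf.prob T"]) auto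
      also have "\<dots> \<le> measure_pmf.prob T ((\<lambda>(p, q, p'). (p, q)) -` ?far \<union> (\<lambda>(p, q, p'). (p', q)) -` ?far)"
      proof (intro measure_pmf.finite_measure_mono_AE)
        show "AE x in measure_pmf T. x \<in> {x. (\<lambda>(p, q, p'). \<not> fbar p p' < e) x} \<longrightarrow>
          x \<in> (\<lambda>(p, q, p'). (p, q)) -` ?far \<union> (\<lambda>(p, q, p'). (p', q)) -` ?far"
        proof (intro AE_pmfI impI)
          fix x assume x: "x \<in> set_pmf T" "x \<in> {x. (\<lambda>(p, q, p'). \<not> fbar p p' < e) x}"
          obtain p q p' where [simp]: "x = (p, q, p')" by (cases x)
          have "(p, q) \<in> set_pmf (\<gamma> a)" unfolding T(1)[symmetric] using x(1) by force
          moreover have "(p', q) \<in> set_pmf (\<gamma> b)" unfolding T(2)[symmetric] using x(1) by force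
          ultimately have l: "length p = K" "length q = K" "length p' = K"
            using len\<gamma>[OF aS(1)] len\<gamma>[OF bS(1)] by fastforce+
          have "fbar p p' \<le> fbar p q + fbar p' q"
            using fbar_triangle[OF l] fbar_commute[OF l(2,3)] by simp
          moreover have "fbar p p' \<ge> e1" using x(2) e1(3) by simp
          ultimately have "fbar p q \<ge> e1 / 2 \<or> fbar p' q \<ge> e1 / 2" by linarith
          then show "x \<in> (\<lambda>(p, q, p'). (p, q)) -` ?far \<union> (\<lambda>(p, q, p'). (p', q)) -` ?far" by simp
        qed
      qed simp
      also have "\<dots> \<le> measure_pmf.prob T ((\<lambda>(p, q, p'). (p, q)) -` ?far) + measure_pmf.prob T ((\<lambda>(p, q, p'). (p', q)) -` ?far)"
        by (rule measure_Un_le) simp_all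
      also have "\<dots> = measure_pmf.prob (\<gamma> a) ?far + measure_pmf.prob (\<gamma> b) ?far"
        unfolding T[symmetric] measure_map_pmf ..
      also have "\<dots> < e" using far[OF aS] far[OF bS] e1 by linarith
      finally have bad: "measure_pmf.prob \<Gamma> ?Bad < e" .
      have cond: "pmf (map_pmf fst (\<gamma> c)) x = prob (?B c \<inter> (?it -` {x} \<inter> space \<mu>)) / prob (?B c)" if "c \<in> set_pmf ?S" for c x
        unfolding Bit Bpr \<gamma>fst[symmetric] using pmf_positive[OF that] by simp
      have "\<exists>\<phi> G. invertible_mp_map (uniform_measure \<mu> A) (uniform_measure \<mu> B) \<phi> \<and> G \<in> events \<and>
        measure (uniform_measure \<mu> A) G \<ge> 1 - measure_pmf.prob \<Gamma> ?Bad \<and> (\<forall>x\<in>G. (?it x, ?it (\<phi> x)) \<notin> ?Bad)"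
        unfolding ab(2,4)
        by (rule C.realise_coupling[OF simple_itinerary[OF P] Bev Bpos[OF ab(1)] Bev Bpos[OF ab(3)] fin\<Gamma>])
          (simp_all only: \<Gamma>1 \<Gamma>2 cond[OF aS(1)] cond[OF bS(1)])
      then obtain \<phi> G where "invertible_mp_map (uniform_measure \<mu> A) (uniform_measure \<mu> B) \<phi>" "G \<in> events"
        "measure (uniform_measure \<mu> A) G \<ge> 1 - measure_pmf.prob \<Gamma> ?Bad" "\<forall>x\<in>G. (?it x, ?it (\<phi> x)) \<notin> ?Bad"
        by blast
      then show "fbar_close left_shift P K (uniform_measure \<mu> A) (uniform_measure \<mu> B) e"
        unfolding fbar_close_def using bad by (intro exI[of _ \<phi>] exI[of _ G]) auto
    qed
  qed
qed

end

theorem theorem1: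
  fixes W :: "nat \<Rightarrow> 'a::finite list set"
    and \<epsilon> :: "nat \<Rightarrow> real"
    and k :: "nat \<Rightarrow> nat"
    and y :: "nat \<Rightarrow> nat \<Rightarrow> 'a list"
    and \<mu> :: "(int \<Rightarrow> 'a) measure"
  assumes "E_construction W \<epsilon> k y"
    and "is_frequency_measure W \<mu>"
  shows "loosely_Bernoulli \<mu> left_shift"
proof -
  have "prob_space \<mu>" using assms(2) by (simp add: is_frequency_measure_def)
  then interpret E_system W \<epsilon> k y \<mu>
    using assms by (simp add: E_system_def E_system_axioms_def)
  show ?thesis
    using mp_automorphism_shift loosely_Bernoulli_shift_process by (simp add: loosely_Bernoulli_def)
qed

end
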